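(* Let $M$ be a smooth paracompact manifold with $\dim M\ge 3$. Given any path geometry on $M$ (a foliation of the sphere bundle $STM$ as described in the context), let $\mathcal{D}$ be the distribution on the slit tangent bundle $T^\circ M$ defined by: $v\in\mathcal{D}_y\subset T_yT^\circ M$ if and only if the projection of $v$ to $STM$ is tangent to the leaf $\mathfrak{S}_{[y]}$ through $[y]$. Then there is a projective class of sprays on $T^\circ M$ such that $\mathcal{D}$ is spanned by $\Delta$ and any spray of the class.
   Context: $T^\circ M$ is the tangent bundle of $M$ with the zero section removed, $\tau:T^\circ M\to M$ the projection, and $\Delta=y^i\partial/\partial y^i$ the Liouville field. A spray is a smooth vector field $\Gamma$ on $T^\circ M$ such that $\tau_*\Gamma_{(x,y)}=y$ for all $(x,y)\in T^\circ M$ and $[\Delta,\Gamma]=\Gamma$. Two sprays are projectively equivalent if their geodesics (base integral curves) agree up to orientation-preserving reparametrization; the projective class of $\Gamma$ consists of all $\Gamma-2P\Delta$ with $P$ a smooth function on $T^\circ M$ satisfying $\Delta(P)=P$. The sphere bundle $\sigma:STM\to M$ is the quotient of $T^\circ M$ by the action generated by $\Delta$; a point $s=[y]$ of $STM$ is an equivalence class of non-zero vectors $y\in T_xM$, $x=\sigma(s)$, under multiplication by positive scalars. A path geometry on $M$ is a smooth foliation of $STM$ by oriented one-dimensional submanifolds $\mathfrak{S}$ such that, if $\mathfrak{S}_s$ is the leaf through $s=[y]$, then the oriented tangent space to $\sigma(\mathfrak{S}_s)$ at $x=\sigma(s)$ coincides with $[y]$ (that is, $\sigma_*$ of a positively oriented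 tangent vector to $\mathfrak{S}_s$ at $s$ is a positive multiple of $y$). *)

theory Defs
  imports "HOL-Analysis.Analysis"
begin

section \<open>Smooth maps between Euclidean spaces\<close>

text \<open>Intended for open \<open>S\<close> only.\<close>

primrec C_k_on :: "nat \<Rightarrow> 'a::euclidean_space set \<Rightarrow> ('a \<Rightarrow> 'b::real_normed_vector) \<Rightarrow> bool" where
  "C_k_on 0 S f \<longleftrightarrow> continuous_on S f"
| "C_k_on (Suc k) S f \<longleftrightarrow>
     (\<forall>x\<in>S. f differentiable (at x)) \<and>
     (\<forall>v. C_k_on k S (\<lambda>x. frechet_derivative f (at x) v))"

definition smooth_on :: "'a::euclidean_space set \<Rightarrow> ('a \<Rightarrow> 'b::real_normed_vector) \<Rightarrow> bool" where
  "smooth_on S f \<longleftrightarrow> (\<forall>k. C_k_on k S f)"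

section \<open>Manifolds\<close>

text \<open>
  A manifold is represented by a smooth atlas (not necessarily maximal). Points, topology and
  smooth structure are all derived from it. A chart is a pair of its domain and its coordinate map;
  the values of the coordinate map outside the domain are irrelevant. The dimension of the manifold
  is the dimension of the model space \<open>'m\<close>.
\<close>

type_synonym ('p, 'm) chart = "'p set \<times> ('p \<Rightarrow> 'm)"

definition chart_inv :: "('p, 'm) chart \<Rightarrow> 'm \<Rightarrow> 'p" where
  "chart_inv c = inv_into (fst c) (snd c)"

definition smooth_atlas :: "('p, 'm::euclidean_space) chart set \<Rightarrow> bool" where
  "smooth_atlas M \<longleftrightarrow>
     (\<forall>c\<in>M. inj_on (snd c) (fst c) \<and> open (snd c ` fst c)) \<and>
     (\<forall>c\<in>M. \<forall>d\<in>M. open (snd c ` (fst c \<inter> fst d)) \<and>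
        smooth_on (snd c ` (fst c \<inter> fst d)) (snd d \<circ> chart_inv c))"

definition points :: "('p, 'm) chart set \<Rightarrow> 'p set" where
  "points M = (\<Union>c\<in>M. fst c)"

definition mtop :: "('p, 'm::euclidean_space) chart set \<Rightarrow> 'p topology" where
  "mtop M = topology (\<lambda>W. W \<subseteq> points M \<and> (\<forall>c\<in>M. open (snd c ` (W \<inter> fst c))))"

lemma openin_mtop:
  assumes "smooth_atlas M"
  shows "openin (mtop M) W \<longleftrightarrow> W \<subseteq> points M \<and> (\<forall>c\<in>M. open (snd c ` (W \<inter> fst c)))"
proof -
  have inj: "inj_on (snd c) (fst c)" if "c \<in> M" for c
    using assms that by (auto simp: smooth_atlas_def)
  have int: "snd c ` (S \<inter> T \<inter> fst c) = snd c ` (S \<inter> fst c) \<inter> snd c ` (T \<inter> fst c)"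
    if "c \<in> M" for c S T
    using inj[OF that] by (auto simp: inj_on_def)
  have un: "snd c ` (\<Union>\<K> \<inter> fst c) = (\<Union>K\<in>\<K>. snd c ` (K \<inter> fst c))" for c :: "('a, 'b) chart" and \<K>
    by auto
  have "istopology (\<lambda>W. W \<subseteq> points M \<and> (\<forall>c\<in>M. open (snd c ` (W \<inter> fst c))))"
    unfolding istopology_def by (auto simp: int un)
  then show ?thesis
    by (simp add: mtop_def topology_inverse')
qed

definition paracompact_space :: "'p topology \<Rightarrow> bool" where
  "paracompact_space X \<longleftrightarrow>
     (\<forall>\<U>. (\<forall>U\<in>\<U>. openin X U) \<and> \<Union>\<U> = topspace X \<longrightarrow>
        (\<exists>\<V>. (\<forall>V\<in>\<V>. openin X V \<and> (\<exists>U\<in>\<U>. V \<subseteq> U)) \<and> \<Union>\<V> = topspace X \<and>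
             locally_finite_in X \<V>))"

definition smooth_manifold :: "('p, 'm::euclidean_space) chart set \<Rightarrow> bool" where
  "smooth_manifold M \<longleftrightarrow>
     smooth_atlas M \<and> Hausdorff_space (mtop M) \<and> paracompact_space (mtop M)"

section \<open>Tangent vectors\<close>

text \<open>
  A tangent vector at \<open>p\<close> is a pair of \<open>p\<close> and a family of coordinate vectors, one for each chart
  around \<open>p\<close>, related by the derivatives of the coordinate changes. The family is \<open>0\<close> at all
  other charts, so that equality of tangent vectors is equality in HOL.
\<close>

type_synonym ('p, 'm) tvec = "'p \<times> (('p, 'm) chart \<Rightarrow> 'm)"

definition tangent_space :: "('p, 'm::euclidean_space) chart set \<Rightarrow> 'p \<Rightarrow> ('p, 'm) tvec set" where
  "tangent_space M p = {(q, v). q = p \<and> p \<in> points M \<and>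
     (\<forall>c\<in>M. \<forall>d\<in>M. p \<in> fst c \<and> p \<in> fst d \<longrightarrow>
        v d = frechet_derivative (snd d \<circ> chart_inv c) (at (snd c p)) (v c)) \<and>
     (\<forall>c. \<not> (c \<in> M \<and> p \<in> fst c) \<longrightarrow> v c = 0)}"

definition tadd :: "('p, 'm::real_vector) tvec \<Rightarrow> ('p, 'm) tvec \<Rightarrow> ('p, 'm) tvec" where
  "tadd v w = (fst v, \<lambda>c. snd v c + snd w c)"

definition tscale :: "real \<Rightarrow> ('p, 'm::real_vector) tvec \<Rightarrow> ('p, 'm) tvec" where
  "tscale k v = (fst v, \<lambda>c. k *\<^sub>R snd v c)"

text \<open>
  Derivative of a function along a tangent vector, computed in some chart around the base point;
  for differentiable functions the choice of the chart does not matter.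
\<close>

definition vderiv ::
  "('p, 'm::euclidean_space) chart set \<Rightarrow> ('p, 'm) tvec \<Rightarrow> ('p \<Rightarrow> 'b::real_normed_vector) \<Rightarrow> 'b" where
  "vderiv M v f =
     (let c = (SOME c. c \<in> M \<and> fst v \<in> fst c)
      in frechet_derivative (f \<circ> chart_inv c) (at (snd c (fst v))) (snd v c))"

definition tangent_map ::
  "('p, 'm::euclidean_space) chart set \<Rightarrow> ('q, 'n::euclidean_space) chart set \<Rightarrow> ('p \<Rightarrow> 'q)
     \<Rightarrow> ('p, 'm) tvec \<Rightarrow> ('q, 'n) tvec" where
  "tangent_map M N f v =
     (f (fst v), \<lambda>d. if d \<in> N \<and> f (fst v) \<in> fst d then vderiv M v (snd d \<circ> f) else 0)"

section \<open>Smooth functions, maps and vector fields\<close>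

definition smooth_function :: "('p, 'm::euclidean_space) chart set \<Rightarrow> ('p \<Rightarrow> real) \<Rightarrow> bool" where
  "smooth_function M f \<longleftrightarrow> (\<forall>c\<in>M. smooth_on (snd c ` fst c) (f \<circ> chart_inv c))"

definition smooth_map ::
  "('p, 'm::euclidean_space) chart set \<Rightarrow> ('q, 'n::euclidean_space) chart set \<Rightarrow> ('p \<Rightarrow> 'q) \<Rightarrow> bool" where
  "smooth_map M N f \<longleftrightarrow>
     continuous_map (mtop M) (mtop N) f \<and>
     (\<forall>c\<in>M. \<forall>d\<in>N. smooth_on (snd c ` {p \<in> fst c. f p \<in> fst d}) (snd d \<circ> f \<circ> chart_inv c))"

definition coord_field ::
  "('p \<Rightarrow> ('p, 'm) tvec) \<Rightarrow> ('p, 'm) chart \<Rightarrow> 'm \<Rightarrow> 'm" where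
  "coord_field X c = (\<lambda>z. snd (X (chart_inv c z)) c)"

definition smooth_vector_field ::
  "('p, 'm::euclidean_space) chart set \<Rightarrow> ('p \<Rightarrow> ('p, 'm) tvec) \<Rightarrow> bool" where
  "smooth_vector_field M X \<longleftrightarrow>
     (\<forall>p\<in>points M. X p \<in> tangent_space M p) \<and>
     (\<forall>c\<in>M. smooth_on (snd c ` fst c) (coord_field X c))"

text \<open>In coordinates, \<open>[X, Y]\<^sup>i = X\<^sup>j \<partial>\<^sub>j Y\<^sup>i - Y\<^sup>j \<partial>\<^sub>j X\<^sup>i\<close>.\<close>

definition lie_bracket ::
  "('p, 'm::euclidean_space) chart set \<Rightarrow> ('p \<Rightarrow> ('p, 'm) tvec) \<Rightarrow> ('p \<Rightarrow> ('p, 'm) tvec)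
     \<Rightarrow> 'p \<Rightarrow> ('p, 'm) tvec" where
  "lie_bracket M X Y p =
     (p, \<lambda>c. if c \<in> M \<and> p \<in> fst c
             then frechet_derivative (coord_field Y c) (at (snd c p)) (snd (X p) c)
                - frechet_derivative (coord_field X c) (at (snd c p)) (snd (Y p) c)
             else 0)"

section \<open>The slit tangent bundle and sprays\<close>

text \<open>The points of the manifold below are the nonzero tangent vectors of \<open>M\<close>.\<close>

definition slit_chart ::
  "('p, 'm::euclidean_space) chart set \<Rightarrow> ('p, 'm) chart \<Rightarrow> (('p, 'm) tvec, 'm \<times> 'm) chart" where
  "slit_chart M c =
     ({y. y \<in> tangent_space M (fst y) \<and> fst y \<in> fst c \<and> snd y \<noteq> (\<lambda>_. 0)},
      \<lambda>y. (snd c (fst y), snd y c))"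

definition slit_bundle ::
  "('p, 'm::euclidean_space) chart set \<Rightarrow> (('p, 'm) tvec, 'm \<times> 'm) chart set" where
  "slit_bundle M = slit_chart M ` M"

text \<open>
  A chart of the slit tangent bundle maps \<open>y\<close> to its coordinates \<open>(x\<^sup>i, y\<^sup>i)\<close>, so the
  second component of \<open>snd C y\<close> is the coordinate vector \<open>y\<^sup>i\<close> in \<open>\<Delta> = y\<^sup>i \<partial>/\<partial>y\<^sup>i\<close>.
\<close>

definition liouville ::
  "('p, 'm::euclidean_space) chart set \<Rightarrow> ('p, 'm) tvec \<Rightarrow> (('p, 'm) tvec, 'm \<times> 'm) tvec" where
  "liouville M y =
     (y, \<lambda>C. if C \<in> slit_bundle M \<and> y \<in> fst C then (0, snd (snd C y)) else 0)"

definition spray ::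
  "('p, 'm::euclidean_space) chart set
     \<Rightarrow> (('p, 'm) tvec \<Rightarrow> (('p, 'm) tvec, 'm \<times> 'm) tvec) \<Rightarrow> bool" where
  "spray M \<Gamma> \<longleftrightarrow>
     smooth_vector_field (slit_bundle M) \<Gamma> \<and>
     (\<forall>y\<in>points (slit_bundle M). tangent_map (slit_bundle M) M fst (\<Gamma> y) = y) \<and>
     (\<forall>y\<in>points (slit_bundle M). lie_bracket (slit_bundle M) (liouville M) \<Gamma> y = \<Gamma> y)"

text \<open>
  Vector fields are total functions in HOL; only their values at points of the slit tangent bundle
  matter.
\<close>

definition projective_class ::
  "('p, 'm::euclidean_space) chart set
     \<Rightarrow> (('p, 'm) tvec \<Rightarrow> (('p, 'm) tvec, 'm \<times> 'm) tvec)
     \<Rightarrow> (('p, 'm) tvec \<Rightarrow> (('p, 'm) tvec, 'm \<times> 'm) tvec) set" where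
  "projective_class M \<Gamma> =
     {\<Gamma>'. \<exists>P. smooth_function (slit_bundle M) P \<and>
        (\<forall>y\<in>points (slit_bundle M). vderiv (slit_bundle M) (liouville M y) P = P y) \<and>
        (\<forall>y\<in>points (slit_bundle M). \<Gamma>' y = tadd (\<Gamma> y) (tscale (- 2 * P y) (liouville M y)))}"

section \<open>The sphere bundle\<close>

definition ray :: "('p, 'm::real_vector) tvec \<Rightarrow> ('p, 'm) tvec set" where
  "ray y = {tscale t y | t. 0 < t}"

definition sphere_proj :: "('p, 'm) tvec set \<Rightarrow> 'p" where
  "sphere_proj s = fst (SOME y. y \<in> s)"

text \<open>
  The sphere bundle has dimension \<open>2 * DIM('m) - 1\<close>; its model space is \<open>'m \<times> 'f\<close>, where \<open>'f\<close> is
  any Euclidean space with \<open>DIM('m) = DIM('f) + 1\<close>. A linear isomorphism from \<open>'m\<close> to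
  \<open>'f \<times> real\<close> provides fibre coordinates \<open>z / t\<close> on the open half of the rays with \<open>t > 0\<close>, where
  \<open>(z, t)\<close> is the image of a representative.
\<close>

definition sphere_chart ::
  "('p, 'm::euclidean_space) chart set \<Rightarrow> ('p, 'm) chart \<Rightarrow> ('m \<Rightarrow> 'f::euclidean_space \<times> real)
     \<Rightarrow> (('p, 'm) tvec set, 'm \<times> 'f) chart" where
  "sphere_chart M c L =
     ({ray y | y. y \<in> points (slit_bundle M) \<and> fst y \<in> fst c \<and> 0 < snd (L (snd y c))},
      \<lambda>s. let y = (SOME y. y \<in> s); (z, t) = L (snd y c) in (snd c (fst y), z /\<^sub>R t))"

definition sphere_bundle ::
  "'f::euclidean_space itself \<Rightarrow> ('p, 'm::euclidean_space) chart set
     \<Rightarrow> (('p, 'm) tvec set, 'm \<times> 'f) chart set" where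
  "sphere_bundle _ M = {sphere_chart M c L | c L. c \<in> M \<and> linear L \<and> bij L}"

section \<open>Foliations by oriented curves\<close>

text \<open>A one-dimensional manifold is modelled on \<open>real\<close>; its orientation is given by its atlas.\<close>

definition oriented_atlas :: "('p, real) chart set \<Rightarrow> bool" where
  "oriented_atlas L \<longleftrightarrow>
     (\<forall>c\<in>L. \<forall>d\<in>L. \<forall>p\<in>fst c \<inter> fst d.
        0 < frechet_derivative (snd d \<circ> chart_inv c) (at (snd c p)) 1)"

definition positive_tangent :: "('p, real) chart set \<Rightarrow> 'p \<Rightarrow> ('p, real) tvec \<Rightarrow> bool" where
  "positive_tangent L p w \<longleftrightarrow>
     w \<in> tangent_space L p \<and> (\<forall>c\<in>L. p \<in> fst c \<longrightarrow> 0 < snd w c)"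

definition immersed_submanifold ::
  "('p, 'l::euclidean_space) chart set \<Rightarrow> ('p, 'm::euclidean_space) chart set \<Rightarrow> bool" where
  "immersed_submanifold L N \<longleftrightarrow>
     smooth_manifold L \<and> points L \<subseteq> points N \<and> smooth_map L N (\<lambda>p. p) \<and>
     (\<forall>p\<in>points L. inj_on (tangent_map L N (\<lambda>p. p)) (tangent_space L p))"

text \<open>
  A flat chart: its image is a box, and every leaf meets its domain in countably many slices, on
  which all coordinates but the one along the basis vector \<open>u\<close> are constant.
\<close>

definition flat_chart ::
  "('p, 'm::euclidean_space) chart set \<Rightarrow> ('p, real) chart set set \<Rightarrow> ('p, 'm) chart \<Rightarrow> bool" where
  "flat_chart N \<F> c \<longleftrightarrow>
     smooth_atlas (insert c N) \<and> fst c \<subseteq> points N \<and> (\<exists>a b. snd c ` fst c = box a b) \<and>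
     (\<exists>u\<in>Basis. \<forall>L\<in>\<F>. \<exists>Z. countable Z \<and>
        points L \<inter> fst c = {q \<in> fst c. \<exists>z\<in>Z. \<forall>b\<in>Basis - {u}. snd c q \<bullet> b = z \<bullet> b})"

definition oriented_curve_foliation ::
  "('p, 'm::euclidean_space) chart set \<Rightarrow> ('p, real) chart set set \<Rightarrow> bool" where
  "oriented_curve_foliation N \<F> \<longleftrightarrow>
     (\<forall>L\<in>\<F>. immersed_submanifold L N \<and> oriented_atlas L \<and>
        connected_space (mtop L) \<and> points L \<noteq> {}) \<and>
     (\<Union>L\<in>\<F>. points L) = points N \<and>
     (\<forall>L\<in>\<F>. \<forall>L'\<in>\<F>. L \<noteq> L' \<longrightarrow> points L \<inter> points L' = {}) \<and>
     (\<forall>p\<in>points N. \<exists>c. p \<in> fst c \<and> flat_chart N \<F> c)"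

section \<open>Path geometries\<close>

definition path_geometry ::
  "'f::euclidean_space itself \<Rightarrow> ('p, 'm::euclidean_space) chart set
     \<Rightarrow> (('p, 'm) tvec set, real) chart set set \<Rightarrow> bool" where
  "path_geometry T M \<F> \<longleftrightarrow>
     oriented_curve_foliation (sphere_bundle T M) \<F> \<and>
     (\<forall>L\<in>\<F>. \<forall>s\<in>points L. \<forall>w. positive_tangent L s w \<longrightarrow>
        (\<forall>y\<in>s. \<exists>k>0.
           tangent_map (sphere_bundle T M) M sphere_proj
             (tangent_map L (sphere_bundle T M) (\<lambda>s. s) w) = tscale k y))"

definition path_distribution ::
  "'f::euclidean_space itself \<Rightarrow> ('p, 'm::euclidean_space) chart set
     \<Rightarrow> (('p, 'm) tvec set, real) chart set set
     \<Rightarrow> ('p, 'm) tvec \<Rightarrow> (('p, 'm) tvec, 'm \<times> 'm) tvec set" where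
  "path_distribution T M \<F> y =
     {v \<in> tangent_space (slit_bundle M) y.
        \<exists>L\<in>\<F>. ray y \<in> points L \<and>
          (\<exists>w\<in>tangent_space L (ray y).
             tangent_map (slit_bundle M) (sphere_bundle T M) ray v =
             tangent_map L (sphere_bundle T M) (\<lambda>s. s) w)}"

end

theory Submission
  imports Defs
begin

text \<open>
  In fibre coordinates on the sphere bundle the leaf through \<open>[y]\<close> has a tangent vector whose base
  component is \<open>y\<close>, because a positive tangent vector projects to a positive multiple of \<open>y\<close>. Lifted to
  the slit tangent bundle, this says that near every point \<open>\<D>\<close> is spanned by \<open>\<Delta>\<close> and a smooth
  field \<open>(y, G(x, y))\<close> with \<open>G\<close> homogeneous of degree \<open>2\<close> in \<open>y\<close>; the elements of \<open>\<D>\<close> over \<open>y\<close>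
  projecting to \<open>y\<close> form one coset of \<open>\<real>\<Delta>\<close>. A global smooth choice in these cosets comes from
  paracompactness: a locally finite sum \<open>E\<close> of bump functions times squared coordinate norms is smooth,
  positive and homogeneous of degree \<open>2\<close>, so \<open>\<Delta>(E) = 2E \<noteq> 0\<close> and the condition \<open>\<Gamma>(E) = 0\<close> selects exactly one
  element \<open>\<Gamma>\<close> of every coset.
\<close>

section \<open>Calculus of smooth maps\<close>

text \<open>A foliation hands over its leaves one at a time, as separate immersed curves, so the
  smooth dependence of the tangent line on the ray has to be extracted from flat charts. Along a
  leaf each transverse coordinate of such a chart takes countably many values on an interval, hence
  is constant there, and the leaf runs along one smooth coordinate field. That field determines the
  tangent line only up to an unknown factor; dividing by a coordinate of its base component removes
  the factor without a choice. The degree 2 of \<open>G\<close> consists of one factor from the base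
  velocity \<open>y\<close>, which also speeds up the motion of the ray, and one from passing from
  the fibre coordinate \<open>z / t\<close> back to \<open>z\<close>. Normalising by
  \<open>\<Gamma>(E) = 0\<close> confines all patching to the scalar function \<open>E\<close>. The
  condition mentions no chart, so local solutions agree on overlaps, and its homogeneity is
  inherited by the solution.\<close>

lemma frechet_derivative_eqI:
  "(f has_derivative f') (at x) \<Longrightarrow> frechet_derivative f (at x) = f'"
  using frechet_derivative_at by metis

lemma differentiable_frechetD:
  "f differentiable (at x) \<Longrightarrow> (f has_derivative frechet_derivative f (at x)) (at x)"
  using frechet_derivative_works by blast

text \<open>Both functions have the same set of derivatives at \<open>x\<close>, so
  \<open>frechet_derivative\<close> makes the same choice even where that set is empty. Openness
  matters because \<open>C_k_on\<close> differentiates in the whole space rather than within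
  \<open>S\<close>.\<close>

lemma frechet_derivative_cong_open:
  assumes "open S" "x \<in> S" "\<And>z. z \<in> S \<Longrightarrow> f z = g z"
  shows "f differentiable (at x) \<longleftrightarrow> g differentiable (at x)"
    and "frechet_derivative f (at x) = frechet_derivative g (at x)"
proof -
  have "(f has_derivative D) (at x) \<longleftrightarrow> (g has_derivative D) (at x)" for D
    using has_derivative_transform_within_open[OF _ assms(1,2)] assms(3) by metis
  then show "f differentiable (at x) \<longleftrightarrow> g differentiable (at x)"
    and "frechet_derivative f (at x) = frechet_derivative g (at x)"
    by (simp_all add: differentiable_def frechet_derivative_def)
qed

lemma C_k_on_cong:
  assumes "open S" "\<And>x. x \<in> S \<Longrightarrow> f x = g x" "C_k_on k S f"
  shows "C_k_on k S g"
  using assms(2,3)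
proof (induction k arbitrary: f g)
  case 0
  then show ?case using continuous_on_cong[of S S f g] by simp
next
  case (Suc k)
  note cong = frechet_derivative_cong_open[OF assms(1) _ Suc.prems(1)]
  show ?case
    using Suc.prems(2) Suc.IH[of "\<lambda>x. frechet_derivative f (at x) v" "\<lambda>x. frechet_derivative g (at x) v" for v]
    by (simp add: cong)
qed

lemma C_k_on_subset: "C_k_on k T f \<Longrightarrow> S \<subseteq> T \<Longrightarrow> C_k_on k S f"
  by (induction k arbitrary: f) (auto intro: continuous_on_subset)

lemma C_k_on_local:
  assumes "\<And>x. x \<in> S \<Longrightarrow> \<exists>T. open T \<and> x \<in> T \<and> C_k_on k T f"
  shows "C_k_on k S f"
  using assms
proof (induction k arbitrary: f)
  case 0
  have "isCont f x" if x: "x \<in> S" for x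
    using 0[OF x] by (auto simp: continuous_on_eq_continuous_at)
  then show ?case by (simp add: continuous_at_imp_continuous_on)
next
  case (Suc k)
  have "f differentiable (at x)" if "x \<in> S" for x
    using Suc.prems[OF that] by auto
  moreover have "C_k_on k S (\<lambda>x. frechet_derivative f (at x) v)" for v
    using Suc.prems by (intro Suc.IH) fastforce
  ultimately show ?case by simp
qed

text \<open>Lets the inductions below work with explicit derivative formulas in place of
  \<open>frechet_derivative\<close>.\<close>

lemma C_k_on_SucI:
  assumes "open S" "\<And>x. x \<in> S \<Longrightarrow> (f has_derivative f' x) (at x)"
    and "\<And>v. C_k_on k S (\<lambda>x. f' x v)"
  shows "C_k_on (Suc k) S f"
  using assms C_k_on_cong[OF assms(1) _ assms(3)] frechet_derivative_eqI[OF assms(2)]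
  by (auto simp: differentiable_def)

lemma C_k_on_SucD:
  assumes "C_k_on (Suc k) S f"
  shows "C_k_on k S f"
  using assms
proof (induction k arbitrary: f)
  case 0
  then show ?case
    by (auto intro!: continuous_at_imp_continuous_on differentiable_imp_continuous_within)
qed auto

lemma C_k_on_const: "C_k_on k S (\<lambda>_. a)"
  by (induction k arbitrary: a) auto

lemma C_k_on_bounded_linear:
  assumes "bounded_linear h" "open S" "C_k_on k S f"
  shows "C_k_on k S (\<lambda>x. h (f x))"
  using assms(3)
proof (induction k arbitrary: f)
  case 0
  then show ?case using assms(1) by (simp add: bounded_linear.continuous_on)
next
  case (Suc k)
  then show ?case
    by (intro C_k_on_SucI[OF assms(2), where f'="\<lambda>x v. h (frechet_derivative f (at x) v)"]
        bounded_linear.has_derivative[OF assms(1)] differentiable_frechetD) auto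
qed

lemma C_k_on_add:
  assumes "open S" "C_k_on k S f" "C_k_on k S g"
  shows "C_k_on k S (\<lambda>x. f x + g x)"
  using assms(2,3)
proof (induction k arbitrary: f g)
  case 0
  then show ?case by (simp add: continuous_on_add)
next
  case (Suc k)
  then show ?case
    by (intro C_k_on_SucI[OF assms(1), where
          f'="\<lambda>x v. frechet_derivative f (at x) v + frechet_derivative g (at x) v"]
        has_derivative_add differentiable_frechetD) auto
qed

lemma C_k_on_sum:
  assumes "open S" "\<And>i. i \<in> I \<Longrightarrow> C_k_on k S (f i)"
  shows "C_k_on k S (\<lambda>x. \<Sum>i\<in>I. f i x)"
  using assms(2)
  by (induction I rule: infinite_finite_induct) (simp_all add: C_k_on_const C_k_on_add[OF assms(1)])

text \<open>The product rule gives two terms of the same shape, each with one factor differentiated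
  and the other lowered by one order of smoothness; the induction therefore runs over all pairs
  \<open>f\<close>, \<open>g\<close>.\<close>

lemma C_k_on_bounded_bilinear:
  assumes "bounded_bilinear h" "open S" "C_k_on k S f" "C_k_on k S g"
  shows "C_k_on k S (\<lambda>x. h (f x) (g x))"
  using assms(3,4)
proof (induction k arbitrary: f g)
  case 0
  then show ?case using bounded_bilinear.continuous_on[OF assms(1)] by simp
next
  case (Suc k)
  have "((\<lambda>x. h (f x) (g x)) has_derivative
      (\<lambda>v. h (f x) (frechet_derivative g (at x) v) + h (frechet_derivative f (at x) v) (g x))) (at x)"
    if "x \<in> S" for x
    using Suc.prems that by (intro bounded_bilinear.FDERIV[OF assms(1)] differentiable_frechetD) auto
  moreover have "C_k_on k S
      (\<lambda>x. h (f x) (frechet_derivative g (at x) v) + h (frechet_derivative f (at x) v) (g x))" for v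
    using Suc.prems C_k_on_SucD[OF Suc.prems(1)] C_k_on_SucD[OF Suc.prems(2)]
    by (intro C_k_on_add[OF assms(2)] Suc.IH) auto
  ultimately show ?case by (rule C_k_on_SucI[OF assms(2)])
qed

lemma linear_eq_sum_Basis:
  fixes h :: "'a::euclidean_space \<Rightarrow> 'b::real_vector"
  assumes "linear h"
  shows "h v = (\<Sum>b\<in>Basis. (v \<bullet> b) *\<^sub>R h b)"
proof -
  have "h v = h (\<Sum>b\<in>Basis. (v \<bullet> b) *\<^sub>R b)" by (simp add: euclidean_representation)
  then show ?thesis by (simp add: linear_sum[OF assms] linear_cmul[OF assms])
qed

lemma C_k_on_compose:
  fixes g :: "'a::euclidean_space \<Rightarrow> 'b::euclidean_space" and f :: "'b \<Rightarrow> 'c::real_normed_vector"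
  assumes "open S" "open T" "C_k_on k S g" "C_k_on k T f" "g ` S \<subseteq> T"
  shows "C_k_on k S (\<lambda>x. f (g x))"
  using assms(3,4)
proof (induction k arbitrary: f)
  case 0
  then show ?case using assms(5) by (auto intro: continuous_on_compose2)
next
  case (Suc k)
  \<comment> \<open>The chain rule evaluates the derivative of \<open>f\<close> in the moving
    direction \<open>frechet_derivative g (at x) v\<close>, whereas \<open>C_k_on\<close> speaks of
    fixed directions only. Expanding that direction in the basis leaves products to which the
    induction hypothesis applies.\<close>
  let ?D = "\<lambda>x v. \<Sum>b\<in>Basis. (frechet_derivative g (at x) v \<bullet> b) *\<^sub>R frechet_derivative f (at (g x)) b"
  have "((\<lambda>x. f (g x)) has_derivative ?D x) (at x)" if x: "x \<in> S" for x
  proof -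
    have f: "f differentiable (at (g x))" and g: "g differentiable (at x)"
      using Suc.prems assms(5) x by auto
    have "((\<lambda>x. f (g x)) has_derivative
        (\<lambda>v. frechet_derivative f (at (g x)) (frechet_derivative g (at x) v))) (at x)"
      using has_derivative_compose[OF differentiable_frechetD[OF g] differentiable_frechetD[OF f]] .
    moreover have "(\<lambda>v. frechet_derivative f (at (g x)) (frechet_derivative g (at x) v)) = ?D x"
      by (intro ext linear_eq_sum_Basis linear_frechet_derivative f)
    ultimately show ?thesis by simp
  qed
  moreover have "C_k_on k S (\<lambda>x. ?D x v)" for v
    using Suc.prems
    by (intro C_k_on_sum C_k_on_bounded_bilinear[OF bounded_bilinear_scaleR]
        C_k_on_bounded_linear[OF bounded_linear_inner_left] Suc.IH C_k_on_SucD[OF Suc.prems(1)])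
      (auto simp: assms)
  ultimately show ?case by (rule C_k_on_SucI[OF assms(1)])
qed

lemma C_k_on_inverse:
  fixes f :: "'a::euclidean_space \<Rightarrow> real"
  assumes "open S" "C_k_on k S f" "\<And>x. x \<in> S \<Longrightarrow> f x \<noteq> 0"
  shows "C_k_on k S (\<lambda>x. inverse (f x))"
  using assms(2)
proof (induction k)
  case 0
  then show ?case using assms(3) by (auto intro: continuous_on_inverse)
next
  case (Suc k)
  have "((\<lambda>x. inverse (f x)) has_derivative
      (\<lambda>v. - (inverse (f x) * frechet_derivative f (at x) v * inverse (f x)))) (at x)" if "x \<in> S" for x
    using Suc.prems that assms(3) by (intro Deriv.has_derivative_inverse differentiable_frechetD) auto
  moreover have "C_k_on k S (\<lambda>x. - (inverse (f x) * frechet_derivative f (at x) v * inverse (f x)))" for v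
    using Suc.prems C_k_on_SucD[OF Suc.prems]
    by (intro C_k_on_bounded_linear[OF bounded_linear_minus[OF bounded_linear_ident]]
        C_k_on_bounded_bilinear[OF bounded_bilinear_mult] Suc.IH assms(1)) auto
  ultimately show ?case by (rule C_k_on_SucI[OF assms(1)])
qed

lemma smooth_on_cong: "open S \<Longrightarrow> (\<And>x. x \<in> S \<Longrightarrow> f x = g x) \<Longrightarrow> smooth_on S f \<Longrightarrow> smooth_on S g"
  unfolding smooth_on_def by (blast intro: C_k_on_cong)

lemma smooth_on_subset: "smooth_on T f \<Longrightarrow> S \<subseteq> T \<Longrightarrow> smooth_on S f"
  unfolding smooth_on_def using C_k_on_subset by blast

lemma smooth_on_local:
  "(\<And>x. x \<in> S \<Longrightarrow> \<exists>T. open T \<and> x \<in> T \<and> smooth_on T f) \<Longrightarrow> smooth_on S f"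
  unfolding smooth_on_def by (meson C_k_on_local)

lemma smooth_on_const: "smooth_on S (\<lambda>_. a)"
  by (simp add: smooth_on_def C_k_on_const)

lemma smooth_on_id: "open S \<Longrightarrow> smooth_on S (\<lambda>x. x)"
  unfolding smooth_on_def
proof
  fix k assume "open S"
  then show "C_k_on k S (\<lambda>x. x)"
    by (cases k) (auto intro: C_k_on_SucI[of S "\<lambda>x. x" "\<lambda>_ v. v"] C_k_on_const simp del: C_k_on.simps(2))
qed

lemma smooth_on_bounded_linear:
  "bounded_linear h \<Longrightarrow> open S \<Longrightarrow> smooth_on S f \<Longrightarrow> smooth_on S (\<lambda>x. h (f x))"
  by (simp add: smooth_on_def C_k_on_bounded_linear)

lemma smooth_on_linear:
  fixes h :: "'b::euclidean_space \<Rightarrow> 'c::real_normed_vector"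
  shows "linear h \<Longrightarrow> open S \<Longrightarrow> smooth_on S f \<Longrightarrow> smooth_on S (\<lambda>x. h (f x))"
  by (rule smooth_on_bounded_linear) (rule linear_conv_bounded_linear[THEN iffD1])

lemma smooth_on_add:
  "open S \<Longrightarrow> smooth_on S f \<Longrightarrow> smooth_on S g \<Longrightarrow> smooth_on S (\<lambda>x. f x + g x)"
  by (simp add: smooth_on_def C_k_on_add)

lemma smooth_on_sum:
  "open S \<Longrightarrow> (\<And>i. i \<in> I \<Longrightarrow> smooth_on S (f i)) \<Longrightarrow> smooth_on S (\<lambda>x. \<Sum>i\<in>I. f i x)"
  by (simp add: smooth_on_def C_k_on_sum)

lemma smooth_on_bounded_bilinear:
  "bounded_bilinear h \<Longrightarrow> open S \<Longrightarrow> smooth_on S f \<Longrightarrow> smooth_on S g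
    \<Longrightarrow> smooth_on S (\<lambda>x. h (f x) (g x))"
  by (simp add: smooth_on_def C_k_on_bounded_bilinear)

lemmas smooth_on_mult = smooth_on_bounded_bilinear[OF bounded_bilinear_mult]
lemmas smooth_on_scaleR = smooth_on_bounded_bilinear[OF bounded_bilinear_scaleR]
lemmas smooth_on_inner = smooth_on_bounded_bilinear[OF bounded_bilinear_inner]
lemmas smooth_on_minus = smooth_on_bounded_linear[OF bounded_linear_minus[OF bounded_linear_ident]]
lemmas smooth_on_fst = smooth_on_bounded_linear[OF bounded_linear_fst]
lemmas smooth_on_snd = smooth_on_bounded_linear[OF bounded_linear_snd]

lemma smooth_on_diff:
  "open S \<Longrightarrow> smooth_on S f \<Longrightarrow> smooth_on S g \<Longrightarrow> smooth_on S (\<lambda>x. f x - g x)"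
  using smooth_on_add[OF _ _ smooth_on_minus, of S f g] by simp

lemma smooth_on_Pair:
  assumes "open S" "smooth_on S f" "smooth_on S g"
  shows "smooth_on S (\<lambda>x. (f x, g x))"
proof -
  have "smooth_on S (\<lambda>x. (f x, 0) + (0, g x))"
    using assms bounded_linear_Pair[OF bounded_linear_ident bounded_linear_zero]
      bounded_linear_Pair[OF bounded_linear_zero bounded_linear_ident]
    by (intro smooth_on_add smooth_on_bounded_linear[where h="\<lambda>z. (z, 0)"]
        smooth_on_bounded_linear[where h="\<lambda>z. (0, z)"]) auto
  then show ?thesis by simp
qed

lemma smooth_on_inverse:
  fixes f :: "'a::euclidean_space \<Rightarrow> real"
  shows "open S \<Longrightarrow> smooth_on S f \<Longrightarrow> (\<And>x. x \<in> S \<Longrightarrow> f x \<noteq> 0) \<Longrightarrow> smooth_on S (\<lambda>x. inverse (f x))"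
  by (simp add: smooth_on_def C_k_on_inverse)

lemma smooth_on_compose:
  fixes g :: "'a::euclidean_space \<Rightarrow> 'b::euclidean_space"
  shows "open S \<Longrightarrow> open T \<Longrightarrow> smooth_on S g \<Longrightarrow> smooth_on T f \<Longrightarrow> g ` S \<subseteq> T
    \<Longrightarrow> smooth_on S (\<lambda>x. f (g x))"
  by (simp add: smooth_on_def C_k_on_compose)

lemma smooth_on_imp_differentiable: "smooth_on S f \<Longrightarrow> x \<in> S \<Longrightarrow> f differentiable (at x)"
  unfolding smooth_on_def by (drule spec[of _ "Suc 0"]) simp

lemma smooth_on_imp_has_derivative:
  "smooth_on S f \<Longrightarrow> x \<in> S \<Longrightarrow> (f has_derivative frechet_derivative f (at x)) (at x)"
  using smooth_on_imp_differentiable differentiable_frechetD by blast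

lemma smooth_on_imp_continuous_on: "smooth_on S f \<Longrightarrow> continuous_on S f"
  unfolding smooth_on_def by (drule spec[of _ 0]) simp

text \<open>Smoothness in the point and in the direction jointly, again by expanding the direction
  in the basis. The fibre components of the transition maps of the slit tangent bundle have exactly
  this form.\<close>

lemma smooth_on_frechet_derivative:
  fixes f :: "'b::euclidean_space \<Rightarrow> 'c::real_normed_vector"
    and g h :: "'a::euclidean_space \<Rightarrow> 'b"
  assumes "open S" "open T" "smooth_on T f" "smooth_on S g" "smooth_on S h" "g ` S \<subseteq> T"
  shows "smooth_on S (\<lambda>x. frechet_derivative f (at (g x)) (h x))"
proof -
  have "smooth_on T (\<lambda>x. frechet_derivative f (at x) b)" for b
    unfolding smooth_on_def
  proof
    fix k
    have "C_k_on (Suc k) T f" using assms(3) unfolding smooth_on_def by blast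
    then show "C_k_on k T (\<lambda>x. frechet_derivative f (at x) b)" by simp
  qed
  then have "smooth_on S (\<lambda>x. frechet_derivative f (at (g x)) b)" for b
    by (rule smooth_on_compose[OF assms(1,2,4) _ assms(6)])
  moreover have "smooth_on S (\<lambda>x. h x \<bullet> b)" for b
    by (rule smooth_on_inner[OF assms(1,5) smooth_on_const])
  ultimately have "smooth_on S (\<lambda>x. \<Sum>b\<in>Basis. (h x \<bullet> b) *\<^sub>R frechet_derivative f (at (g x)) b)"
    by (intro smooth_on_sum[OF assms(1)] smooth_on_scaleR[OF assms(1)])
  moreover have "(\<Sum>b\<in>Basis. (h x \<bullet> b) *\<^sub>R frechet_derivative f (at (g x)) b)
      = frechet_derivative f (at (g x)) (h x)" if "x \<in> S" for x
    by (rule linear_eq_sum_Basis[OF linear_frechet_derivative, symmetric])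
      (use smooth_on_imp_differentiable[OF assms(3)] assms(6) that in auto)
  ultimately show ?thesis by (rule smooth_on_cong[OF assms(1), rotated])
qed

section \<open>A smooth function vanishing on the negative half-line\<close>

definition flat_exp :: "nat \<Rightarrow> real \<Rightarrow> real" where
  "flat_exp n t = (if 0 < t then inverse t ^ n * exp (- inverse t) else 0)"

text \<open>For \<open>t > 0\<close> the member \<open>n\<close> of the family is
  \<open>t^(-n) exp (-1/t)\<close>. Carrying the power \<open>n\<close> along makes the family
  closed under differentiation up to linear combinations, so that smoothness of all members follows
  by one induction.\<close>

lemma has_derivative_flat_exp:
  "(flat_exp n has_real_derivative flat_exp (n + 2) t - n * flat_exp (Suc n) t) (at t)"
proof (cases t "0 :: real" rule: linorder_cases)
  case less
  have "((\<lambda>_. 0) has_real_derivative 0) (at t)" by simp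
  then have "(flat_exp n has_real_derivative 0) (at t)"
    by (rule has_field_derivative_transform_within_open[of _ _ _ "{..<0}"]) (use less in \<open>auto simp: flat_exp_def\<close>)
  then show ?thesis using less by (simp add: flat_exp_def)
next
  case greater
  have "((\<lambda>t. inverse t ^ n * exp (- inverse t)) has_real_derivative
      flat_exp (n + 2) t - n * flat_exp (Suc n) t) (at t)"
  proof (rule DERIV_cong)
    show "((\<lambda>t. inverse t ^ n * exp (- inverse t)) has_real_derivative
        real n * inverse t ^ (n - 1) * (- (inverse t ^ 2)) * exp (- inverse t)
        + exp (- inverse t) * inverse t ^ 2 * inverse t ^ n) (at t)"
      using greater by (auto intro!: derivative_eq_intros simp: power2_eq_square)
    have "real n * i ^ (n - 1) * (- (i ^ 2)) * e + e * i ^ 2 * i ^ n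
        = i ^ (n + 2) * e - n * (i ^ Suc n * e)" for i e :: real
      by (cases n) (simp_all add: power2_eq_square)
    with greater show "real n * inverse t ^ (n - 1) * (- (inverse t ^ 2)) * exp (- inverse t)
        + exp (- inverse t) * inverse t ^ 2 * inverse t ^ n
        = flat_exp (n + 2) t - n * flat_exp (Suc n) t"
      unfolding flat_exp_def by simp
  qed
  then show ?thesis
    by (rule has_field_derivative_transform_within_open[of _ _ _ "{0<..}"]) (use greater in \<open>auto simp: flat_exp_def\<close>)
next
  case equal
  have l: "((\<lambda>h. (flat_exp n (0 + h) - flat_exp n 0) / h) \<longlongrightarrow> 0) (at_left 0)"
    by (rule tendsto_eventually) (auto simp: flat_exp_def eventually_at_filter)
  \<comment> \<open>Substituting \<open>x = 1/h\<close> turns the right difference quotient at 0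
    into \<open>x^(n+1) / exp x\<close>, which tends to 0 at infinity.\<close>
  have "((\<lambda>h::real. inverse h ^ n * exp (- inverse h) / h) \<longlongrightarrow> 0) (at_right 0)"
  proof -
    have "((\<lambda>x::real. x ^ Suc n / exp x) \<longlongrightarrow> 0) at_top"
      by (rule tendsto_power_div_exp_0)
    from filterlim_compose[OF this filterlim_inverse_at_top_right]
    moreover have "inverse h ^ Suc n / exp (inverse h) = inverse h ^ n * exp (- inverse h) / h" for h :: real
      by (simp add: exp_minus divide_inverse)
    ultimately show ?thesis by simp
  qed
  moreover have "\<forall>\<^sub>F h in at_right 0.
      inverse h ^ n * exp (- inverse h) / h = (flat_exp n (0 + h) - flat_exp n 0) / h"
    by (auto simp: flat_exp_def eventually_at_filter)
  ultimately have r: "((\<lambda>h. (flat_exp n (0 + h) - flat_exp n 0) / h) \<longlongrightarrow> 0) (at_right 0)"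
    by (rule Lim_transform_eventually)
  have "(flat_exp n has_real_derivative 0) (at 0)"
    unfolding DERIV_def by (rule filterlim_split_at[OF l r])
  moreover have "flat_exp m 0 = 0" for m by (simp add: flat_exp_def)
  ultimately show ?thesis using equal by simp
qed

lemma smooth_on_flat_exp: "smooth_on UNIV (flat_exp n)"
  unfolding smooth_on_def
proof
  fix k show "C_k_on k UNIV (flat_exp n)"
  proof (induction k arbitrary: n)
    case 0
    have "isCont (flat_exp n) t" for t
      using has_derivative_flat_exp by (rule DERIV_isCont)
    then show ?case by (simp add: continuous_at_imp_continuous_on)
  next
    case (Suc k)
    have "C_k_on k UNIV (\<lambda>t. (flat_exp (n + 2) t + (- real n) * flat_exp (Suc n) t) * v)" for v
      using Suc.IH
      by (intro C_k_on_bounded_bilinear[OF bounded_bilinear_mult] C_k_on_add C_k_on_const) auto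
    moreover have "(flat_exp n has_derivative
        (\<lambda>v. (flat_exp (n + 2) t + (- real n) * flat_exp (Suc n) t) * v)) (at t)" for t
      using has_derivative_flat_exp[of n t] by (simp add: has_field_derivative_def)
    ultimately show ?case by (intro C_k_on_SucI) auto
  qed
qed

section \<open>Charts and tangent vectors\<close>

lemma chart_inv_into: "x \<in> snd c ` S \<Longrightarrow> S \<subseteq> fst c \<Longrightarrow> chart_inv c x \<in> fst c"
  unfolding chart_inv_def by (auto intro: inv_into_into)

lemma chart_chart_inv: "x \<in> snd c ` S \<Longrightarrow> S \<subseteq> fst c \<Longrightarrow> snd c (chart_inv c x) = x"
  unfolding chart_inv_def by (auto intro: f_inv_into_f)

lemma chart_inv_chart: "smooth_atlas M \<Longrightarrow> c \<in> M \<Longrightarrow> p \<in> fst c \<Longrightarrow> chart_inv c (snd c p) = p"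
  by (simp add: smooth_atlas_def chart_inv_def)

lemma chart_inv_mem:
  assumes "smooth_atlas M" "c \<in> M" "x \<in> snd c ` S" "S \<subseteq> fst c"
  shows "chart_inv c x \<in> S"
  using assms chart_inv_chart[OF assms(1,2)] by auto

lemma chart_image_open: "smooth_atlas M \<Longrightarrow> c \<in> M \<Longrightarrow> open (snd c ` fst c)"
  by (simp add: smooth_atlas_def)

lemma chart_overlap_open: "smooth_atlas M \<Longrightarrow> c \<in> M \<Longrightarrow> d \<in> M \<Longrightarrow> open (snd c ` (fst c \<inter> fst d))"
  by (simp add: smooth_atlas_def)

lemma transition_smooth:
  "smooth_atlas M \<Longrightarrow> c \<in> M \<Longrightarrow> d \<in> M
    \<Longrightarrow> smooth_on (snd c ` (fst c \<inter> fst d)) (snd d \<circ> chart_inv c)"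
  by (simp add: smooth_atlas_def)

abbreviation coord_change :: "('p, 'm::euclidean_space) chart \<Rightarrow> ('p, 'n::euclidean_space) chart \<Rightarrow> 'p \<Rightarrow> 'm \<Rightarrow> 'n" where
  "coord_change c d p \<equiv> frechet_derivative (snd d \<circ> chart_inv c) (at (snd c p))"

lemma coord_change_has_derivative:
  assumes "smooth_atlas M" "c \<in> M" "d \<in> M" "p \<in> fst c" "p \<in> fst d"
  shows "((snd d \<circ> chart_inv c) has_derivative coord_change c d p) (at (snd c p))"
  using smooth_on_imp_has_derivative[OF transition_smooth[OF assms(1-3)]] assms(4,5) by blast

lemma coord_change_linear:
  assumes "smooth_atlas M" "c \<in> M" "d \<in> M" "p \<in> fst c" "p \<in> fst d"
  shows "linear (coord_change c d p)"
  using coord_change_has_derivative[OF assms] has_derivative_linear by blast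

lemma has_derivative_change_chart:
  assumes A: "smooth_atlas M" "c \<in> M" "d \<in> M" and p: "p \<in> fst c" "p \<in> fst d"
    and D: "((f \<circ> chart_inv c) has_derivative D) (at (snd c p))"
  shows "((f \<circ> chart_inv d) has_derivative (\<lambda>v. D (coord_change d c p v))) (at (snd d p))"
proof -
  have "(((f \<circ> chart_inv c) \<circ> (snd c \<circ> chart_inv d)) has_derivative D \<circ> coord_change d c p) (at (snd d p))"
    using D by (intro diff_chain_at[OF coord_change_has_derivative[OF A(1,3,2) p(2,1)]])
      (simp add: chart_inv_chart[OF A(1,3) p(2)])
  then show ?thesis
    unfolding comp_def[of D]
  proof (rule has_derivative_transform_within_open[OF _ chart_overlap_open[OF A(1,3,2)]])
    show "snd d p \<in> snd d ` (fst d \<inter> fst c)" using p by auto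
    fix x assume "x \<in> snd d ` (fst d \<inter> fst c)"
    then have "chart_inv d x \<in> fst c"
      using chart_inv_mem[OF A(1,3), of x "fst d \<inter> fst c"] by simp
    then show "((f \<circ> chart_inv c) \<circ> (snd c \<circ> chart_inv d)) x = (f \<circ> chart_inv d) x"
      by (simp add: chart_inv_chart[OF A(1,2)])
  qed
qed

lemma coord_change_refl:
  assumes "smooth_atlas M" "c \<in> M" "p \<in> fst c"
  shows "coord_change c c p v = v"
proof -
  have "((snd c \<circ> chart_inv c) has_derivative (\<lambda>v. v)) (at (snd c p))"
    by (rule has_derivative_transform_within_open[OF has_derivative_ident chart_image_open[OF assms(1,2)]])
      (use assms(3) chart_chart_inv[of _ c "fst c"] in auto)
  then show ?thesis by (simp add: frechet_derivative_eqI)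
qed

lemma coord_change_trans:
  assumes "smooth_atlas M" "c \<in> M" "d \<in> M" "e \<in> M" "p \<in> fst c" "p \<in> fst d" "p \<in> fst e"
  shows "coord_change d e p (coord_change c d p v) = coord_change c e p v"
  using has_derivative_change_chart[OF assms(1,3,2,6,5) coord_change_has_derivative[OF assms(1,3,4,6,7)]]
  by (simp add: frechet_derivative_eqI)

lemma tangent_space_iff:
  "v \<in> tangent_space M p \<longleftrightarrow> fst v = p \<and> p \<in> points M \<and>
    (\<forall>c\<in>M. \<forall>d\<in>M. p \<in> fst c \<and> p \<in> fst d \<longrightarrow> snd v d = coord_change c d p (snd v c)) \<and>
    (\<forall>c. \<not> (c \<in> M \<and> p \<in> fst c) \<longrightarrow> snd v c = 0)"
  by (simp only: tangent_space_def mem_Collect_eq case_prod_beta)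

lemma tangent_spaceI:
  assumes "fst v = p" "p \<in> points M"
    and "\<And>c d. c \<in> M \<Longrightarrow> d \<in> M \<Longrightarrow> p \<in> fst c \<Longrightarrow> p \<in> fst d \<Longrightarrow> snd v d = coord_change c d p (snd v c)"
    and "\<And>c. \<not> (c \<in> M \<and> p \<in> fst c) \<Longrightarrow> snd v c = 0"
  shows "v \<in> tangent_space M p"
  unfolding tangent_space_iff using assms by blast

lemma tangent_space_coord_change:
  assumes "v \<in> tangent_space M p" "c \<in> M" "d \<in> M" "p \<in> fst c" "p \<in> fst d"
  shows "snd v d = coord_change c d p (snd v c)"
  using assms unfolding tangent_space_iff by blast

lemma tangent_space_fst: "v \<in> tangent_space M p \<Longrightarrow> fst v = p"
  unfolding tangent_space_iff by blast

lemma tangent_space_0: "v \<in> tangent_space M p \<Longrightarrow> \<not> (c \<in> M \<and> p \<in> fst c) \<Longrightarrow> snd v c = 0"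
  unfolding tangent_space_iff by blast

lemma tangent_space_points: "v \<in> tangent_space M p \<Longrightarrow> p \<in> points M"
  unfolding tangent_space_iff by blast

text \<open>Inverse to reading off the component in \<open>c\<close>: for a chart \<open>c\<close>
  around \<open>p\<close>, every tangent vector at \<open>p\<close> arises from exactly one
  \<open>v\<close>. Statements about tangent vectors thereby reduce to one chart.\<close>

definition tvec_of ::
  "('p, 'm::euclidean_space) chart set \<Rightarrow> ('p, 'm) chart \<Rightarrow> 'p \<Rightarrow> 'm \<Rightarrow> ('p, 'm) tvec" where
  "tvec_of M c p v = (p, \<lambda>d. if d \<in> M \<and> p \<in> fst d then coord_change c d p v else 0)"

lemma fst_tvec_of [simp]: "fst (tvec_of M c p v) = p"
  by (simp add: tvec_of_def)

lemma snd_tvec_of: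
  assumes "smooth_atlas M" "c \<in> M" "p \<in> fst c"
  shows "snd (tvec_of M c p v) c = v"
  using assms by (simp add: tvec_of_def coord_change_refl)

lemma tvec_of_tangent:
  assumes "smooth_atlas M" "c \<in> M" "p \<in> fst c"
  shows "tvec_of M c p v \<in> tangent_space M p"
proof (rule tangent_spaceI)
  show "snd (tvec_of M c p v) e = coord_change d e p (snd (tvec_of M c p v) d)"
    if "d \<in> M" "e \<in> M" "p \<in> fst d" "p \<in> fst e" for d e
    using coord_change_trans[OF assms(1,2) that(1,2) assms(3) that(3,4), of v] that
    by (simp add: tvec_of_def)
qed (use assms in \<open>auto simp: points_def tvec_of_def\<close>)

lemma tangent_space_eq_tvec_of:
  assumes "v \<in> tangent_space M p" "c \<in> M" "p \<in> fst c"
  shows "v = tvec_of M c p (snd v c)"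
proof (rule prod_eqI)
  show "snd v = snd (tvec_of M c p (snd v c))"
  proof
    fix d show "snd v d = snd (tvec_of M c p (snd v c)) d"
    proof (cases "d \<in> M \<and> p \<in> fst d")
      case True
      then show ?thesis
        using tangent_space_coord_change[OF assms(1,2) _ assms(3), of d] by (simp add: tvec_of_def)
    next
      case False
      then have "snd (tvec_of M c p (snd v c)) d = 0" by (auto simp: tvec_of_def)
      then show ?thesis using tangent_space_0[OF assms(1) False] by simp
    qed
  qed
qed (use tangent_space_fst[OF assms(1)] in simp)

lemma tangent_space_eqI:
  assumes "v \<in> tangent_space M p" "w \<in> tangent_space M p" "c \<in> M" "p \<in> fst c" "snd v c = snd w c"
  shows "v = w"
  using tangent_space_eq_tvec_of[OF assms(1,3,4)] tangent_space_eq_tvec_of[OF assms(2,3,4)] assms(5)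
  by simp

text \<open>Coordinate changes are linear, so a component that vanishes in one chart vanishes in all
  of them.\<close>

lemma tangent_space_nonzero_iff:
  assumes "smooth_atlas M" "v \<in> tangent_space M p" "c \<in> M" "p \<in> fst c"
  shows "snd v = (\<lambda>_. 0) \<longleftrightarrow> snd v c = 0"
proof
  assume 0: "snd v c = 0"
  have "snd v d = 0" for d
  proof (cases "d \<in> M \<and> p \<in> fst d")
    case True
    then have "snd v d = coord_change c d p 0"
      using tangent_space_coord_change[OF assms(2,3) _ assms(4), of d] 0 by simp
    then show ?thesis
      using linear_0[OF coord_change_linear[OF assms(1,3) _ assms(4), of d]] True by simp
  qed (rule tangent_space_0[OF assms(2)])
  then show "snd v = (\<lambda>_. 0)" by (rule ext)
qed simp

lemma tadd_simps [simp]: "fst (tadd v w) = fst v" "snd (tadd v w) c = snd v c + snd w c"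
  by (simp_all add: tadd_def)

lemma tscale_simps [simp]: "fst (tscale k v) = fst v" "snd (tscale k v) c = k *\<^sub>R snd v c"
  by (simp_all add: tscale_def)

lemma tadd_tangent:
  assumes "smooth_atlas M" "v \<in> tangent_space M p" "w \<in> tangent_space M p"
  shows "tadd v w \<in> tangent_space M p"
proof (rule tangent_spaceI)
  show "fst (tadd v w) = p" "p \<in> points M"
    using tangent_space_fst[OF assms(2)] tangent_space_points[OF assms(2)] by simp_all
  show "snd (tadd v w) d = coord_change c d p (snd (tadd v w) c)"
    if "c \<in> M" "d \<in> M" "p \<in> fst c" "p \<in> fst d" for c d
    unfolding tadd_simps linear_add[OF coord_change_linear[OF assms(1) that]]
      tangent_space_coord_change[OF assms(2) that] tangent_space_coord_change[OF assms(3) that] ..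
  show "snd (tadd v w) c = 0" if "\<not> (c \<in> M \<and> p \<in> fst c)" for c
    using tangent_space_0[OF assms(2) that] tangent_space_0[OF assms(3) that] by simp
qed

lemma tscale_tangent:
  assumes "smooth_atlas M" "v \<in> tangent_space M p"
  shows "tscale k v \<in> tangent_space M p"
proof (rule tangent_spaceI)
  show "fst (tscale k v) = p" "p \<in> points M"
    using tangent_space_fst[OF assms(2)] tangent_space_points[OF assms(2)] by simp_all
  show "snd (tscale k v) d = coord_change c d p (snd (tscale k v) c)"
    if "c \<in> M" "d \<in> M" "p \<in> fst c" "p \<in> fst d" for c d
    unfolding tscale_simps linear_cmul[OF coord_change_linear[OF assms(1) that]]
      tangent_space_coord_change[OF assms(2) that] ..
  show "snd (tscale k v) c = 0" if "\<not> (c \<in> M \<and> p \<in> fst c)" for c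
    using tangent_space_0[OF assms(2) that] by simp
qed

text \<open>Frees \<open>vderiv\<close> from the chart picked by \<open>SOME\<close>: the derivative
  of \<open>f\<close> and the components of \<open>v\<close> change by mutually compensating
  Jacobians.\<close>

lemma vderiv_chart:
  assumes A: "smooth_atlas M" and v: "v \<in> tangent_space M p" and c: "c \<in> M" "p \<in> fst c"
    and D: "((f \<circ> chart_inv c) has_derivative D) (at (snd c p))"
  shows "vderiv M v f = D (snd v c)"
proof -
  define d where "d = (SOME c. c \<in> M \<and> fst v \<in> fst c)"
  have fst: "fst v = p" using v by (rule tangent_space_fst)
  have d: "d \<in> M" "p \<in> fst d"
    using someI[of "\<lambda>c. c \<in> M \<and> fst v \<in> fst c" c] c unfolding d_def fst by auto
  have "vderiv M v f = frechet_derivative (f \<circ> chart_inv d) (at (snd d p)) (snd v d)"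
    unfolding vderiv_def Let_def d_def fst ..
  also have "\<dots> = D (coord_change d c p (snd v d))"
    using frechet_derivative_eqI[OF has_derivative_change_chart[OF A c(1) d(1) c(2) d(2) D]] by simp
  also have "coord_change d c p (snd v d) = snd v c"
    using tangent_space_coord_change[OF v d(1) c(1) d(2) c(2)] by simp
  finally show ?thesis .
qed

text \<open>Computes a tangent map from one chart on either side. The components in the remaining
  charts of \<open>N\<close> follow from the chain rule, which inserts just the coordinate changes
  used by \<open>tvec_of\<close>.\<close>

lemma tangent_map_eq_tvec_of:
  assumes A: "smooth_atlas M" "smooth_atlas N" and v: "v \<in> tangent_space M p"
    and c: "c \<in> M" "p \<in> fst c" and d: "d \<in> N" "f p \<in> fst d"
    and U: "open U" "snd c p \<in> U" "\<And>x. x \<in> U \<Longrightarrow> f (chart_inv c x) \<in> fst d"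
    and D: "\<And>x. x \<in> U \<Longrightarrow> ((snd d \<circ> f \<circ> chart_inv c) has_derivative D x) (at x)"
  shows "tangent_map M N f v = tvec_of N d (f p) (D (snd c p) (snd v c))"
proof -
  define g where "g = snd d \<circ> f \<circ> chart_inv c"
  have g: "g (snd c p) = snd d (f p)" by (simp add: g_def chart_inv_chart[OF A(1) c])
  have "continuous_on U g"
    unfolding g_def using D has_derivative_continuous by (blast intro: continuous_at_imp_continuous_on)
  have "vderiv M v (snd e \<circ> f) = coord_change d e (f p) (D (snd c p) (snd v c))"
    if e: "e \<in> N" "f p \<in> fst e" for e
  proof (rule vderiv_chart[OF A(1) v c])
    let ?W = "U \<inter> g -` (snd d ` (fst d \<inter> fst e))"
    have "((snd e \<circ> chart_inv d) \<circ> g has_derivative coord_change d e (f p) \<circ> D (snd c p)) (at (snd c p))"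
      using coord_change_has_derivative[OF A(2) d(1) e(1) d(2) e(2)]
      by (intro diff_chain_at[OF D[OF U(2), folded g_def]]) (simp only: g)
    then show "(snd e \<circ> f \<circ> chart_inv c has_derivative
        (\<lambda>v. coord_change d e (f p) (D (snd c p) v))) (at (snd c p))"
      unfolding comp_def[of "coord_change d e (f p)"]
    proof (rule has_derivative_transform_within_open)
      show "open ?W"
        using continuous_open_preimage[OF \<open>continuous_on U g\<close> U(1) chart_overlap_open[OF A(2) d(1) e(1)]] .
      show "snd c p \<in> ?W" using U(2) g d e by auto
      fix x assume "x \<in> ?W"
      then show "((snd e \<circ> chart_inv d) \<circ> g) x = (snd e \<circ> f \<circ> chart_inv c) x"
        using chart_inv_chart[OF A(2) d(1) U(3)[of x]] by (simp add: g_def)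
    qed
  qed
  then show ?thesis
    unfolding tangent_map_def tvec_of_def tangent_space_fst[OF v]
    by (intro prod_eqI) (simp_all cong: if_cong conj_cong)
qed

section \<open>The slit tangent bundle\<close>

lemma mem_slit_chart:
  "y \<in> fst (slit_chart M c) \<longleftrightarrow> y \<in> tangent_space M (fst y) \<and> fst y \<in> fst c \<and> snd y \<noteq> (\<lambda>_. 0)"
  by (simp add: slit_chart_def)

lemma slit_chart_apply: "snd (slit_chart M c) y = (snd c (fst y), snd y c)"
  by (simp add: slit_chart_def)

lemma mem_points_slit:
  "y \<in> points (slit_bundle M) \<longleftrightarrow> y \<in> tangent_space M (fst y) \<and> snd y \<noteq> (\<lambda>_. 0)"
proof
  assume y: "y \<in> tangent_space M (fst y) \<and> snd y \<noteq> (\<lambda>_. 0)"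
  then obtain c where "c \<in> M" "fst y \<in> fst c"
    using tangent_space_points[of y M "fst y"] unfolding points_def by blast
  with y have "y \<in> fst (slit_chart M c)" by (simp add: mem_slit_chart)
  with \<open>c \<in> M\<close> show "y \<in> points (slit_bundle M)" unfolding points_def slit_bundle_def by blast
qed (auto simp: points_def slit_bundle_def mem_slit_chart)

lemma slit_chart_mem: "c \<in> M \<Longrightarrow> slit_chart M c \<in> slit_bundle M"
  by (simp add: slit_bundle_def)

lemma mem_slit_chart_iff:
  "y \<in> fst (slit_chart M c) \<longleftrightarrow> y \<in> points (slit_bundle M) \<and> fst y \<in> fst c"
  by (auto simp: mem_points_slit mem_slit_chart)

lemma points_slit_coord_nonzero:
  assumes "smooth_atlas M" "y \<in> points (slit_bundle M)" "c \<in> M" "fst y \<in> fst c"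
  shows "snd y c \<noteq> 0"
  using tangent_space_nonzero_iff[OF assms(1) _ assms(3,4), of y] assms(2) by (simp add: mem_points_slit)

lemma tvec_of_mem_slit_chart:
  assumes "smooth_atlas M" "c \<in> M" "p \<in> fst c" "v \<noteq> 0"
  shows "tvec_of M c p v \<in> fst (slit_chart M c)"
  using tvec_of_tangent[OF assms(1-3)] tangent_space_nonzero_iff[OF assms(1) _ assms(2,3)]
    snd_tvec_of[OF assms(1-3)] assms(3,4) by (simp add: mem_slit_chart)

lemma slit_chart_tvec_of:
  assumes "smooth_atlas M" "c \<in> M" "x \<in> snd c ` fst c"
  shows "snd (slit_chart M c) (tvec_of M c (chart_inv c x) v) = (x, v)"
  using assms snd_tvec_of[OF assms(1,2) chart_inv_into[OF assms(3)]] chart_chart_inv[OF assms(3)]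
  by (simp add: slit_chart_apply)

lemma inj_on_slit_chart:
  assumes "smooth_atlas M" "c \<in> M"
  shows "inj_on (snd (slit_chart M c)) (fst (slit_chart M c))"
proof (rule inj_onI)
  fix y z assume y: "y \<in> fst (slit_chart M c)" and z: "z \<in> fst (slit_chart M c)"
    and eq: "snd (slit_chart M c) y = snd (slit_chart M c) z"
  have c: "fst y \<in> fst c" "fst z \<in> fst c" "y \<in> tangent_space M (fst y)" "z \<in> tangent_space M (fst z)"
    using y z by (simp_all only: mem_slit_chart)
  have e: "snd c (fst y) = snd c (fst z)" "snd y c = snd z c"
    using eq by (simp_all only: slit_chart_apply prod.inject)
  have "inj_on (snd c) (fst c)" using assms by (simp add: smooth_atlas_def)
  then have "fst y = fst z" using e(1) c(1,2) by (rule inj_onD)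
  with c(3,4) have "y \<in> tangent_space M (fst z)" by (simp only:)
  then show "y = z" using c(4) assms(2) c(2) e(2) by (rule tangent_space_eqI)
qed

text \<open>The image is a full product because being nonzero does not depend on the chart: over
  each base point every nonzero coordinate vector occurs.\<close>

lemma slit_chart_image_overlap:
  assumes "smooth_atlas M" "c \<in> M"
  shows "snd (slit_chart M c) ` (fst (slit_chart M c) \<inter> fst (slit_chart M d))
    = (snd c ` (fst c \<inter> fst d)) \<times> (- {0})" (is "?l = ?r")
proof
  show "?l \<subseteq> ?r"
  proof
    fix z assume "z \<in> ?l"
    then obtain y where z: "z = snd (slit_chart M c) y"
      and y: "y \<in> fst (slit_chart M c) \<inter> fst (slit_chart M d)" by (rule imageE)
    from y have y': "y \<in> points (slit_bundle M)" "fst y \<in> fst c" "fst y \<in> fst d"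
      by (simp_all only: Int_iff mem_slit_chart_iff)
    show "z \<in> ?r"
      unfolding z slit_chart_apply mem_Times_iff fst_conv snd_conv
      using y'(2,3) points_slit_coord_nonzero[OF assms(1) y'(1) assms(2) y'(2)]
      by (intro conjI imageI IntI ComplI) simp_all
  qed
  show "?r \<subseteq> ?l"
  proof
    fix z assume "z \<in> ?r"
    then obtain p v where z: "z = (snd c p, v)" and p: "p \<in> fst c" "p \<in> fst d" and v: "v \<noteq> 0" by auto
    have "tvec_of M c p v \<in> fst (slit_chart M c) \<inter> fst (slit_chart M d)"
      using tvec_of_mem_slit_chart[OF assms p(1) v] p(2)
      by (simp only: mem_slit_chart fst_tvec_of Int_iff simp_thms)
    moreover have "z = snd (slit_chart M c) (tvec_of M c p v)"
      by (simp only: slit_chart_apply fst_tvec_of snd_tvec_of[OF assms p(1)] z)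
    ultimately show "z \<in> ?l" by (rule rev_image_eqI)
  qed
qed

lemma slit_chart_image:
  assumes "smooth_atlas M" "c \<in> M"
  shows "snd (slit_chart M c) ` fst (slit_chart M c) = (snd c ` fst c) \<times> (- {0})"
  using slit_chart_image_overlap[OF assms, of c] by simp

lemma slit_chart_inv:
  assumes "smooth_atlas M" "c \<in> M" "x \<in> snd c ` fst c" "v \<noteq> 0"
  shows "chart_inv (slit_chart M c) (x, v) = tvec_of M c (chart_inv c x) v"
proof -
  have p: "chart_inv c x \<in> fst c" by (rule chart_inv_into[OF assms(3)]) simp
  show ?thesis
    unfolding chart_inv_def[of "slit_chart M c"]
    by (rule inv_into_f_eq[OF inj_on_slit_chart[OF assms(1,2)]
          tvec_of_mem_slit_chart[OF assms(1,2) p assms(4)] slit_chart_tvec_of[OF assms(1-3)]])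
qed

text \<open>In coordinates the transition is
  \<open>(x, v) \<mapsto> (\<tau> x, D\<tau>(x) v)\<close>, linear in the fibre; this linearity is
  what makes \<open>\<Delta>\<close> independent of the chart.\<close>

lemma slit_transition:
  assumes "smooth_atlas M" "c \<in> M" "d \<in> M" "x \<in> snd c ` (fst c \<inter> fst d)" "v \<noteq> 0"
  shows "(snd (slit_chart M d) \<circ> chart_inv (slit_chart M c)) (x, v)
    = ((snd d \<circ> chart_inv c) x, frechet_derivative (snd d \<circ> chart_inv c) (at x) v)"
proof -
  have "x \<in> snd c ` fst c" and p: "chart_inv c x \<in> fst c \<inter> fst d"
    using assms(4) chart_inv_mem[OF assms(1,2,4)] by auto
  then show ?thesis
    using slit_chart_inv[OF assms(1,2) _ assms(5), of x] assms(3) chart_chart_inv[of x c "fst c"]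
    by (simp add: slit_chart_apply tvec_of_def)
qed

lemma open_punctured: "open S \<Longrightarrow> open (S \<times> (- {0::'a::euclidean_space}))"
  by (intro open_Times open_Compl) auto

lemma smooth_atlas_slit:
  assumes "smooth_atlas M"
  shows "smooth_atlas (slit_bundle M)"
  unfolding slit_bundle_def smooth_atlas_def[of "slit_chart M ` M"] ball_simps(9)
proof (intro conjI ballI)
  fix c assume c: "c \<in> M"
  show "inj_on (snd (slit_chart M c)) (fst (slit_chart M c))"
    using assms c by (rule inj_on_slit_chart)
  show "open (snd (slit_chart M c) ` fst (slit_chart M c))"
    unfolding slit_chart_image[OF assms c] by (intro open_punctured chart_image_open[OF assms c])
  fix d assume d: "d \<in> M"
  let ?S = "(snd c ` (fst c \<inter> fst d)) \<times> (- {0::'b})"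
  note S = slit_chart_image_overlap[OF assms c, of d]
  have o: "open (snd c ` (fst c \<inter> fst d))" using assms c d by (rule chart_overlap_open)
  then have oS: "open ?S" by (rule open_punctured)
  then show "open (snd (slit_chart M c) ` (fst (slit_chart M c) \<inter> fst (slit_chart M d)))"
    unfolding S .
  have fst: "smooth_on ?S fst" and snd: "smooth_on ?S snd"
    using smooth_on_fst[OF oS smooth_on_id[OF oS]] smooth_on_snd[OF oS smooth_on_id[OF oS]] by simp_all
  have im: "fst ` ?S \<subseteq> snd c ` (fst c \<inter> fst d)" by auto
  note t = transition_smooth[OF assms c d]
  have "smooth_on ?S (\<lambda>z. ((snd d \<circ> chart_inv c) (fst z),
      frechet_derivative (snd d \<circ> chart_inv c) (at (fst z)) (snd z)))"
    by (intro smooth_on_Pair[OF oS] smooth_on_compose[OF oS o fst t im]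
        smooth_on_frechet_derivative[OF oS o t fst snd im])
  then show "smooth_on (snd (slit_chart M c) ` (fst (slit_chart M c) \<inter> fst (slit_chart M d)))
      (snd (slit_chart M d) \<circ> chart_inv (slit_chart M c))"
    unfolding S
  proof (rule smooth_on_cong[OF oS, rotated])
    fix z assume "z \<in> ?S"
    then have "fst z \<in> snd c ` (fst c \<inter> fst d)" "snd z \<noteq> 0" by auto
    from slit_transition[OF assms c d this]
    show "((snd d \<circ> chart_inv c) (fst z), frechet_derivative (snd d \<circ> chart_inv c) (at (fst z)) (snd z))
      = (snd (slit_chart M d) \<circ> chart_inv (slit_chart M c)) z" by simp
  qed
qed

text \<open>In bundle coordinates the projection is the linear map \<open>fst\<close>, hence its own
  derivative at every point.\<close>

lemma tangent_map_slit_proj: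
  assumes "smooth_atlas M" "c \<in> M" "fst y \<in> fst c" "y \<in> points (slit_bundle M)"
    and v: "v \<in> tangent_space (slit_bundle M) y"
  shows "tangent_map (slit_bundle M) M fst v = tvec_of M c (fst y) (fst (snd v (slit_chart M c)))"
proof (rule tangent_map_eq_tvec_of[where f=fst and D="\<lambda>_. fst", OF smooth_atlas_slit[OF assms(1)] assms(1) v
        slit_chart_mem[OF assms(2)] _ assms(2,3)])
  let ?C = "slit_chart M c" and ?U = "snd (slit_chart M c) ` fst (slit_chart M c)"
  show y: "y \<in> fst ?C" using assms(3,4) by (simp add: mem_slit_chart_iff)
  show U: "open ?U" using smooth_atlas_slit[OF assms(1)] slit_chart_mem[OF assms(2)] by (rule chart_image_open)
  show "snd ?C y \<in> ?U" using y by auto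
  fix z assume z: "z \<in> ?U"
  have m: "chart_inv ?C z \<in> fst ?C" if "z \<in> ?U" for z using that by (rule chart_inv_into) simp
  then show "fst (chart_inv ?C z) \<in> fst c" using z mem_slit_chart by blast
  show "(snd c \<circ> fst \<circ> chart_inv ?C has_derivative fst) (at z)"
  proof (rule has_derivative_transform_within_open[OF _ U z])
    show "(fst has_derivative fst) (at z)" by (rule bounded_linear_imp_has_derivative[OF bounded_linear_fst])
    fix w assume "w \<in> ?U"
    then have "snd ?C (chart_inv ?C w) = w" by (rule chart_chart_inv) simp
    then show "fst w = (snd c \<circ> fst \<circ> chart_inv ?C) w" by (simp add: slit_chart_apply prod_eq_iff)
  qed
qed

section \<open>The sphere bundle\<close>

lemma tscale_1 [simp]: "tscale 1 y = y"
  by (simp add: tscale_def)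

lemma mem_ray_self: "y \<in> ray y"
  unfolding ray_def using tscale_1[of y, symmetric] zero_less_one by blast

lemma mem_rayE:
  assumes "z \<in> ray y"
  obtains t where "0 < t" "z = tscale t y"
  using assms by (auto simp: ray_def)

lemma sphere_proj_ray: "sphere_proj (ray y) = fst y"
proof -
  have "(SOME z. z \<in> ray y) \<in> ray y" by (rule someI) (rule mem_ray_self)
  then show ?thesis unfolding sphere_proj_def by (auto elim: mem_rayE)
qed

text \<open>The chart evaluates a representative picked by \<open>SOME\<close>; a positive factor
  cancels in \<open>z / t\<close>, so \<open>y\<close> itself may be used instead.\<close>

lemma sphere_chart_ray:
  assumes "linear L"
  shows "snd (sphere_chart M c L) (ray y)
    = (snd c (fst y), fst (L (snd y c)) /\<^sub>R snd (L (snd y c)))"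
proof -
  have "(SOME z. z \<in> ray y) \<in> ray y" by (rule someI) (rule mem_ray_self)
  then obtain t where t: "0 < t" "(SOME z. z \<in> ray y) = tscale t y" by (rule mem_rayE)
  then show ?thesis
    by (simp add: sphere_chart_def case_prod_beta linear_cmul[OF assms])
qed

lemma ray_mem_sphere_chart:
  assumes "linear L" "y \<in> points (slit_bundle M)"
  shows "ray y \<in> fst (sphere_chart M c L) \<longleftrightarrow> fst y \<in> fst c \<and> 0 < snd (L (snd y c))"
proof
  assume "ray y \<in> fst (sphere_chart M c L)"
  then obtain z where z: "ray y = ray z" "fst z \<in> fst c" "0 < snd (L (snd z c))"
    by (auto simp: sphere_chart_def)
  then have "y \<in> ray z" using mem_ray_self by metis
  then obtain t where "0 < t" "y = tscale t z" by (rule mem_rayE)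
  then show "fst y \<in> fst c \<and> 0 < snd (L (snd y c))"
    using z by (simp add: linear_cmul[OF assms(1)])
next
  show "fst y \<in> fst c \<and> 0 < snd (L (snd y c)) \<Longrightarrow> ray y \<in> fst (sphere_chart M c L)"
    unfolding sphere_chart_def fst_conv using assms(2) by blast
qed

lemma mem_sphere_chartE:
  assumes "s \<in> fst (sphere_chart M c L)"
  obtains y where "s = ray y" "y \<in> points (slit_bundle M)" "fst y \<in> fst c" "0 < snd (L (snd y c))"
  using assms by (auto simp: sphere_chart_def)

lemma sphere_chart_mem:
  "c \<in> M \<Longrightarrow> linear L \<Longrightarrow> bij L \<Longrightarrow> sphere_chart M c (L :: _ \<Rightarrow> 'f::euclidean_space \<times> real) \<in> sphere_bundle TYPE('f) M"
  unfolding sphere_bundle_def by blast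

text \<open>Shows that the half-space charts reach every ray: a linear isometry onto
  \<open>'f \<times> real\<close> is corrected by a reflection or a shear until the last coordinate
  of \<open>v\<close> is positive.\<close>

lemma ex_linear_bij_pos:
  fixes v :: "'m::euclidean_space"
  assumes "DIM('m) = DIM('f::euclidean_space) + 1" "v \<noteq> 0"
  shows "\<exists>L :: 'm \<Rightarrow> 'f \<times> real. linear L \<and> bij L \<and> 0 < snd (L v)"
proof -
  have "DIM('m) = DIM('f \<times> real)" using assms(1) by simp
  then obtain f :: "'m \<Rightarrow> 'f \<times> real" and g 
    where f: "linear f" "linear g" "\<And>x. norm (f x) = norm x" "\<And>y. norm (g y) = norm y"
      "\<And>x. g (f x) = x" "\<And>y. f (g y) = y"
    by (rule isomorphisms_UNIV_UNIV) (rule that)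
  have bf: "bij f" by (rule o_bij[of g]) (simp_all add: fun_eq_iff f(5,6))
  \<comment> \<open>If the last coordinate of \<open>f v\<close> is nonzero, the sign
    \<open>s\<close> makes it positive and no shear is applied. If it is zero, the shear along
    \<open>a = fst (f v)\<close> produces the last coordinate \<open>a \<bullet> a\<close>, which is
    positive because \<open>f v\<close> is nonzero.\<close>
  define a where "a = (if snd (f v) = 0 then fst (f v) else 0)"
  define s :: real where "s = (if snd (f v) < 0 then - 1 else 1)"
  define h where "h = (\<lambda>z :: 'f \<times> real. (fst z, s * snd z + fst z \<bullet> a))"
  have s: "s * (s * r) = r" for r by (simp add: s_def)
  have "linear h" by (rule linearI) (simp_all add: h_def algebra_simps inner_left_distrib)
  moreover have "bij h"
  proof (rule o_bij)
    show "(\<lambda>z. (fst z, s * (snd z - fst z \<bullet> a))) \<circ> h = id"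
      by (simp add: h_def fun_eq_iff s)
    show "h \<circ> (\<lambda>z. (fst z, s * (snd z - fst z \<bullet> a))) = id"
      by (simp add: h_def fun_eq_iff s)
  qed
  moreover have "f v \<noteq> 0"
  proof
    assume "f v = 0"
    then have "f v = f 0" by (simp add: linear_0[OF f(1)])
    then have "g (f v) = g (f 0)" by (rule arg_cong)
    then show False using assms(2) by (simp add: f(5))
  qed
  then have "fst (f v) \<noteq> 0 \<or> snd (f v) \<noteq> 0" by (simp add: prod_eq_iff)
  then have "0 < snd (h (f v))"
    by (auto simp: h_def a_def s_def)
  ultimately show ?thesis
    using linear_compose[OF f(1), of h] bij_comp[OF bf, of h] by (intro exI[of _ "h \<circ> f"]) simp
qed

text \<open>Here too the projection is \<open>fst\<close> in coordinates. That the sphere charts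
  form a smooth atlas enters as a hypothesis; for a path geometry it is read off a flat
  chart.\<close>

lemma tangent_map_sphere_proj:
  fixes L :: "'m::euclidean_space \<Rightarrow> 'f::euclidean_space \<times> real"
  assumes "smooth_atlas M" "smooth_atlas (sphere_bundle TYPE('f) M)" "c \<in> M" "linear L" "bij L"
    and s: "s \<in> fst (sphere_chart M c L)"
    and v: "v \<in> tangent_space (sphere_bundle TYPE('f) M) s"
  shows "tangent_map (sphere_bundle TYPE('f) M) M sphere_proj v
    = tvec_of M c (sphere_proj s) (fst (snd v (sphere_chart M c L)))"
proof -
  let ?C = "sphere_chart M c L" and ?U = "snd (sphere_chart M c L) ` fst (sphere_chart M c L)"
  have *: "sphere_proj t \<in> fst c \<and> snd c (sphere_proj t) = fst (snd ?C t)" if "t \<in> fst ?C" for t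
    using that by (auto elim!: mem_sphere_chartE simp: sphere_proj_ray sphere_chart_ray[OF assms(4)])
  show ?thesis
  proof (rule tangent_map_eq_tvec_of[where f=sphere_proj and D="\<lambda>_. fst", OF assms(2,1) v sphere_chart_mem[OF assms(3-5)] s assms(3)])
    show "sphere_proj s \<in> fst c" using *[OF s] by simp
    show U: "open ?U" using assms(2) sphere_chart_mem[OF assms(3-5)] by (rule chart_image_open)
    show "snd ?C s \<in> ?U" using s by auto
    fix z assume z: "z \<in> ?U"
    have m: "chart_inv ?C z \<in> fst ?C" if "z \<in> ?U" for z using that by (rule chart_inv_into) simp
    show "sphere_proj (chart_inv ?C z) \<in> fst c" using *[OF m[OF z]] by simp
    show "(snd c \<circ> sphere_proj \<circ> chart_inv ?C has_derivative fst) (at z)"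
    proof (rule has_derivative_transform_within_open[OF _ U z])
      show "(fst has_derivative fst) (at z)" by (rule bounded_linear_imp_has_derivative[OF bounded_linear_fst])
      fix w assume w: "w \<in> ?U"
      then have "snd ?C (chart_inv ?C w) = w" by (rule chart_chart_inv) simp
      then show "fst w = (snd c \<circ> sphere_proj \<circ> chart_inv ?C) w" using *[OF m[OF w]] by simp
    qed
  qed
qed

text \<open>The quotient rule for the fibre coordinate \<open>\<zeta> = z / t\<close>: a change
  \<open>(z', t')\<close> of \<open>L y\<close> moves it by \<open>(z' - t' \<zeta>) / t\<close>.
  The result vanishes in the direction of \<open>y\<close> itself, as it must for a map that forgets
  the length.\<close>

lemma tangent_map_ray:
  fixes L :: "'m::euclidean_space \<Rightarrow> 'f::euclidean_space \<times> real"
  assumes "smooth_atlas M" "smooth_atlas (sphere_bundle TYPE('f) M)" "c \<in> M" "linear L" "bij L"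
    and y: "y \<in> points (slit_bundle M)" "fst y \<in> fst c" "0 < snd (L (snd y c))"
    and v: "v \<in> tangent_space (slit_bundle M) y"
  defines "a \<equiv> fst (snd v (slit_chart M c))" and "b \<equiv> snd (snd v (slit_chart M c))"
    and "t \<equiv> snd (L (snd y c))" and "\<zeta> \<equiv> fst (L (snd y c)) /\<^sub>R snd (L (snd y c))"
  shows "tangent_map (slit_bundle M) (sphere_bundle TYPE('f) M) ray v
    = tvec_of (sphere_bundle TYPE('f) M) (sphere_chart M c L) (ray y)
        (a, (fst (L b) - snd (L b) *\<^sub>R \<zeta>) /\<^sub>R t)"
proof -
  let ?C = "slit_chart M c" and ?K = "sphere_chart M c L" and ?N = "sphere_bundle TYPE('f) M"
  let ?U = "snd ?C ` fst ?C \<inter> {z. 0 < snd (L (snd z))}"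
  \<comment> \<open>The shape delivered by the derivative rules for \<open>inverse\<close> and
    scalar multiplication; it is brought into quotient form only after evaluation at
    \<open>y\<close>.\<close>
  let ?D = "\<lambda>z h. (fst h, inverse (snd (L (snd z))) *\<^sub>R fst (L (snd h)) +
     (- (inverse (snd (L (snd z))) * snd (L (snd h)) * inverse (snd (L (snd z))))) *\<^sub>R fst (L (snd z)))"
  have bl: "bounded_linear L" using assms(4) by (rule linear_conv_bounded_linear[THEN iffD1])
  have "tangent_map (slit_bundle M) ?N ray v = tvec_of ?N ?K (ray y) (?D (snd ?C y) (snd v ?C))"
  proof (rule tangent_map_eq_tvec_of[where f=ray and D="?D", OF smooth_atlas_slit[OF assms(1)] assms(2) v slit_chart_mem[OF assms(3)]
          _ sphere_chart_mem[OF assms(3-5)]])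
    show yC: "y \<in> fst ?C" using y by (simp add: mem_slit_chart_iff)
    show "ray y \<in> fst ?K" using ray_mem_sphere_chart[OF assms(4) y(1)] y by simp
    have "continuous_on UNIV (\<lambda>z :: 'm \<times> 'm. snd (L (snd z)))"
      by (rule continuous_on_snd[OF bounded_linear.continuous_on[OF bl continuous_on_snd[OF continuous_on_id]]])
    then have "open {z :: 'm \<times> 'm. 0 < snd (L (snd z))}"
      by (rule open_Collect_less[OF continuous_on_const])
    with chart_image_open[OF smooth_atlas_slit[OF assms(1)] slit_chart_mem[OF assms(3)]]
    show U: "open ?U" by (rule open_Int)
    show "snd ?C y \<in> ?U" using yC y by (auto simp: slit_chart_apply)
    fix z assume z: "z \<in> ?U"
    have m: "ray (chart_inv ?C z) \<in> fst ?K" and e: "snd c (fst (chart_inv ?C z)) = fst z"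
      "snd (chart_inv ?C z) c = snd z" if "z \<in> ?U" for z
    proof -
      have zC: "z \<in> snd ?C ` fst ?C" using that by simp
      have "snd ?C (chart_inv ?C z) = z" by (rule chart_chart_inv[OF zC]) simp
      then show e: "snd c (fst (chart_inv ?C z)) = fst z" "snd (chart_inv ?C z) c = snd z"
        unfolding slit_chart_apply by (simp_all add: prod_eq_iff)
      have "chart_inv ?C z \<in> fst ?C" by (rule chart_inv_into[OF zC]) simp
      then show "ray (chart_inv ?C z) \<in> fst ?K"
        using ray_mem_sphere_chart[OF assms(4), of "chart_inv ?C z" M c] e(2) that
        by (simp add: mem_slit_chart_iff)
    qed
    show "ray (chart_inv ?C z) \<in> fst ?K" using m[OF z] by simp
    show "(snd ?K \<circ> ray \<circ> chart_inv ?C has_derivative ?D z) (at z)"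
    proof (rule has_derivative_transform_within_open[OF _ U z])
      have l: "((\<lambda>z. L (snd z)) has_derivative (\<lambda>h. L (snd h))) (at z)"
        by (rule bounded_linear.has_derivative[OF bl has_derivative_snd[OF has_derivative_ident]])
      have "snd (L (snd z)) \<noteq> 0" using z by auto
      from Deriv.has_derivative_inverse[OF this has_derivative_snd[OF l]]
      show "((\<lambda>z. (fst z, inverse (snd (L (snd z))) *\<^sub>R fst (L (snd z)))) has_derivative ?D z) (at z)"
        by (rule has_derivative_Pair[OF has_derivative_fst[OF has_derivative_ident]
              has_derivative_scaleR[OF _ has_derivative_fst[OF l]]])
      fix w assume w: "w \<in> ?U"
      show "(fst w, inverse (snd (L (snd w))) *\<^sub>R fst (L (snd w))) = (snd ?K \<circ> ray \<circ> chart_inv ?C) w"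
        unfolding comp_apply sphere_chart_ray[OF assms(4)] e(1)[OF w] e(2)[OF w] ..
    qed
  qed
  also have "?D (snd ?C y) (snd v ?C) = (a, (fst (L b) - snd (L b) *\<^sub>R \<zeta>) /\<^sub>R t)"
    by (simp add: slit_chart_apply a_def b_def t_def \<zeta>_def scaleR_diff_right)
  finally show ?thesis .
qed


section \<open>Tangent directions of a foliation\<close>

lemma topspace_mtop:
  assumes "smooth_atlas M"
  shows "topspace (mtop M) = points M"
proof
  show "topspace (mtop M) \<subseteq> points M"
    using openin_topspace[of "mtop M"] unfolding openin_mtop[OF assms] by (rule conjunct1)
  have "openin (mtop M) (points M)"
    unfolding openin_mtop[OF assms]
  proof (intro conjI ballI subset_refl)
    fix c assume c: "c \<in> M"
    then have "points M \<inter> fst c = fst c" by (auto simp: points_def)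
    then show "open (snd c ` (points M \<inter> fst c))" using chart_image_open[OF assms c] by simp
  qed
  then show "points M \<subseteq> topspace (mtop M)" by (rule openin_subset)
qed

lemma smooth_atlas_insertD: "smooth_atlas (insert k N) \<Longrightarrow> smooth_atlas N"
  by (simp add: smooth_atlas_def)

lemma openin_chart_domain:
  assumes "smooth_atlas (insert k N)" "fst k \<subseteq> points N"
  shows "openin (mtop N) (fst k)"
  unfolding openin_mtop[OF smooth_atlas_insertD[OF assms(1)]]
proof (intro conjI ballI assms(2))
  fix d assume "d \<in> N"
  then show "open (snd d ` (fst k \<inter> fst d))"
    using chart_overlap_open[OF assms(1), of d k] by (simp add: Int_commute)
qed

text \<open>\<open>X\<close> is the coordinate field along \<open>u\<close> of the flat chart,
  written in the chart \<open>\<kappa>\<close>, so a single smooth field serves all leaves. The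
  speed factor \<open>m\<close> depends on the leaf, the point and \<open>e\<close>; that it does
  not vanish is derived afterwards from the projection condition of a path geometry.\<close>

lemma leaf_direction:
  fixes N :: "('q, 'n::euclidean_space) chart set"
  assumes F: "oriented_curve_foliation N \<F>" and K: "flat_chart N \<F> k" and \<kappa>: "\<kappa> \<in> N"
  obtains X where "smooth_on (snd \<kappa> ` (fst \<kappa> \<inter> fst k)) X"
    and "\<And>L s. L \<in> \<F> \<Longrightarrow> s \<in> points L \<Longrightarrow> s \<in> fst \<kappa> \<inter> fst k \<Longrightarrow>
      \<exists>e\<in>L. s \<in> fst e \<and> (\<exists>m. \<forall>w\<in>tangent_space L s.
        tangent_map L N (\<lambda>s. s) w = tvec_of N \<kappa> s ((snd w e * m) *\<^sub>R X (snd \<kappa> s)))"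
proof -
  have N': "smooth_atlas (insert k N)" and k: "fst k \<subseteq> points N"
    using K by (simp_all add: flat_chart_def)
  have N: "smooth_atlas N" using N' by (rule smooth_atlas_insertD)
  obtain u where u: "u \<in> Basis" and slices: "\<And>L. L \<in> \<F> \<Longrightarrow> \<exists>Z. countable Z \<and>
      points L \<inter> fst k = {q \<in> fst k. \<exists>z\<in>Z. \<forall>b\<in>Basis - {u}. snd k q \<bullet> b = z \<bullet> b}"
    using K unfolding flat_chart_def by blast
  define A where "A = snd \<kappa> ` (fst \<kappa> \<inter> fst k)"
  define B where "B = snd k ` (fst k \<inter> fst \<kappa>)"
  define \<Phi> where "\<Phi> = snd k \<circ> chart_inv \<kappa>"
  define \<Psi> where "\<Psi> = snd \<kappa> \<circ> chart_inv k"
  \<comment> \<open>Push-forward of the constant vector \<open>u\<close> from the flat chart to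
    \<open>\<kappa>\<close>.\<close>
  define X where "X = (\<lambda>q. frechet_derivative \<Psi> (at (\<Phi> q)) u)"
  have \<kappa>': "\<kappa> \<in> insert k N" and k': "k \<in> insert k N" using \<kappa> by simp_all
  have oA: "open A" and oB: "open B"
    unfolding A_def B_def using chart_overlap_open[OF N'] \<kappa>' k' by blast+
  have s\<Phi>: "smooth_on A \<Phi>" unfolding A_def \<Phi>_def by (rule transition_smooth[OF N' \<kappa>' k'])
  have s\<Psi>: "smooth_on B \<Psi>" unfolding B_def \<Psi>_def by (rule transition_smooth[OF N' k' \<kappa>'])
  have \<Phi>A: "\<Phi> ` A \<subseteq> B"
  proof
    fix z assume "z \<in> \<Phi> ` A"
    then obtain q where q: "q \<in> A" "z = \<Phi> q" by blast
    have "chart_inv \<kappa> q \<in> fst \<kappa> \<inter> fst k"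
      by (rule chart_inv_mem[OF N \<kappa>]) (use q(1) in \<open>simp_all add: A_def\<close>)
    then show "z \<in> B" unfolding q(2) \<Phi>_def B_def by auto
  qed
  have "smooth_on A X"
    unfolding X_def by (rule smooth_on_frechet_derivative[OF oA oB s\<Psi> s\<Phi> smooth_on_const \<Phi>A])
  moreover have "\<exists>e\<in>L. s \<in> fst e \<and> (\<exists>m. \<forall>w\<in>tangent_space L s.
        tangent_map L N (\<lambda>s. s) w = tvec_of N \<kappa> s ((snd w e * m) *\<^sub>R X (snd \<kappa> s)))"
    if L: "L \<in> \<F>" and s: "s \<in> points L" "s \<in> fst \<kappa> \<inter> fst k" for L s
  proof -
    have imm: "immersed_submanifold L N" using F L unfolding oriented_curve_foliation_def by blast
    then have LA: "smooth_atlas L" and "smooth_map L N (\<lambda>p. p)"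
      by (simp_all add: immersed_submanifold_def smooth_manifold_def)
    then have cont: "continuous_map (mtop L) (mtop N) (\<lambda>p. p)"
      and sm: "\<And>e. e \<in> L \<Longrightarrow> smooth_on (snd e ` {p \<in> fst e. p \<in> fst \<kappa>}) (snd \<kappa> \<circ> (\<lambda>p. p) \<circ> chart_inv e)"
      using \<kappa> unfolding smooth_map_def by blast+
    obtain e where e: "e \<in> L" "s \<in> fst e" using s(1) unfolding points_def by blast
    \<comment> \<open>The leaf carries its own topology, which may be finer than the one induced by
      \<open>N\<close>; openness of this part of the leaf comes from continuity of the
      inclusion.\<close>
    define W where "W = {p \<in> topspace (mtop L). p \<in> fst \<kappa> \<inter> fst k}"
    define T where "T = snd e ` (W \<inter> fst e)"
    have "fst \<kappa> \<subseteq> points N" using \<kappa> unfolding points_def by blast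
    then have "openin (mtop N) (fst \<kappa> \<inter> fst k)"
      using N \<kappa> by (intro openin_Int openin_chart_domain N' k) (simp_all add: insert_absorb)
    then have "openin (mtop L) W"
      unfolding W_def by (rule openin_continuous_map_preimage[OF cont])
    then have oT: "open T" unfolding openin_mtop[OF LA] T_def using e(1) by blast
    have sW: "s \<in> W" using s unfolding W_def topspace_mtop[OF LA] by blast
    define t0 where "t0 = snd e s"
    have t0: "t0 \<in> T" using sW e(2) unfolding T_def t0_def by blast
    have inT: "chart_inv e t \<in> W \<inter> fst e" if "t \<in> T" for t
      by (rule chart_inv_mem[OF LA e(1)]) (use that in \<open>simp_all add: T_def\<close>)
    define \<gamma> where "\<gamma> = snd \<kappa> \<circ> chart_inv e"
    define \<delta> where "\<delta> = snd k \<circ> chart_inv e"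
    have inv_t0: "chart_inv e t0 = s" unfolding t0_def by (rule chart_inv_chart[OF LA e])
    have "T \<subseteq> snd e ` {p \<in> fst e. p \<in> fst \<kappa>}" unfolding T_def W_def by blast
    from smooth_on_subset[OF sm[OF e(1)] this] have s\<gamma>: "smooth_on T \<gamma>"
      by (simp add: \<gamma>_def comp_def)
    have \<gamma>T: "\<gamma> ` T \<subseteq> A" using inT unfolding \<gamma>_def A_def W_def by fastforce
    have \<delta>T: "\<delta> ` T \<subseteq> B" using inT unfolding \<delta>_def B_def W_def by fastforce
    \<comment> \<open>Smoothness of the inclusion refers to charts of \<open>N\<close>, and
      \<open>k\<close> may lie outside \<open>N\<close>. The leaf in the flat chart is therefore
      obtained from \<open>\<gamma>\<close> by the transition map \<open>\<Phi>\<close>.\<close>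
    have "smooth_on T (\<lambda>t. \<Phi> (\<gamma> t))" by (rule smooth_on_compose[OF oT oA s\<gamma> s\<Phi> \<gamma>T])
    then have s\<delta>: "smooth_on T \<delta>"
    proof (rule smooth_on_cong[OF oT, rotated])
      fix t assume "t \<in> T"
      then have "chart_inv e t \<in> fst \<kappa>" using inT unfolding W_def by blast
      then show "\<Phi> (\<gamma> t) = \<delta> t"
        by (simp add: \<Phi>_def \<gamma>_def \<delta>_def chart_inv_chart[OF N \<kappa>])
    qed
    define D where "D = frechet_derivative \<delta> (at t0)"
    have D: "(\<delta> has_derivative D) (at t0)"
      unfolding D_def by (rule smooth_on_imp_has_derivative[OF s\<delta> t0])
    have transverse: "D r \<bullet> b = 0" if b: "b \<in> Basis" "b \<noteq> u" for b r
    proof -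
      obtain Z where Z: "countable Z"
        "points L \<inter> fst k = {q \<in> fst k. \<exists>z\<in>Z. \<forall>b\<in>Basis - {u}. snd k q \<bullet> b = z \<bullet> b}"
        using slices[OF L] by blast
      \<comment> \<open>The leaf may return to the domain in other slices, so \<open>T\<close> can
        be disconnected; on a ball the image under a transverse coordinate is connected and
        countable, hence a single point.\<close>
      obtain \<epsilon> where \<epsilon>: "0 < \<epsilon>" "ball t0 \<epsilon> \<subseteq> T" using oT t0 open_contains_ball by blast
      let ?f = "\<lambda>t. \<delta> t \<bullet> b"
      have "?f ` ball t0 \<epsilon> \<subseteq> (\<lambda>z. z \<bullet> b) ` Z"
      proof
        fix r assume "r \<in> ?f ` ball t0 \<epsilon>"
        then obtain t where t: "t \<in> T" "r = \<delta> t \<bullet> b" using \<epsilon>(2) by blast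
        have "chart_inv e t \<in> points L \<inter> fst k"
          using inT[OF t(1)] unfolding W_def topspace_mtop[OF LA] by blast
        then obtain z where "z \<in> Z" "snd k (chart_inv e t) \<bullet> b = z \<bullet> b"
          unfolding Z(2) using b by blast
        then show "r \<in> (\<lambda>z. z \<bullet> b) ` Z" unfolding t(2) \<delta>_def comp_apply by blast
      qed
      then have cnt: "countable (?f ` ball t0 \<epsilon>)"
        by (rule countable_subset[OF _ countable_image[OF Z(1)]])
      have "continuous_on (ball t0 \<epsilon>) ?f"
        by (rule continuous_on_inner[OF continuous_on_subset[OF smooth_on_imp_continuous_on[OF s\<delta>] \<epsilon>(2)]
              continuous_on_const])
      then have conn: "connected (?f ` ball t0 \<epsilon>)"
        by (rule connected_continuous_image[OF _ connected_ball])
      have const: "?f t0 = ?f t" if "t \<in> ball t0 \<epsilon>" for t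
      proof (rule ccontr)
        assume "?f t0 \<noteq> ?f t"
        moreover have "?f t0 \<in> ?f ` ball t0 \<epsilon>" "?f t \<in> ?f ` ball t0 \<epsilon>"
          using that \<epsilon>(1) by (auto simp del: mem_ball intro!: imageI centre_in_ball[THEN iffD2])
        ultimately show False using connected_uncountable[OF conn] cnt by blast
      qed
      have "(?f has_derivative (\<lambda>_. 0)) (at t0)"
        by (rule has_derivative_transform_within_open[OF has_derivative_const open_ball _ const])
          (use \<epsilon>(1) in simp_all)
      moreover have "(?f has_derivative (\<lambda>h. D h \<bullet> b)) (at t0)"
        by (rule has_derivative_inner_left[OF D])
      ultimately have "(\<lambda>h. D h \<bullet> b) = (\<lambda>_. 0)" by (rule has_derivative_unique[rotated])
      then show ?thesis by (rule fun_cong)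
    qed
    \<comment> \<open>Only the component along \<open>u\<close> survives, so the velocity of the
      leaf in the flat chart is \<open>m\<close> times \<open>u\<close>.\<close>
    define m where "m = D 1 \<bullet> u"
    have Dr: "D r = (r * m) *\<^sub>R u" for r
    proof (rule euclidean_eqI)
      fix b :: 'n assume b: "b \<in> Basis"
      have "D r = r *\<^sub>R D 1" using linear_cmul[OF has_derivative_linear[OF D], of r 1] by simp
      then show "D r \<bullet> b = (r * m) *\<^sub>R u \<bullet> b"
        using transverse[OF b, of r] u b by (cases "b = u") (simp_all add: m_def inner_Basis)
    qed
    have \<delta>t0: "\<delta> t0 = \<Phi> (snd \<kappa> s)"
      using s(2) by (simp add: \<delta>_def inv_t0 \<Phi>_def chart_inv_chart[OF N \<kappa>])
    have \<delta>B: "\<delta> t0 \<in> B" using \<delta>T t0 by blast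
    have "(\<Psi> \<circ> \<delta> has_derivative frechet_derivative \<Psi> (at (\<delta> t0)) \<circ> D) (at t0)"
      by (rule diff_chain_at[OF D smooth_on_imp_has_derivative[OF s\<Psi> \<delta>B]])
    then have "(\<gamma> has_derivative frechet_derivative \<Psi> (at (\<delta> t0)) \<circ> D) (at t0)"
    proof (rule has_derivative_transform_within_open[OF _ oT t0])
      fix t assume "t \<in> T"
      then have "chart_inv e t \<in> fst k" using inT unfolding W_def by blast
      then show "(\<Psi> \<circ> \<delta>) t = \<gamma> t"
        by (simp add: \<Psi>_def \<gamma>_def \<delta>_def chart_inv_chart[OF N' k'])
    qed
    then have "frechet_derivative \<gamma> (at t0) = frechet_derivative \<Psi> (at (\<delta> t0)) \<circ> D"
      by (rule frechet_derivative_eqI)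
    then have D\<gamma>: "frechet_derivative \<gamma> (at t0) r = (r * m) *\<^sub>R X (snd \<kappa> s)" for r
      using linear_cmul[OF linear_frechet_derivative[OF smooth_on_imp_differentiable[OF s\<Psi> \<delta>B]]]
      by (simp add: Dr X_def \<delta>t0)
    have "tangent_map L N (\<lambda>s. s) w = tvec_of N \<kappa> s ((snd w e * m) *\<^sub>R X (snd \<kappa> s))"
      if w: "w \<in> tangent_space L s" for w
    proof -
      have "tangent_map L N (\<lambda>s. s) w = tvec_of N \<kappa> s (frechet_derivative \<gamma> (at (snd e s)) (snd w e))"
      proof (rule tangent_map_eq_tvec_of[where f="\<lambda>s. s" and D="\<lambda>t. frechet_derivative \<gamma> (at t)" and U=T,
            OF LA N w e \<kappa>])
        show "s \<in> fst \<kappa>" using s(2) by blast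
        show "open T" by (rule oT)
        show "snd e s \<in> T" using t0 by (simp only: t0_def)
        fix t assume t: "t \<in> T"
        show "chart_inv e t \<in> fst \<kappa>" using inT[OF t] unfolding W_def by blast
        show "(snd \<kappa> \<circ> (\<lambda>s. s) \<circ> chart_inv e has_derivative frechet_derivative \<gamma> (at t)) (at t)"
          using smooth_on_imp_has_derivative[OF s\<gamma> t] by (simp add: \<gamma>_def comp_def)
      qed
      then show ?thesis unfolding t0_def[symmetric] D\<gamma> .
    qed
    then show ?thesis using e by blast
  qed
  ultimately show ?thesis using that unfolding A_def by blast
qed

section \<open>Local sprays spanning the distribution of a path geometry\<close>

lemma tvec_of_inject:
  assumes "smooth_atlas M" "c \<in> M" "p \<in> fst c"
  shows "tvec_of M c p v = tvec_of M c p w \<longleftrightarrow> v = w"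
  using snd_tvec_of[OF assms, of v] snd_tvec_of[OF assms, of w] by metis

text \<open>Projecting a positive tangent vector of the leaf to the base gives both a positive
  multiple of \<open>y\<close> and \<open>m\<close> times the base component of \<open>X\<close>. As
  \<open>y\<close> is nonzero, neither \<open>m\<close> nor this component can vanish: the base part
  of \<open>X\<close> points along \<open>y\<close>, and \<open>X\<close> spans the whole tangent
  line of the leaf.\<close>

lemma path_geometry_leaf_tangents:
  fixes L :: "'m::euclidean_space \<Rightarrow> 'f::euclidean_space \<times> real"
  assumes M: "smooth_atlas M" and N: "smooth_atlas (sphere_bundle TYPE('f) M)"
    and \<F>: "path_geometry TYPE('f) M \<F>" and c: "c \<in> M" and L: "linear L" "bij L"
    and y: "y \<in> points (slit_bundle M)" "ray y \<in> fst (sphere_chart M c L)"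
    and B: "B \<in> \<F>" "ray y \<in> points B"
    and e: "e \<in> B" "ray y \<in> fst e"
    and X: "\<And>w. w \<in> tangent_space B (ray y) \<Longrightarrow> tangent_map B (sphere_bundle TYPE('f) M) (\<lambda>s. s) w
      = tvec_of (sphere_bundle TYPE('f) M) (sphere_chart M c L) (ray y) ((snd w e * m) *\<^sub>R X)"
  shows "\<exists>l. l \<noteq> 0 \<and> fst X = l *\<^sub>R snd y c"
    and "(\<exists>w\<in>tangent_space B (ray y). v = tangent_map B (sphere_bundle TYPE('f) M) (\<lambda>s. s) w)
      \<longleftrightarrow> (\<exists>r. v = tvec_of (sphere_bundle TYPE('f) M) (sphere_chart M c L) (ray y) (r *\<^sub>R X))"
proof -
  let ?N = "sphere_bundle TYPE('f) M" and ?K = "sphere_chart M c L"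
  have K: "?K \<in> ?N" using c L by (rule sphere_chart_mem)
  have fol: "oriented_curve_foliation ?N \<F>" using \<F> by (simp add: path_geometry_def)
  then have "immersed_submanifold B ?N" and ori: "oriented_atlas B"
    using B(1) unfolding oriented_curve_foliation_def by blast+
  then have BA: "smooth_atlas B" by (simp add: immersed_submanifold_def smooth_manifold_def)
  have yc: "fst y \<in> fst c" using y ray_mem_sphere_chart[OF L(1) y(1)] by blast
  \<comment> \<open>The unit vector of the leaf chart \<open>e\<close>. It is positive in every
    other leaf chart because the coordinate changes of an oriented atlas have positive
    derivative.\<close>
  define w where "w = tvec_of B e (ray y) 1"
  have w: "w \<in> tangent_space B (ray y)" "snd w e = 1"
    unfolding w_def using tvec_of_tangent[OF BA e] snd_tvec_of[OF BA e] by blast+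
  have "positive_tangent B (ray y) w"
    unfolding positive_tangent_def
  proof (intro conjI w(1) ballI impI)
    fix d assume "d \<in> B" "ray y \<in> fst d"
    then show "0 < snd w d"
      using ori e unfolding w_def tvec_of_def oriented_atlas_def by simp
  qed
  then obtain k where k: "0 < k"
    "tangent_map ?N M sphere_proj (tangent_map B ?N (\<lambda>s. s) w) = tscale k y"
    using \<F> B mem_ray_self unfolding path_geometry_def by blast
  have "tangent_map ?N M sphere_proj (tangent_map B ?N (\<lambda>s. s) w)
      = tvec_of M c (sphere_proj (ray y)) (fst (snd (tangent_map B ?N (\<lambda>s. s) w) ?K))"
    by (rule tangent_map_sphere_proj[OF M N c L y(2)]) (simp only: X[OF w(1)] tvec_of_tangent[OF N K y(2)])
  also have "\<dots> = tvec_of M c (fst y) (m *\<^sub>R fst X)"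
    by (simp add: X[OF w(1)] w(2) snd_tvec_of[OF N K y(2)] sphere_proj_ray)
  finally have "tscale k y = tvec_of M c (fst y) (m *\<^sub>R fst X)" unfolding k(2) .
  then have "snd (tscale k y) c = snd (tvec_of M c (fst y) (m *\<^sub>R fst X)) c" by (rule arg_cong)
  then have eq: "k *\<^sub>R snd y c = m *\<^sub>R fst X"
    unfolding snd_tvec_of[OF M c yc] tscale_simps .
  have m: "m \<noteq> 0" using eq k(1) points_slit_coord_nonzero[OF M y(1) c yc] by auto
  have "fst X = (k / m) *\<^sub>R snd y c"
  proof -
    have "(k / m) *\<^sub>R snd y c = (1 / m) *\<^sub>R (k *\<^sub>R snd y c)" by simp
    also have "\<dots> = fst X" unfolding eq using m by simp
    finally show ?thesis by (rule sym)
  qed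
  moreover have "k / m \<noteq> 0" using k(1) m by simp
  ultimately show "\<exists>l. l \<noteq> 0 \<and> fst X = l *\<^sub>R snd y c" by blast
  show "(\<exists>w\<in>tangent_space B (ray y). v = tangent_map B ?N (\<lambda>s. s) w)
      \<longleftrightarrow> (\<exists>r. v = tvec_of ?N ?K (ray y) (r *\<^sub>R X))" (is "?l \<longleftrightarrow> ?r")
  proof
    assume ?l
    then obtain w where "w \<in> tangent_space B (ray y)" "v = tangent_map B ?N (\<lambda>s. s) w" by blast
    then show ?r using X by blast
  next
    assume ?r
    then obtain r where r: "v = tvec_of ?N ?K (ray y) (r *\<^sub>R X)" by blast
    \<comment> \<open>Rescaling by \<open>r / m\<close> compensates the speed of the leaf, so every
      multiple of \<open>X\<close> is reached.\<close>
    define w' where "w' = tscale (r / m) w"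
    have w': "w' \<in> tangent_space B (ray y)" unfolding w'_def by (rule tscale_tangent[OF BA w(1)])
    have "snd w' e * m = r" using m by (simp add: w'_def w(2))
    then have "v = tangent_map B ?N (\<lambda>s. s) w'" unfolding X[OF w'] r by simp
    then show ?l using w' by blast
  qed
qed

text \<open>Here \<open>(a, b)\<close> are the components of a vector at a point with fibre
  coordinates \<open>\<eta>\<close>, and \<open>(l \<eta>, F)\<close> is the direction of the leaf.
  The map to the sphere bundle kills exactly the vertical multiples of \<open>\<eta>\<close>, so the
  preimage of the leaf direction is a plane spanned by \<open>(\<eta>, g)\<close> and
  \<open>(0, \<eta>)\<close>. The term \<open>F / (l t)\<close> is the fibre part of the leaf
  direction divided by the last \<open>L\<close>-coordinate of its base part, a quotient that
  rescaling the direction leaves unchanged.\<close>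

lemma fibre_coordinate_iff:
  fixes L :: "'m::euclidean_space \<Rightarrow> 'f::euclidean_space \<times> real" and \<eta> :: 'm
  assumes L: "linear L" "bij L"
  defines "t \<equiv> snd (L \<eta>)"
  assumes t: "0 < t" and l: "l \<noteq> 0"
  shows "(\<exists>r. a = r *\<^sub>R l *\<^sub>R \<eta> \<and> (fst (L b) - snd (L b) *\<^sub>R (fst (L \<eta>) /\<^sub>R t)) /\<^sub>R t = r *\<^sub>R F)
    \<longleftrightarrow> (\<exists>\<alpha> \<beta>. a = \<beta> *\<^sub>R \<eta> \<and> b = \<beta> *\<^sub>R inv L (t\<^sup>2 *\<^sub>R (F /\<^sub>R (l * t)), 0) + \<alpha> *\<^sub>R \<eta>)"
proof -
  \<comment> \<open>Modulo \<open>\<eta>\<close> the vertical part is free; \<open>g\<close> is the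
    representative whose last \<open>L\<close>-coordinate vanishes.\<close>
  define g where "g = inv L (t\<^sup>2 *\<^sub>R (F /\<^sub>R (l * t)), 0)"
  have LG: "L g = ((t / l) *\<^sub>R F, 0)"
    using t l by (simp add: g_def surj_f_inv_f[OF bij_is_surj[OF L(2)]] power2_eq_square field_simps)
  have L\<eta>: "L \<eta> = (fst (L \<eta>), t)" by (simp add: t_def)
  have L_eq: "b = \<beta> *\<^sub>R g + \<alpha> *\<^sub>R \<eta> \<longleftrightarrow>
      fst (L b) = (\<beta> * t / l) *\<^sub>R F + \<alpha> *\<^sub>R fst (L \<eta>) \<and> snd (L b) = \<alpha> * t" for \<alpha> \<beta>
  proof -
    have "b = \<beta> *\<^sub>R g + \<alpha> *\<^sub>R \<eta> \<longleftrightarrow> L b = L (\<beta> *\<^sub>R g + \<alpha> *\<^sub>R \<eta>)"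
      using inj_eq[OF bij_is_inj[OF L(2)]] by blast
    also have "L (\<beta> *\<^sub>R g + \<alpha> *\<^sub>R \<eta>) = ((\<beta> * t / l) *\<^sub>R F + \<alpha> *\<^sub>R fst (L \<eta>), \<alpha> * t)"
      by (simp add: linear_add[OF L(1)] linear_cmul[OF L(1)] LG prod_eq_iff t_def)
    finally show ?thesis by (simp add: prod_eq_iff)
  qed
  show ?thesis
    unfolding g_def[symmetric]
  proof
    assume "\<exists>r. a = r *\<^sub>R l *\<^sub>R \<eta> \<and> (fst (L b) - snd (L b) *\<^sub>R (fst (L \<eta>) /\<^sub>R t)) /\<^sub>R t = r *\<^sub>R F"
    then obtain r where r: "a = r *\<^sub>R l *\<^sub>R \<eta>"
      "(fst (L b) - snd (L b) *\<^sub>R (fst (L \<eta>) /\<^sub>R t)) /\<^sub>R t = r *\<^sub>R F" by blast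
    have "fst (L b) - snd (L b) *\<^sub>R (fst (L \<eta>) /\<^sub>R t)
        = t *\<^sub>R ((fst (L b) - snd (L b) *\<^sub>R (fst (L \<eta>) /\<^sub>R t)) /\<^sub>R t)" using t by simp
    also have "\<dots> = (r * t) *\<^sub>R F" unfolding r(2) by (simp add: mult.commute)
    finally have "fst (L b) = (r * t) *\<^sub>R F + (snd (L b) / t) *\<^sub>R fst (L \<eta>)"
      by (simp add: algebra_simps divide_inverse)
    then have "b = (r * l) *\<^sub>R g + (snd (L b) / t) *\<^sub>R \<eta>" unfolding L_eq using t l by simp
    moreover have "a = (r * l) *\<^sub>R \<eta>" using r(1) by simp
    ultimately show "\<exists>\<alpha> \<beta>. a = \<beta> *\<^sub>R \<eta> \<and> b = \<beta> *\<^sub>R g + \<alpha> *\<^sub>R \<eta>" by blast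
  next
    assume "\<exists>\<alpha> \<beta>. a = \<beta> *\<^sub>R \<eta> \<and> b = \<beta> *\<^sub>R g + \<alpha> *\<^sub>R \<eta>"
    then obtain \<alpha> \<beta> where "a = \<beta> *\<^sub>R \<eta>" and b: "fst (L b) = (\<beta> * t / l) *\<^sub>R F + \<alpha> *\<^sub>R fst (L \<eta>)"
      "snd (L b) = \<alpha> * t" unfolding L_eq by blast
    moreover have "(fst (L b) - snd (L b) *\<^sub>R (fst (L \<eta>) /\<^sub>R t)) /\<^sub>R t = (\<beta> / l) *\<^sub>R F"
      unfolding b using t by (simp add: algebra_simps)
    ultimately show "\<exists>r. a = r *\<^sub>R l *\<^sub>R \<eta> \<and>
        (fst (L b) - snd (L b) *\<^sub>R (fst (L \<eta>) /\<^sub>R t)) /\<^sub>R t = r *\<^sub>R F"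
      using l by (intro exI[of _ "\<beta> / l"]) simp
  qed
qed

text \<open>The domain \<open>S\<close> is a cone over an open set of rays, which makes degree 2
  homogeneity of \<open>G\<close> meaningful. Everything on \<open>S\<close> is a function of the
  ray, apart from the power of \<open>t\<close> that produces the degree.\<close>

lemma path_distribution_local:
  fixes M :: "('p, 'm::euclidean_space) chart set"
  assumes M: "smooth_atlas M" and dim: "DIM('m) = DIM('f::euclidean_space) + 1"
    and \<F>: "path_geometry TYPE('f) M \<F>" and c: "c \<in> M"
    and y0: "y0 \<in> points (slit_bundle M)" "fst y0 \<in> fst c"
  obtains S G where "open S" "snd (slit_chart M c) y0 \<in> S" "S \<subseteq> (snd c ` fst c) \<times> (- {0})"
    "smooth_on S G"
    "\<And>x v t. (x, v) \<in> S \<Longrightarrow> 0 < t \<Longrightarrow> (x, t *\<^sub>R v) \<in> S \<and> G (x, t *\<^sub>R v) = t\<^sup>2 *\<^sub>R G (x, v)"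
    "\<And>y v. y \<in> points (slit_bundle M) \<Longrightarrow> fst y \<in> fst c \<Longrightarrow> snd (slit_chart M c) y \<in> S \<Longrightarrow>
      v \<in> tangent_space (slit_bundle M) y \<Longrightarrow>
      v \<in> path_distribution TYPE('f) M \<F> y \<longleftrightarrow>
      (\<exists>\<alpha> \<beta>. snd v (slit_chart M c)
        = (\<beta> *\<^sub>R snd y c, \<beta> *\<^sub>R G (snd (slit_chart M c) y) + \<alpha> *\<^sub>R snd y c))"
proof -
  let ?N = "sphere_bundle TYPE('f) M" and ?C = "slit_chart M c"
  obtain L :: "'m \<Rightarrow> 'f \<times> real" where L: "linear L" "bij L" and L0: "0 < snd (L (snd y0 c))"
    using ex_linear_bij_pos[OF dim points_slit_coord_nonzero[OF M y0(1) c y0(2)]] by blast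
  let ?K = "sphere_chart M c L"
  have K: "?K \<in> ?N" using c L by (rule sphere_chart_mem)
  have fol: "oriented_curve_foliation ?N \<F>" using \<F> by (simp add: path_geometry_def)
  have y0K: "ray y0 \<in> fst ?K" using ray_mem_sphere_chart[OF L(1) y0(1)] y0(2) L0 by blast
  then have "ray y0 \<in> points ?N" using K unfolding points_def by blast
  then obtain k where y0k: "ray y0 \<in> fst k" and k: "flat_chart ?N \<F> k"
    using fol unfolding oriented_curve_foliation_def by blast
  \<comment> \<open>A flat chart is required to be compatible with the charts of the sphere bundle,
    and this compatibility includes that those charts form an atlas.\<close>
  have N: "smooth_atlas ?N"
    using k smooth_atlas_insertD unfolding flat_chart_def by blast
  define A where "A = snd ?K ` (fst ?K \<inter> fst k)"
  obtain X where sX: "smooth_on A X"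
    and X: "\<And>B s. B \<in> \<F> \<Longrightarrow> s \<in> points B \<Longrightarrow> s \<in> fst ?K \<inter> fst k \<Longrightarrow>
      \<exists>e\<in>B. s \<in> fst e \<and> (\<exists>m. \<forall>w\<in>tangent_space B s.
        tangent_map B ?N (\<lambda>s. s) w = tvec_of ?N ?K s ((snd w e * m) *\<^sub>R X (snd ?K s)))"
    unfolding A_def by (rule leaf_direction[OF fol k K]) (rule that[unfolded A_def])
  have oA: "open A"
    unfolding A_def using k K by (intro chart_overlap_open[of "insert k ?N"]) (simp_all add: flat_chart_def)
  have leaf: "\<exists>B\<in>\<F>. s \<in> points B" if "s \<in> fst ?K" for s
  proof -
    have "(\<Union>B\<in>\<F>. points B) = points ?N"
      using fol unfolding oriented_curve_foliation_def by (elim conjE)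
    moreover have "s \<in> points ?N" unfolding points_def by (rule UN_I[where B=fst, OF K that])
    ultimately have "s \<in> (\<Union>B\<in>\<F>. points B)" by (simp only:)
    then show ?thesis by (simp only: UN_iff)
  qed
  have X1: "\<exists>l. l \<noteq> 0 \<and> fst (X (snd ?K (ray y))) = l *\<^sub>R snd y c"
    if y: "y \<in> points (slit_bundle M)" "ray y \<in> fst ?K \<inter> fst k" for y
  proof -
    have yK: "ray y \<in> fst ?K" using y(2) by blast
    obtain B where B: "B \<in> \<F>" "ray y \<in> points B" using leaf[OF yK] by blast
    obtain e m where "e \<in> B" "ray y \<in> fst e" "\<And>w. w \<in> tangent_space B (ray y) \<Longrightarrow>
        tangent_map B ?N (\<lambda>s. s) w = tvec_of ?N ?K (ray y) ((snd w e * m) *\<^sub>R X (snd ?K (ray y)))"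
      using X[OF B y(2)] by blast
    then show ?thesis by (rule path_geometry_leaf_tangents(1)[OF M N \<F> c L y(1) yK B])
  qed
  have dist: "v \<in> path_distribution TYPE('f) M \<F> y \<longleftrightarrow>
      (\<exists>r. tangent_map (slit_bundle M) ?N ray v = tvec_of ?N ?K (ray y) (r *\<^sub>R X (snd ?K (ray y))))"
    if y: "y \<in> points (slit_bundle M)" "ray y \<in> fst ?K \<inter> fst k" and v: "v \<in> tangent_space (slit_bundle M) y"
    for y v
  proof -
    have yK: "ray y \<in> fst ?K" using y(2) by blast
    have *: "(\<exists>w\<in>tangent_space B (ray y). z = tangent_map B ?N (\<lambda>s. s) w)
        \<longleftrightarrow> (\<exists>r. z = tvec_of ?N ?K (ray y) (r *\<^sub>R X (snd ?K (ray y))))"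
      if B: "B \<in> \<F>" "ray y \<in> points B" for B z
    proof -
      obtain e m where "e \<in> B" "ray y \<in> fst e" "\<And>w. w \<in> tangent_space B (ray y) \<Longrightarrow>
          tangent_map B ?N (\<lambda>s. s) w = tvec_of ?N ?K (ray y) ((snd w e * m) *\<^sub>R X (snd ?K (ray y)))"
        using X[OF B y(2)] by blast
      then show ?thesis by (rule path_geometry_leaf_tangents(2)[OF M N \<F> c L y(1) yK B])
    qed
    obtain B where B: "B \<in> \<F>" "ray y \<in> points B" using leaf[OF yK] by blast
    show ?thesis
      unfolding path_distribution_def mem_Collect_eq
    proof (intro iffI conjI v)
      assume "v \<in> tangent_space (slit_bundle M) y \<and> (\<exists>B\<in>\<F>. ray y \<in> points B \<and>
        (\<exists>w\<in>tangent_space B (ray y). tangent_map (slit_bundle M) ?N ray v = tangent_map B ?N (\<lambda>s. s) w))"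
      then obtain B' where B': "B' \<in> \<F>" "ray y \<in> points B'"
        "\<exists>w\<in>tangent_space B' (ray y). tangent_map (slit_bundle M) ?N ray v = tangent_map B' ?N (\<lambda>s. s) w"
        by blast
      then show "\<exists>r. tangent_map (slit_bundle M) ?N ray v = tvec_of ?N ?K (ray y) (r *\<^sub>R X (snd ?K (ray y)))"
        using *[OF B'(1,2)] by blast
    next
      assume "\<exists>r. tangent_map (slit_bundle M) ?N ray v = tvec_of ?N ?K (ray y) (r *\<^sub>R X (snd ?K (ray y)))"
      then show "\<exists>B\<in>\<F>. ray y \<in> points B \<and>
        (\<exists>w\<in>tangent_space B (ray y). tangent_map (slit_bundle M) ?N ray v = tangent_map B ?N (\<lambda>s. s) w)"
        using *[OF B] B by blast
    qed
  qed
  have repr: "\<exists>y. y \<in> points (slit_bundle M) \<and> ray y \<in> fst ?K \<inter> fst k \<and> q = snd ?K (ray y)" if q: "q \<in> A" for q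
  proof -
    obtain s where s: "s \<in> fst ?K" "s \<in> fst k" "q = snd ?K s" using q unfolding A_def by blast
    obtain y where "s = ray y" "y \<in> points (slit_bundle M)" by (rule mem_sphere_chartE[OF s(1)])
    then show ?thesis using s by blast
  qed
  \<comment> \<open>Every point of \<open>A\<close> comes from a vector \<open>y\<close> with
    positive last \<open>L\<close>-coordinate, and the base part of \<open>X\<close> is a nonzero
    multiple of \<open>y\<close>. This makes the denominator of \<open>F\<close> admissible on all
    of \<open>A\<close>.\<close>
  have X1_nonzero: "snd (L (fst (X q))) \<noteq> 0" if q: "q \<in> A" for q
  proof -
    obtain y where y: "y \<in> points (slit_bundle M)" "ray y \<in> fst ?K \<inter> fst k" "q = snd ?K (ray y)"
      using repr[OF q] by blast
    obtain l where "l \<noteq> 0" "fst (X q) = l *\<^sub>R snd y c" using X1[OF y(1,2)] y(3) by blast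
    moreover have "0 < snd (L (snd y c))" using ray_mem_sphere_chart[OF L(1) y(1)] y(2) by blast
    ultimately show ?thesis by (simp add: linear_cmul[OF L(1)])
  qed
  \<comment> \<open>Coordinate expression of \<open>ray\<close>; it is constant along positive
    multiples of the fibre variable.\<close>
  define \<rho> where "\<rho> = (\<lambda>z :: 'm \<times> 'm. (fst z, fst (L (snd z)) /\<^sub>R snd (L (snd z))))"
  define H where "H = {z :: 'm \<times> 'm. 0 < snd (L (snd z))}"
  define S where "S = H \<inter> \<rho> -` A"
  \<comment> \<open>With base part \<open>l *\<^sub>R y\<close> the denominator is
    \<open>l * t\<close>. The factor \<open>l\<close> is only known to exist for each
    \<open>y\<close>; this quotient contains it without naming it and is visibly smooth.\<close>
  define F where "F = (\<lambda>q. snd (X q) /\<^sub>R snd (L (fst (X q))))"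
  define G where "G = (\<lambda>z. inv L ((snd (L (snd z)))\<^sup>2 *\<^sub>R F (\<rho> z), 0))"
  have bL: "bounded_linear L" using L(1) by (rule linear_conv_bounded_linear[THEN iffD1])
  have "continuous_on UNIV (\<lambda>z :: 'm \<times> 'm. snd (L (snd z)))"
    by (rule continuous_on_snd[OF bounded_linear.continuous_on[OF bL continuous_on_snd[OF continuous_on_id]]])
  then have oH: "open H"
    unfolding H_def by (rule open_Collect_less[OF continuous_on_const])
  have sL: "smooth_on U (\<lambda>z. L (snd z))" if "open U" for U :: "('m \<times> 'm) set"
    by (rule smooth_on_linear[OF L(1) that smooth_on_snd[OF that smooth_on_id[OF that]]])
  have s\<rho>: "smooth_on H \<rho>"
    unfolding \<rho>_def
  proof (rule smooth_on_Pair[OF oH smooth_on_fst[OF oH smooth_on_id[OF oH]]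
        smooth_on_scaleR[OF oH smooth_on_inverse[OF oH smooth_on_snd[OF oH sL[OF oH]]]
          smooth_on_fst[OF oH sL[OF oH]]]])
    fix z assume "z \<in> H" then show "snd (L (snd z)) \<noteq> 0" by (simp add: H_def)
  qed
  have oS: "open S"
    unfolding S_def
    by (rule continuous_open_preimage[OF smooth_on_imp_continuous_on[OF s\<rho>] oH oA])
  have s\<rho>S: "smooth_on S \<rho>" by (rule smooth_on_subset[OF s\<rho>]) (simp add: S_def)
  have sXA: "smooth_on A (\<lambda>q. L (fst (X q)))"
    by (rule smooth_on_linear[OF L(1) oA smooth_on_fst[OF oA sX]])
  have sF: "smooth_on A F"
    unfolding F_def
    by (rule smooth_on_scaleR[OF oA smooth_on_inverse[OF oA smooth_on_snd[OF oA sXA] X1_nonzero]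
          smooth_on_snd[OF oA sX]])
  have \<rho>S: "\<rho> ` S \<subseteq> A" unfolding S_def by blast
  have LL: "L (inv L z) = z" for z by (rule surj_f_inv_f[OF bij_is_surj[OF L(2)]])
  have linv: "linear (inv L)"
    by (rule linearI; rule inv_f_eq[OF bij_is_inj[OF L(2)]])
      (simp_all add: linear_add[OF L(1)] linear_cmul[OF L(1)] LL)
  have "smooth_on S G"
    unfolding G_def power2_eq_square
    by (rule smooth_on_linear[OF linv oS smooth_on_Pair[OF oS smooth_on_scaleR[OF oS
          smooth_on_mult[OF oS smooth_on_snd[OF oS sL[OF oS]] smooth_on_snd[OF oS sL[OF oS]]]
          smooth_on_compose[OF oS oA s\<rho>S sF \<rho>S]] smooth_on_const]])
  moreover have \<rho>y: "\<rho> (snd ?C y) = snd ?K (ray y)" for y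
    by (simp add: \<rho>_def slit_chart_apply sphere_chart_ray[OF L(1)])
  have "snd ?C y0 \<in> S"
    unfolding S_def vimage_eq Int_iff \<rho>y using L0 y0K y0k
    by (simp add: H_def slit_chart_apply A_def)
  moreover have "S \<subseteq> (snd c ` fst c) \<times> (- {0})"
  proof
    fix z assume z: "z \<in> S"
    then have "\<rho> z \<in> A" unfolding S_def by blast
    then obtain y where y: "y \<in> points (slit_bundle M)" "ray y \<in> fst ?K \<inter> fst k" "\<rho> z = snd ?K (ray y)"
      using repr by blast
    have "fst y \<in> fst c" using ray_mem_sphere_chart[OF L(1) y(1)] y(2) by blast
    moreover have "fst z = snd c (fst y)" using y(3) by (simp add: \<rho>_def sphere_chart_ray[OF L(1)])
    moreover have "snd z \<noteq> 0" using z linear_0[OF L(1)] by (auto simp: S_def H_def)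
    ultimately show "z \<in> (snd c ` fst c) \<times> (- {0})" by (simp add: mem_Times_iff)
  qed
  moreover have "(x, t *\<^sub>R v) \<in> S \<and> G (x, t *\<^sub>R v) = t\<^sup>2 *\<^sub>R G (x, v)" if "(x, v) \<in> S" "0 < t" for x v t
  proof -
    have \<rho>t: "\<rho> (x, t *\<^sub>R v) = \<rho> (x, v)" using that(2) by (simp add: \<rho>_def linear_cmul[OF L(1)])
    have "(x, t *\<^sub>R v) \<in> S" using that unfolding S_def vimage_eq Int_iff \<rho>t
      by (simp add: H_def linear_cmul[OF L(1)])
    moreover have "G (x, t *\<^sub>R v) = inv L (t\<^sup>2 *\<^sub>R ((snd (L v))\<^sup>2 *\<^sub>R F (\<rho> (x, v)), 0))"
      unfolding G_def \<rho>t by (simp add: linear_cmul[OF L(1)] power_mult_distrib)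
    ultimately show ?thesis unfolding linear_cmul[OF linv] G_def by simp
  qed
  moreover have "v \<in> path_distribution TYPE('f) M \<F> y \<longleftrightarrow>
      (\<exists>\<alpha> \<beta>. snd v ?C = (\<beta> *\<^sub>R snd y c, \<beta> *\<^sub>R G (snd ?C y) + \<alpha> *\<^sub>R snd y c))"
    if y: "y \<in> points (slit_bundle M)" "fst y \<in> fst c" "snd ?C y \<in> S"
      and v: "v \<in> tangent_space (slit_bundle M) y" for y v
  proof -
    define a where "a = fst (snd v ?C)"
    define b where "b = snd (snd v ?C)"
    define \<eta> where "\<eta> = snd y c"
    define t where "t = snd (L \<eta>)"
    have t: "0 < t" using y(3) by (simp add: S_def H_def slit_chart_apply t_def \<eta>_def)
    have yK: "ray y \<in> fst ?K" using ray_mem_sphere_chart[OF L(1) y(1)] y(2) t by (simp add: t_def \<eta>_def)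
    have "snd ?K (ray y) \<in> A" using y(3) unfolding S_def vimage_eq Int_iff \<rho>y by blast
    \<comment> \<open>Membership in \<open>A\<close> only says that some ray in both domains has
      these coordinates; injectivity of the chart identifies it with \<open>ray y\<close>.\<close>
    then have "chart_inv ?K (snd ?K (ray y)) \<in> fst ?K \<inter> fst k"
      unfolding A_def by (rule chart_inv_mem[OF N K]) simp
    then have yk: "ray y \<in> fst ?K \<inter> fst k" unfolding chart_inv_chart[OF N K yK] .
    define Y where "Y = X (snd ?K (ray y))"
    obtain l where l: "l \<noteq> 0" "fst Y = l *\<^sub>R \<eta>" using X1[OF y(1) yk] unfolding Y_def \<eta>_def by blast
    have Gy: "G (snd ?C y) = inv L (t\<^sup>2 *\<^sub>R (snd Y /\<^sub>R (l * t)), 0)"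
      unfolding G_def \<rho>y F_def Y_def[symmetric] l(2)
      by (simp add: slit_chart_apply t_def \<eta>_def linear_cmul[OF L(1)])
    have tm: "tangent_map (slit_bundle M) ?N ray v
        = tvec_of ?N ?K (ray y) (a, (fst (L b) - snd (L b) *\<^sub>R (fst (L \<eta>) /\<^sub>R t)) /\<^sub>R t)"
      unfolding a_def b_def t_def \<eta>_def
      by (rule tangent_map_ray[OF M N c L y(1,2) _ v]) (use t in \<open>simp add: t_def \<eta>_def\<close>)
    have "v \<in> path_distribution TYPE('f) M \<F> y \<longleftrightarrow>
        (\<exists>r. (a, (fst (L b) - snd (L b) *\<^sub>R (fst (L \<eta>) /\<^sub>R t)) /\<^sub>R t) = r *\<^sub>R Y)"
      unfolding dist[OF y(1) yk v] tm Y_def[symmetric] tvec_of_inject[OF N K yK] ..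
    also have "\<dots> \<longleftrightarrow> (\<exists>r. a = r *\<^sub>R l *\<^sub>R \<eta> \<and>
        (fst (L b) - snd (L b) *\<^sub>R (fst (L \<eta>) /\<^sub>R t)) /\<^sub>R t = r *\<^sub>R snd Y)"
      by (simp only: prod_eq_iff fst_conv snd_conv fst_scaleR snd_scaleR l(2))
    also have "\<dots> \<longleftrightarrow> (\<exists>\<alpha> \<beta>. a = \<beta> *\<^sub>R \<eta> \<and> b = \<beta> *\<^sub>R G (snd ?C y) + \<alpha> *\<^sub>R \<eta>)"
      unfolding Gy t_def by (rule fibre_coordinate_iff[OF L _ l(1)]) (use t in \<open>simp add: t_def\<close>)
    also have "\<dots> \<longleftrightarrow> (\<exists>\<alpha> \<beta>. snd v ?C = (\<beta> *\<^sub>R \<eta>, \<beta> *\<^sub>R G (snd ?C y) + \<alpha> *\<^sub>R \<eta>))"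
      by (simp only: prod_eq_iff fst_conv snd_conv a_def b_def)
    finally show ?thesis unfolding \<eta>_def .
  qed
  ultimately show ?thesis using that[OF oS] by blast
qed

section \<open>A fibrewise quadratic energy function\<close>

lemma openin_chart_inv_image:
  assumes M: "smooth_atlas M" and d: "d \<in> M" and U: "open U" "U \<subseteq> snd d ` fst d"
  shows "openin (mtop M) (chart_inv d ` U)"
  unfolding openin_mtop[OF M]
proof (intro conjI ballI subsetI)
  fix p assume "p \<in> chart_inv d ` U"
  then obtain x where x: "x \<in> U" "p = chart_inv d x" by blast
  have "x \<in> snd d ` fst d" using U(2) x(1) by (rule subsetD)
  then have "p \<in> fst d" unfolding x(2) by (rule chart_inv_into) simp
  then show "p \<in> points M" unfolding points_def using d by blast
next
  fix c assume c: "c \<in> M"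
  have "snd c ` (chart_inv d ` U \<inter> fst c)
      = (snd c ` (fst c \<inter> fst d)) \<inter> (snd d \<circ> chart_inv c) -` U" (is "?l = ?r")
  proof (intro equalityI subsetI)
    fix z assume "z \<in> ?l"
    then obtain x where x: "x \<in> U" "chart_inv d x \<in> fst c" "z = snd c (chart_inv d x)" by blast
    have xd: "x \<in> snd d ` fst d" using U(2) x(1) by (rule subsetD)
    have "chart_inv d x \<in> fst d" using xd by (rule chart_inv_into) simp
    moreover have "snd d (chart_inv d x) = x" using xd by (rule chart_chart_inv) simp
    ultimately show "z \<in> ?r"
      using x by (simp add: chart_inv_chart[OF M c])
  next
    fix z assume "z \<in> ?r"
    then obtain p where p: "p \<in> fst c" "p \<in> fst d" "z = snd c p" "snd d (chart_inv c z) \<in> U" by auto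
    have "snd d p \<in> U" using p(4) unfolding p(3) chart_inv_chart[OF M c p(1)] .
    then have "p \<in> chart_inv d ` U"
      using chart_inv_chart[OF M d p(2), symmetric] by (rule rev_image_eqI)
    then show "z \<in> ?l" using p by blast
  qed
  then show "open (snd c ` (chart_inv d ` U \<inter> fst c))"
    using continuous_open_preimage[OF smooth_on_imp_continuous_on[OF transition_smooth[OF M c d]]
        chart_overlap_open[OF M c d] U(1)] by (simp only:)
qed

lemma compactin_chart_inv_image:
  assumes M: "smooth_atlas M" and d: "d \<in> M" and K: "compact K" "K \<subseteq> snd d ` fst d"
  shows "compactin (mtop M) (chart_inv d ` K)"
proof (rule image_compactin)
  show "compactin (top_of_set (snd d ` fst d)) K"
    using K by (intro compact_imp_compactin_subtopology) (simp_all add: compactin_euclidean_iff)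
  show "continuous_map (top_of_set (snd d ` fst d)) (mtop M) (chart_inv d)"
    unfolding continuous_map_def
  proof (intro conjI allI impI funcsetI)
    fix x assume "x \<in> topspace (top_of_set (snd d ` fst d))"
    then have "chart_inv d x \<in> fst d" using chart_inv_into[of x d "fst d"] by simp
    then show "chart_inv d x \<in> topspace (mtop M)"
      unfolding topspace_mtop[OF M] points_def using d by blast
  next
    fix U assume U: "openin (mtop M) U"
    have "{x \<in> snd d ` fst d. chart_inv d x \<in> U} = snd d ` (U \<inter> fst d)"
      using chart_inv_chart[OF M d] by auto
    moreover have "open (snd d ` (U \<inter> fst d))" using U d unfolding openin_mtop[OF M] by blast
    moreover have "snd d ` (U \<inter> fst d) \<subseteq> snd d ` fst d" by blast
    ultimately show "openin (top_of_set (snd d ` fst d))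
        {x \<in> topspace (top_of_set (snd d ` fst d)). chart_inv d x \<in> U}"
      using open_subset by simp
  qed
qed

text \<open>Finitely many of the neighbourhoods provided by local finiteness cover \<open>K\<close>,
  and each of them meets finitely many members.\<close>

lemma locally_finite_in_compactin:
  assumes "locally_finite_in X \<V>" "compactin X K"
  shows "finite {V \<in> \<V>. V \<inter> K \<noteq> {}}"
proof -
  define \<U> where "\<U> = {U. openin X U \<and> finite {V \<in> \<V>. V \<inter> U \<noteq> {}}}"
  have K: "K \<subseteq> topspace X" using assms(2) unfolding compactin_def by blast
  have "K \<subseteq> \<Union>\<U>"
  proof
    fix x assume "x \<in> K"
    then have "x \<in> topspace X" using K by blast
    then obtain U where "openin X U" "x \<in> U" "finite {V \<in> \<V>. V \<inter> U \<noteq> {}}"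
      using assms(1) unfolding locally_finite_in_def by blast
    then show "x \<in> \<Union>\<U>" unfolding \<U>_def by blast
  qed
  moreover have "\<forall>U\<in>\<U>. openin X U" unfolding \<U>_def by blast
  ultimately obtain \<W> where W: "finite \<W>" "\<W> \<subseteq> \<U>" "K \<subseteq> \<Union>\<W>"
    using assms(2) unfolding compactin_def by blast
  have "finite (\<Union>U\<in>\<W>. {V \<in> \<V>. V \<inter> U \<noteq> {}})"
  proof (rule finite_UN_I[OF W(1)])
    fix U assume "U \<in> \<W>"
    then have "U \<in> \<U>" using W(2) by blast
    then show "finite {V \<in> \<V>. V \<inter> U \<noteq> {}}" unfolding \<U>_def by blast
  qed
  moreover have "{V \<in> \<V>. V \<inter> K \<noteq> {}} \<subseteq> (\<Union>U\<in>\<W>. {V \<in> \<V>. V \<inter> U \<noteq> {}})"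
    using W(3) by blast
  ultimately show ?thesis by (rule finite_subset[rotated])
qed

abbreviation chart_ball :: "('p, 'm::euclidean_space) chart \<times> 'm \<times> real \<Rightarrow> 'p set" where
  "chart_ball i \<equiv> chart_inv (fst i) ` ball (fst (snd i)) (snd (snd i))"

text \<open>The closed ball has to fit into the chart image, not just the open one: its copy in the
  manifold is compact, hence closed in a Hausdorff space, and a function supported there extends
  smoothly by 0 beyond the chart.\<close>

definition chart_balls :: "('p, 'm::euclidean_space) chart set \<Rightarrow> (('p, 'm) chart \<times> 'm \<times> real) set" where
  "chart_balls M = {(d, a, r). d \<in> M \<and> 0 < r \<and> cball a r \<subseteq> snd d ` fst d}"

lemma openin_chart_ball:
  assumes "smooth_atlas M" "i \<in> chart_balls M"
  shows "openin (mtop M) (chart_ball i)"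
proof -
  obtain d a r where i: "i = (d, a, r)" "d \<in> M" "cball a r \<subseteq> snd d ` fst d"
    using assms(2) by (auto simp: chart_balls_def)
  show ?thesis
    unfolding i(1) fst_conv snd_conv
    by (rule openin_chart_inv_image[OF assms(1) i(2) open_ball subset_trans[OF ball_subset_cball i(3)]])
qed

lemma ex_chart_ball:
  assumes M: "smooth_atlas M" and U: "openin (mtop M) U" "p \<in> U"
  shows "\<exists>i\<in>chart_balls M. p \<in> chart_ball i \<and> chart_ball i \<subseteq> U"
proof -
  have "p \<in> points M" using U unfolding openin_mtop[OF M] by blast
  then obtain d where d: "d \<in> M" "p \<in> fst d" unfolding points_def by blast
  have "open (snd d ` (U \<inter> fst d))" using U(1) d(1) unfolding openin_mtop[OF M] by blast
  moreover have "snd d p \<in> snd d ` (U \<inter> fst d)" using U(2) d(2) by blast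
  ultimately obtain r where r: "0 < r" "cball (snd d p) r \<subseteq> snd d ` (U \<inter> fst d)"
    using open_contains_cball by metis
  have "(d, snd d p, r) \<in> chart_balls M"
    unfolding chart_balls_def using d(1) r by blast
  moreover have "p \<in> chart_inv d ` ball (snd d p) r"
    using chart_inv_chart[OF M d, symmetric] r(1) by (intro image_eqI[of _ _ "snd d p"]) simp_all
  moreover have "chart_inv d ` ball (snd d p) r \<subseteq> U"
  proof
    fix q assume "q \<in> chart_inv d ` ball (snd d p) r"
    then obtain x where x: "x \<in> ball (snd d p) r" "q = chart_inv d x" by blast
    have "x \<in> snd d ` (U \<inter> fst d)" using x(1) r(2) ball_subset_cball by blast
    then have "chart_inv d x \<in> U \<inter> fst d" by (rule chart_inv_mem[OF M d(1)]) simp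
    then show "q \<in> U" using x(2) by blast
  qed
  ultimately show ?thesis by (intro bexI[of _ "(d, snd d p, r)"]) simp_all
qed

text \<open>
  Taking finitely many balls for each member of a locally finite refinement with compact closures
  avoids shrinking the refinement.
\<close>

lemma ex_locally_finite_chart_balls:
  assumes sm: "smooth_manifold M"
  obtains I where "I \<subseteq> chart_balls M" "points M \<subseteq> (\<Union>i\<in>I. chart_ball i)"
    "\<And>p. p \<in> points M \<Longrightarrow> \<exists>N. openin (mtop M) N \<and> p \<in> N \<and> finite {i \<in> I. chart_ball i \<inter> N \<noteq> {}}"
proof -
  have M: "smooth_atlas M" and haus: "Hausdorff_space (mtop M)" and para: "paracompact_space (mtop M)"
    using sm by (simp_all add: smooth_manifold_def)
  let ?X = "mtop M"
  have top: "topspace ?X = points M" using M by (rule topspace_mtop)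
  have opn: "openin ?X (chart_ball i)" if "i \<in> chart_balls M" for i
    using M that by (rule openin_chart_ball)
  have un: "\<Union>(chart_ball ` chart_balls M) = topspace ?X"
  proof (intro equalityI subsetI)
    fix p assume "p \<in> \<Union>(chart_ball ` chart_balls M)"
    then obtain i where i: "i \<in> chart_balls M" "p \<in> chart_ball i" by blast
    show "p \<in> topspace ?X" using openin_subset[OF opn[OF i(1)]] i(2) by blast
  next
    fix p assume "p \<in> topspace ?X"
    then obtain i where "i \<in> chart_balls M" "p \<in> chart_ball i"
      using ex_chart_ball[OF M openin_topspace] by blast
    then show "p \<in> \<Union>(chart_ball ` chart_balls M)" by blast
  qed
  have op: "\<forall>U\<in>chart_ball ` chart_balls M. openin ?X U"
    by (intro ballI) (elim imageE, simp only: opn)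
  obtain \<V> where V: "\<forall>V\<in>\<V>. openin ?X V \<and> (\<exists>U\<in>chart_ball ` chart_balls M. V \<subseteq> U)"
      "\<Union>\<V> = topspace ?X" and lf: "locally_finite_in ?X \<V>"
    using mp[OF spec[OF para[unfolded paracompact_space_def], of "chart_ball ` chart_balls M"] conjI[OF op un]]
    by (elim exE conjE) (rule that)
  \<comment> \<open>The closure stays inside the copy of a closed ball, which is compact and, by the
    Hausdorff property, closed.\<close>
  have comp: "compactin ?X (?X closure_of V)" if "V \<in> \<V>" for V
  proof -
    obtain i where i: "i \<in> chart_balls M" "V \<subseteq> chart_ball i" using V(1) \<open>V \<in> \<V>\<close> by blast
    define K where "K = chart_inv (fst i) ` cball (fst (snd i)) (snd (snd i))"
    have "compactin ?X K"
      unfolding K_def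
      by (rule compactin_chart_inv_image[OF M _ compact_cball]) (use i(1) in \<open>auto simp: chart_balls_def\<close>)
    moreover from compactin_imp_closedin[OF haus this] have "closedin ?X K" .
    moreover have "V \<subseteq> K" using i(2) ball_subset_cball unfolding K_def by blast
    ultimately show ?thesis
      using closed_compactin[of ?X K "?X closure_of V"] closure_of_minimal[of V K ?X]
        closedin_closure_of[of ?X V] by blast
  qed
  define J where "J = (\<lambda>V. {i \<in> chart_balls M. \<exists>V'\<in>\<V>. chart_ball i \<subseteq> V' \<and> V' \<inter> V \<noteq> {}})"
  have ex: "\<exists>B. finite B \<and> B \<subseteq> J V \<and> ?X closure_of V \<subseteq> (\<Union>i\<in>B. chart_ball i)" if "V \<in> \<V>" for V
  proof -
    have "?X closure_of V \<subseteq> \<Union>(chart_ball ` J V)"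
    proof
      fix q assume q: "q \<in> ?X closure_of V"
      then have "q \<in> \<Union>\<V>" unfolding V(2) in_closure_of by blast
      then obtain V' where V': "V' \<in> \<V>" "q \<in> V'" by blast
      have oV': "openin ?X V'" using V(1) V'(1) by blast
      then have "V' \<inter> V \<noteq> {}" using q V'(2) unfolding in_closure_of by blast
      moreover obtain i where "i \<in> chart_balls M" "q \<in> chart_ball i" "chart_ball i \<subseteq> V'"
        using ex_chart_ball[OF M oV' V'(2)] by blast
      ultimately show "q \<in> \<Union>(chart_ball ` J V)" unfolding J_def using V'(1) by blast
    qed
    moreover have "\<forall>U\<in>chart_ball ` J V. openin ?X U" using opn unfolding J_def by blast
    ultimately obtain \<W> where W: "finite \<W>" "\<W> \<subseteq> chart_ball ` J V" "?X closure_of V \<subseteq> \<Union>\<W>"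
      using comp[OF \<open>V \<in> \<V>\<close>] unfolding compactin_def by meson
    obtain B where "B \<subseteq> J V" "finite B" "\<W> = chart_ball ` B"
      using finite_subset_image[OF W(1,2)] by blast
    then show ?thesis using W(3) by blast
  qed
  define B where "B = (\<lambda>V. SOME B. finite B \<and> B \<subseteq> J V \<and> ?X closure_of V \<subseteq> (\<Union>i\<in>B. chart_ball i))"
  have B_spec: "finite (B V) \<and> B V \<subseteq> J V \<and> ?X closure_of V \<subseteq> (\<Union>i\<in>B V. chart_ball i)" if "V \<in> \<V>" for V
    unfolding B_def by (rule someI_ex[OF ex[OF that]])
  note B = conjunct1[OF B_spec] conjunct1[OF conjunct2[OF B_spec]] conjunct2[OF conjunct2[OF B_spec]]
  define I where "I = (\<Union>V\<in>\<V>. B V)"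
  show ?thesis
  proof (rule that[of I])
    show "I \<subseteq> chart_balls M"
    proof
      fix i assume "i \<in> I"
      then obtain V where "V \<in> \<V>" "i \<in> B V" unfolding I_def by blast
      then have "i \<in> J V" using B(2) by blast
      then show "i \<in> chart_balls M" unfolding J_def by blast
    qed
    show "points M \<subseteq> (\<Union>i\<in>I. chart_ball i)"
    proof
      fix p assume "p \<in> points M"
      then obtain V where V': "V \<in> \<V>" "p \<in> V" using V(2) top by blast
      then have "p \<in> ?X closure_of V"
        using closure_of_subset[of V ?X] openin_subset[of ?X V] V(1) by blast
      then have "p \<in> (\<Union>i\<in>B V. chart_ball i)" using B(3)[OF V'(1)] by (rule subsetD[rotated])
      then obtain i where "i \<in> B V" "p \<in> chart_ball i" by (rule UN_E)
      then show "p \<in> (\<Union>i\<in>I. chart_ball i)" unfolding I_def using V'(1) by blast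
    qed
    fix p assume "p \<in> points M"
    then obtain N where N: "openin ?X N" "p \<in> N" "finite {V \<in> \<V>. V \<inter> N \<noteq> {}}"
      using lf unfolding locally_finite_in_def top by blast
    have meet: "finite {V \<in> \<V>. V' \<inter> V \<noteq> {}}" if V': "V' \<in> \<V>" for V'
    proof (rule finite_subset[OF _ locally_finite_in_compactin[OF lf comp[OF V']]])
      have "V' \<subseteq> ?X closure_of V'"
        using closure_of_subset[of V' ?X] openin_subset[of ?X V'] V(1) V' by blast
      then show "{V \<in> \<V>. V' \<inter> V \<noteq> {}} \<subseteq> {V \<in> \<V>. V \<inter> (?X closure_of V') \<noteq> {}}" by blast
    qed
    \<comment> \<open>A ball meeting \<open>N\<close> lies in some \<open>V'\<close> meeting
      \<open>N\<close>: finitely many possibilities. It was selected for some \<open>V\<close>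
      meeting \<open>V'\<close>: finitely many for each \<open>V'\<close>, since the closure of
      \<open>V'\<close> is compact. And each \<open>V\<close> selects finitely many balls.\<close>
    have "finite (\<Union>V'\<in>{V \<in> \<V>. V \<inter> N \<noteq> {}}. \<Union>V\<in>{V \<in> \<V>. V' \<inter> V \<noteq> {}}. B V)"
    proof (rule finite_UN_I[OF N(3)])
      fix V' assume "V' \<in> {V \<in> \<V>. V \<inter> N \<noteq> {}}"
      then have "V' \<in> \<V>" by blast
      show "finite (\<Union>V\<in>{V \<in> \<V>. V' \<inter> V \<noteq> {}}. B V)"
        by (rule finite_UN_I[OF meet[OF \<open>V' \<in> \<V>\<close>]]) (use B(1) in blast)
    qed
    moreover have "{i \<in> I. chart_ball i \<inter> N \<noteq> {}}
        \<subseteq> (\<Union>V'\<in>{V \<in> \<V>. V \<inter> N \<noteq> {}}. \<Union>V\<in>{V \<in> \<V>. V' \<inter> V \<noteq> {}}. B V)"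
    proof
      fix i assume i: "i \<in> {i \<in> I. chart_ball i \<inter> N \<noteq> {}}"
      then obtain V where V': "V \<in> \<V>" "i \<in> B V" unfolding I_def by blast
      then have "i \<in> J V" using B(2) by blast
      then obtain V' where "V' \<in> \<V>" "chart_ball i \<subseteq> V'" "V' \<inter> V \<noteq> {}" unfolding J_def by blast
      moreover have "V' \<inter> N \<noteq> {}" using i \<open>chart_ball i \<subseteq> V'\<close> by blast
      ultimately show "i \<in> (\<Union>V'\<in>{V \<in> \<V>. V \<inter> N \<noteq> {}}. \<Union>V\<in>{V \<in> \<V>. V' \<inter> V \<noteq> {}}. B V)"
        using V' by blast
    qed
    ultimately have "finite {i \<in> I. chart_ball i \<inter> N \<noteq> {}}" by (rule finite_subset[rotated])
    then show "\<exists>N. openin ?X N \<and> p \<in> N \<and> finite {i \<in> I. chart_ball i \<inter> N \<noteq> {}}" using N(1,2) by blast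
  qed
qed

section \<open>Quadratic energies supported in coordinate balls\<close>

text \<open>The argument of the bump is positive exactly inside the ball, and squared distances keep
  it smooth at the centre, where the norm is not.\<close>

definition ball_energy :: "('p, 'm::euclidean_space) chart \<times> 'm \<times> real \<Rightarrow> ('p, 'm) tvec \<Rightarrow> real" where
  "ball_energy i y = (case i of (d, a, r) \<Rightarrow>
     flat_exp 0 (r\<^sup>2 - (snd d (fst y) - a) \<bullet> (snd d (fst y) - a)) * (snd y d \<bullet> snd y d))"

lemma flat_exp_nonneg: "0 \<le> flat_exp n t"
  by (simp add: flat_exp_def)

lemma ball_energy_nonneg: "0 \<le> ball_energy i y"
  by (simp add: ball_energy_def flat_exp_nonneg split: prod.split)

lemma ball_energy_tscale: "ball_energy i (tscale t y) = t\<^sup>2 * ball_energy i y"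
  by (simp add: ball_energy_def power2_eq_square split: prod.split)

lemma ball_energy_eq_0:
  assumes M: "smooth_atlas M" and i: "i \<in> chart_balls M" and y: "y \<in> points (slit_bundle M)"
    and out: "fst y \<notin> chart_ball i"
  shows "ball_energy i y = 0"
proof -
  obtain d a r where i': "i = (d, a, r)" "d \<in> M" "0 < r" using i by (auto simp: chart_balls_def)
  show ?thesis
  proof (cases "fst y \<in> fst d")
    case True
    have "snd d (fst y) \<notin> ball a r"
    proof
      assume "snd d (fst y) \<in> ball a r"
      then have "fst y \<in> chart_inv d ` ball a r"
        using chart_inv_chart[OF M i'(2) True, symmetric] by (rule rev_image_eqI)
      then show False using out i'(1) by simp
    qed
    then have "r \<le> norm (snd d (fst y) - a)" by (simp add: dist_norm norm_minus_commute)
    then have "r\<^sup>2 \<le> (snd d (fst y) - a) \<bullet> (snd d (fst y) - a)"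
      using i'(3) by (simp add: power2_norm_eq_inner[symmetric] power_mono)
    then show ?thesis by (simp add: ball_energy_def i'(1) flat_exp_def)
  next
    \<comment> \<open>Outside the chart \<open>snd d (fst y)\<close> is an arbitrary value, but the
      component \<open>snd y d\<close> is 0 by the convention for tangent vectors and annihilates
      the product.\<close>
    case False
    have "y \<in> tangent_space M (fst y)" using y by (simp add: mem_points_slit)
    from tangent_space_0[OF this] have "snd y d = 0" using False by blast
    then show ?thesis by (simp add: ball_energy_def i'(1))
  qed
qed

lemma ball_energy_pos:
  assumes M: "smooth_atlas M" and i: "i \<in> chart_balls M" and y: "y \<in> points (slit_bundle M)"
    and y_in: "fst y \<in> chart_ball i"
  shows "0 < ball_energy i y"
proof -
  obtain d a r where i': "i = (d, a, r)" "d \<in> M" "0 < r" "cball a r \<subseteq> snd d ` fst d"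
    using i by (auto simp: chart_balls_def)
  obtain x where x: "x \<in> ball a r" "fst y = chart_inv d x" using y_in i'(1) by auto
  have xd: "x \<in> snd d ` fst d" using x(1) i'(4) ball_subset_cball by blast
  have yd: "fst y \<in> fst d" unfolding x(2) by (rule chart_inv_into[OF xd]) simp
  have "snd d (fst y) = x" unfolding x(2) by (rule chart_chart_inv[OF xd]) simp
  then have "norm (snd d (fst y) - a) < r" using x(1) by (simp add: dist_norm norm_minus_commute)
  then have "(snd d (fst y) - a) \<bullet> (snd d (fst y) - a) < r\<^sup>2"
    by (simp add: power2_norm_eq_inner[symmetric] power_strict_mono)
  moreover have "snd y d \<noteq> 0" by (rule points_slit_coord_nonzero[OF M y i'(2) yd])
  ultimately show ?thesis by (simp add: ball_energy_def i'(1) flat_exp_def)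
qed

lemma slit_chart_inv_mem:
  assumes "smooth_atlas M" "c \<in> M" "z \<in> (snd c ` S) \<times> (- {0})" "S \<subseteq> fst c"
  shows "chart_inv (slit_chart M c) z \<in> points (slit_bundle M)"
    and "fst (chart_inv (slit_chart M c) z) \<in> S"
    and "snd c (fst (chart_inv (slit_chart M c) z)) = fst z"
    and "snd (chart_inv (slit_chart M c) z) c = snd z"
proof -
  have z: "z \<in> snd (slit_chart M c) ` fst (slit_chart M c)"
    unfolding slit_chart_image[OF assms(1,2)] using assms(3,4) by (auto simp: mem_Times_iff)
  have m: "chart_inv (slit_chart M c) z \<in> fst (slit_chart M c)" by (rule chart_inv_into[OF z]) simp
  then show "chart_inv (slit_chart M c) z \<in> points (slit_bundle M)"
    by (simp only: mem_slit_chart_iff)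
  have "snd (slit_chart M c) (chart_inv (slit_chart M c) z) = z" by (rule chart_chart_inv[OF z]) simp
  then show e: "snd c (fst (chart_inv (slit_chart M c) z)) = fst z"
    and "snd (chart_inv (slit_chart M c) z) c = snd z"
    unfolding slit_chart_apply by (simp_all add: prod_eq_iff)
  have pc: "fst (chart_inv (slit_chart M c) z) \<in> fst c" using m by (simp only: mem_slit_chart_iff)
  have "fst z \<in> snd c ` S" using assms(3) by (simp add: mem_Times_iff)
  from chart_inv_mem[OF assms(1,2) this assms(4)]
  show "fst (chart_inv (slit_chart M c) z) \<in> S"
    unfolding e[symmetric] chart_inv_chart[OF assms(1,2) pc] .
qed

text \<open>Where the charts \<open>c\<close> and \<open>d\<close> overlap the energy is an explicit
  smooth expression in the transition map. At points outside the domain of \<open>d\<close> it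
  vanishes near the point, because the support lies in a closed set inside that domain.\<close>

lemma smooth_ball_energy:
  assumes M: "smooth_atlas M" and haus: "Hausdorff_space (mtop M)" and i: "i \<in> chart_balls M" and c: "c \<in> M"
  shows "smooth_on (snd (slit_chart M c) ` fst (slit_chart M c)) (ball_energy i \<circ> chart_inv (slit_chart M c))"
  unfolding slit_chart_image[OF M c]
proof (rule smooth_on_local)
  fix z assume z: "z \<in> (snd c ` fst c) \<times> (- {0::'b})"
  obtain d a r where i': "i = (d, a, r)" "d \<in> M" "0 < r" "cball a r \<subseteq> snd d ` fst d"
    using i by (auto simp: chart_balls_def)
  let ?C = "slit_chart M c"
  define p where "p = fst (chart_inv ?C z)"
  have p: "p \<in> fst c" "fst z = snd c p"
    using slit_chart_inv_mem(2,3)[OF M c z subset_refl] by (simp_all add: p_def)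
  have nz: "snd z \<noteq> 0" using z by (simp add: mem_Times_iff)
  show "\<exists>T. open T \<and> z \<in> T \<and> smooth_on T (ball_energy i \<circ> chart_inv ?C)"
  proof (cases "p \<in> fst d")
    case True
    let ?U = "snd c ` (fst c \<inter> fst d)"
    let ?T = "?U \<times> (- {0::'b})"
    define \<tau> where "\<tau> = snd d \<circ> chart_inv c"
    have oU: "open ?U" by (rule chart_overlap_open[OF M c i'(2)])
    have oT: "open ?T" by (rule open_punctured[OF oU])
    have st: "smooth_on ?U \<tau>" unfolding \<tau>_def by (rule transition_smooth[OF M c i'(2)])
    have sf: "smooth_on ?T fst" and ss: "smooth_on ?T snd"
      using smooth_on_fst[OF oT smooth_on_id[OF oT]] smooth_on_snd[OF oT smooth_on_id[OF oT]] by simp_all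
    have im: "fst ` ?T \<subseteq> ?U" by auto
    have s1: "smooth_on ?T (\<lambda>z. \<tau> (fst z) - a)"
      by (rule smooth_on_diff[OF oT smooth_on_compose[OF oT oU sf st im] smooth_on_const])
    have s2: "smooth_on ?T (\<lambda>z. r\<^sup>2 - (\<tau> (fst z) - a) \<bullet> (\<tau> (fst z) - a))"
      by (rule smooth_on_diff[OF oT smooth_on_const smooth_on_inner[OF oT s1 s1]])
    have s3: "smooth_on ?T (\<lambda>z. flat_exp 0 (r\<^sup>2 - (\<tau> (fst z) - a) \<bullet> (\<tau> (fst z) - a)))"
      by (rule smooth_on_compose[OF oT open_UNIV s2 smooth_on_flat_exp]) simp
    have s4: "smooth_on ?T (\<lambda>z. frechet_derivative \<tau> (at (fst z)) (snd z))"
      by (rule smooth_on_frechet_derivative[OF oT oU st sf ss im])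
    have "smooth_on ?T (ball_energy i \<circ> chart_inv ?C)"
    proof (rule smooth_on_cong[OF oT _ smooth_on_mult[OF oT s3 smooth_on_inner[OF oT s4 s4]]])
      fix z assume z: "z \<in> ?T"
      let ?y = "chart_inv ?C z"
      have y: "?y \<in> points (slit_bundle M)" "fst ?y \<in> fst c \<inter> fst d" "snd c (fst ?y) = fst z" "snd ?y c = snd z"
        using slit_chart_inv_mem[OF M c z] by blast+
      have yc: "fst ?y \<in> fst c" and yd: "fst ?y \<in> fst d" using y(2) by blast+
      have "?y \<in> tangent_space M (fst ?y)" using y(1) by (simp add: mem_points_slit)
      from tangent_space_coord_change[OF this c i'(2) yc yd]
      have D: "snd ?y d = frechet_derivative \<tau> (at (fst z)) (snd z)"
        unfolding y(3,4) \<tau>_def .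
      have t: "snd d (fst ?y) = \<tau> (fst z)"
        unfolding \<tau>_def y(3)[symmetric] comp_apply chart_inv_chart[OF M c yc] ..
      show "flat_exp 0 (r\<^sup>2 - (\<tau> (fst z) - a) \<bullet> (\<tau> (fst z) - a)) *
          (frechet_derivative \<tau> (at (fst z)) (snd z) \<bullet> frechet_derivative \<tau> (at (fst z)) (snd z))
        = (ball_energy i \<circ> chart_inv ?C) z"
        unfolding comp_apply ball_energy_def i'(1) prod.case D t ..
    qed
    moreover have "z \<in> ?T" using True p nz by (simp add: mem_Times_iff)
    ultimately show ?thesis using oT by blast
  next
    case False
    \<comment> \<open>Closedness of this compact set is where the Hausdorff property enters; its
      complement is the neighbourhood on which the energy is 0.\<close>
    define K where "K = chart_inv d ` cball a r"
    have "compactin (mtop M) K"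
      unfolding K_def by (rule compactin_chart_inv_image[OF M i'(2) compact_cball i'(4)])
    then have "closedin (mtop M) K" by (rule compactin_imp_closedin[OF haus])
    then have "openin (mtop M) (points M - K)"
      unfolding closedin_def topspace_mtop[OF M] by blast
    then have oU: "open (snd c ` ((points M - K) \<inter> fst c))"
      unfolding openin_mtop[OF M] using c by blast
    let ?T = "(snd c ` ((points M - K) \<inter> fst c)) \<times> (- {0::'b})"
    have oT: "open ?T" by (rule open_punctured[OF oU])
    have "smooth_on ?T (ball_energy i \<circ> chart_inv ?C)"
    proof (rule smooth_on_cong[OF oT _ smooth_on_const])
      fix z assume z: "z \<in> ?T"
      let ?y = "chart_inv ?C z"
      have y: "?y \<in> points (slit_bundle M)" "fst ?y \<in> (points M - K) \<inter> fst c"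
        using slit_chart_inv_mem[OF M c z] by blast+
      have "chart_ball i \<subseteq> K" unfolding K_def i'(1) fst_conv snd_conv by (rule image_mono[OF ball_subset_cball])
      then have "fst ?y \<notin> chart_ball i" using y(2) by blast
      then show "0 = (ball_energy i \<circ> chart_inv ?C) z"
        using ball_energy_eq_0[OF M i y(1)] by simp
    qed
    moreover have "p \<notin> K"
    proof
      assume "p \<in> K"
      then obtain x where x: "x \<in> cball a r" "p = chart_inv d x" unfolding K_def by blast
      have "x \<in> snd d ` fst d" using i'(4) x(1) by (rule subsetD)
      then have "p \<in> fst d" unfolding x(2) by (rule chart_inv_into) simp
      then show False using False by simp
    qed
    then have "p \<in> (points M - K) \<inter> fst c" using p(1) c unfolding points_def by blast
    then have "z \<in> ?T" using p(2) nz by (simp add: mem_Times_iff)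
    ultimately show ?thesis using oT by blast
  qed
qed

text \<open>\<open>E\<close> is the quadratic form of a Riemannian metric on \<open>M\<close>. The
  bump functions are not normalised to sum 1, since positivity and degree 2 suffice for what
  follows.\<close>

lemma ex_energy:
  assumes sm: "smooth_manifold M"
  obtains E where "smooth_function (slit_bundle M) E" "\<And>y. y \<in> points (slit_bundle M) \<Longrightarrow> 0 < E y"
    "\<And>y t. y \<in> points (slit_bundle M) \<Longrightarrow> E (tscale t y) = t\<^sup>2 * E y"
proof -
  have M: "smooth_atlas M" and haus: "Hausdorff_space (mtop M)"
    using sm by (simp_all add: smooth_manifold_def)
  obtain I where I: "I \<subseteq> chart_balls M" "points M \<subseteq> (\<Union>i\<in>I. chart_ball i)"
    "\<And>p. p \<in> points M \<Longrightarrow> \<exists>N. openin (mtop M) N \<and> p \<in> N \<and> finite {i \<in> I. chart_ball i \<inter> N \<noteq> {}}"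
    by (rule ex_locally_finite_chart_balls[OF sm]) (rule that)
  define E where "E = (\<lambda>y. \<Sum>i\<in>{i \<in> I. fst y \<in> chart_ball i}. ball_energy i y)"
  have pM: "fst y \<in> points M" if "y \<in> points (slit_bundle M)" for y
    by (rule tangent_space_points[of y]) (use that in \<open>simp add: mem_points_slit\<close>)
  \<comment> \<open>The index set in the definition of \<open>E\<close> varies with
    \<open>y\<close>. Enlarging it by vanishing terms gives one finite index set valid for all base
    points in \<open>N\<close>, so that \<open>E\<close> is locally a fixed finite sum.\<close>
  have E_eq: "E y = (\<Sum>i\<in>{i \<in> I. chart_ball i \<inter> N \<noteq> {}}. ball_energy i y)"
    if y: "y \<in> points (slit_bundle M)" and N: "fst y \<in> N" "finite {i \<in> I. chart_ball i \<inter> N \<noteq> {}}" for y N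
    unfolding E_def
  proof (rule sum.mono_neutral_left[OF N(2)])
    show "{i \<in> I. fst y \<in> chart_ball i} \<subseteq> {i \<in> I. chart_ball i \<inter> N \<noteq> {}}" using N(1) by blast
    show "\<forall>i\<in>{i \<in> I. chart_ball i \<inter> N \<noteq> {}} - {i \<in> I. fst y \<in> chart_ball i}. ball_energy i y = 0"
      using ball_energy_eq_0[OF M _ y] I(1) by blast
  qed
  show ?thesis
  proof (rule that[of E])
    show "0 < E y" if y: "y \<in> points (slit_bundle M)" for y
    proof -
      have "fst y \<in> (\<Union>i\<in>I. chart_ball i)" using I(2) pM[OF y] by (rule subsetD)
      then obtain i where i: "i \<in> I" "fst y \<in> chart_ball i" by (rule UN_E)
      obtain N where N: "fst y \<in> N" "finite {i \<in> I. chart_ball i \<inter> N \<noteq> {}}" using I(3)[OF pM[OF y]] by blast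
      have iJ: "i \<in> {i \<in> I. chart_ball i \<inter> N \<noteq> {}}" using i N(1) by blast
      have "0 < ball_energy i y" using ball_energy_pos[OF M _ y i(2)] I(1) i(1) by blast
      then show ?thesis
        unfolding E_eq[OF y N] by (rule sum_pos2[OF N(2) iJ]) (rule ball_energy_nonneg)
    qed
    show "E (tscale t y) = t\<^sup>2 * E y" if "y \<in> points (slit_bundle M)" for y t
      by (simp add: E_def ball_energy_tscale sum_distrib_left)
    have "smooth_on (snd (slit_chart M c) ` fst (slit_chart M c)) (E \<circ> chart_inv (slit_chart M c))"
      if c: "c \<in> M" for c
      unfolding slit_chart_image[OF M c]
    proof (rule smooth_on_local)
      fix z assume z: "z \<in> (snd c ` fst c) \<times> (- {0::'b})"
      let ?C = "slit_chart M c"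
      define p where "p = fst (chart_inv ?C z)"
      have p: "p \<in> fst c" "fst z = snd c p"
        using slit_chart_inv_mem(2,3)[OF M c z subset_refl] by (simp_all add: p_def)
      have "p \<in> points M" using p(1) c unfolding points_def by blast
      then obtain N where N: "openin (mtop M) N" "p \<in> N" "finite {i \<in> I. chart_ball i \<inter> N \<noteq> {}}"
        using I(3) by blast
      let ?J = "{i \<in> I. chart_ball i \<inter> N \<noteq> {}}"
      let ?T = "(snd c ` (N \<inter> fst c)) \<times> (- {0::'b})"
      have oT: "open ?T" using N(1) c unfolding openin_mtop[OF M] by (intro open_punctured) blast
      have "smooth_on ?T (\<lambda>z. \<Sum>i\<in>?J. (ball_energy i \<circ> chart_inv ?C) z)"
      proof (rule smooth_on_sum[OF oT])
        fix i assume "i \<in> ?J"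
        then have "i \<in> chart_balls M" using I(1) by blast
        from smooth_ball_energy[OF M haus this c]
        show "smooth_on ?T (ball_energy i \<circ> chart_inv ?C)"
          unfolding slit_chart_image[OF M c] by (rule smooth_on_subset) (intro Sigma_mono image_mono Int_lower2 subset_refl)
      qed
      then have "smooth_on ?T (E \<circ> chart_inv ?C)"
      proof (rule smooth_on_cong[OF oT, rotated])
        fix z assume z: "z \<in> ?T"
        have "chart_inv ?C z \<in> points (slit_bundle M)" "fst (chart_inv ?C z) \<in> N"
          using slit_chart_inv_mem(1,2)[OF M c z] by blast+
        then show "(\<Sum>i\<in>?J. (ball_energy i \<circ> chart_inv ?C) z) = (E \<circ> chart_inv ?C) z"
          unfolding comp_apply by (rule E_eq[OF _ _ N(3), symmetric])
      qed
      moreover have "z \<in> ?T" using z p N(2) by (simp add: mem_Times_iff)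
      ultimately show "\<exists>T. open T \<and> z \<in> T \<and> smooth_on T (E \<circ> chart_inv ?C)" using oT by blast
    qed
    then show "smooth_function (slit_bundle M) E"
      unfolding smooth_function_def slit_bundle_def by blast
  qed
qed

section \<open>Sprays\<close>

text \<open>The curve \<open>s \<mapsto> (x, s v)\<close> has velocity \<open>(0, v)\<close> at
  \<open>s = 1\<close>. Only positive \<open>s\<close> are used, so the curve stays in the punctured
  fibre when \<open>v\<close> is nonzero.\<close>

lemma has_derivative_radial:
  fixes f :: "'a::real_normed_vector \<times> 'b::real_normed_vector \<Rightarrow> 'c::real_normed_vector"
  assumes D: "(f has_derivative D) (at (x, v))"
    and g: "(g has_vector_derivative w) (at 1)" and eq: "\<And>s. 0 < s \<Longrightarrow> f (x, s *\<^sub>R v) = g s"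
  shows "D (0, v) = w"
proof -
  have "((\<lambda>s::real. s *\<^sub>R v) has_derivative (\<lambda>s. s *\<^sub>R v)) (at 1)"
    by (rule bounded_linear_imp_has_derivative[OF bounded_linear_scaleR_left])
  from has_derivative_Pair[OF has_derivative_const this]
  have h: "((\<lambda>s::real. (x, s *\<^sub>R v)) has_derivative (\<lambda>s. (0, s *\<^sub>R v))) (at 1)" .
  have "(f has_derivative D) (at (x, 1 *\<^sub>R v))" using D by simp
  from diff_chain_at[OF h this]
  have "(f \<circ> (\<lambda>s. (x, s *\<^sub>R v)) has_derivative D \<circ> (\<lambda>s. (0, s *\<^sub>R v))) (at 1)" .
  then have "(g has_derivative D \<circ> (\<lambda>s. (0, s *\<^sub>R v))) (at 1)"
    by (rule has_derivative_transform_within_open[where s="{0<..}"]) (simp_all add: eq)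
  moreover have "(g has_derivative (\<lambda>s. s *\<^sub>R w)) (at 1)"
    using g by (simp only: has_vector_derivative_def)
  ultimately have "D \<circ> (\<lambda>s. (0, s *\<^sub>R v)) = (\<lambda>s. s *\<^sub>R w)" by (rule has_derivative_unique)
  then have "(D \<circ> (\<lambda>s. (0, s *\<^sub>R v))) 1 = 1 *\<^sub>R w" by (rule fun_cong)
  then show ?thesis by simp
qed

lemma euler_quadratic:
  fixes f :: "'a::real_normed_vector \<times> 'b::real_normed_vector \<Rightarrow> 'c::real_normed_vector"
  assumes "(f has_derivative D) (at (x, v))" "\<And>s. 0 < s \<Longrightarrow> f (x, s *\<^sub>R v) = s\<^sup>2 *\<^sub>R f (x, v)"
  shows "D (0, v) = 2 *\<^sub>R f (x, v)"
proof (rule has_derivative_radial[OF assms(1) _ assms(2)])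
  have "((\<lambda>s::real. s\<^sup>2) has_real_derivative 2) (at 1)"
    by (auto intro!: derivative_eq_intros)
  then show "((\<lambda>s. s\<^sup>2 *\<^sub>R f (x, v)) has_vector_derivative 2 *\<^sub>R f (x, v)) (at 1)"
    using has_vector_derivative_scaleR[OF _ has_vector_derivative_const, of "\<lambda>s. s\<^sup>2" 2 1 UNIV "f (x, v)"] by simp
qed

lemma tscale_tvec_of:
  assumes M: "smooth_atlas M" and c: "c \<in> M" "p \<in> fst c"
  shows "tscale t (tvec_of M c p v) = tvec_of M c p (t *\<^sub>R v)"
  by (rule tangent_space_eqI[OF tscale_tangent[OF M tvec_of_tangent[OF M c]] tvec_of_tangent[OF M c] c])
    (simp add: snd_tvec_of[OF M c])

lemma liouville_coord:
  assumes "c \<in> M" "y \<in> points (slit_bundle M)" "fst y \<in> fst c"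
  shows "snd (liouville M y) (slit_chart M c) = (0, snd y c)"
  using assms slit_chart_mem[OF assms(1)] by (simp add: liouville_def mem_slit_chart_iff slit_chart_apply)

text \<open>\<open>liouville\<close> is defined chart by chart; this shows that its components
  transform as those of a tangent vector. Along a fibre the transition map is linear, so its radial
  derivative is again radial.\<close>

lemma liouville_eq_tvec_of:
  assumes M: "smooth_atlas M" and c: "c \<in> M" and y: "y \<in> points (slit_bundle M)" "fst y \<in> fst c"
  shows "liouville M y = tvec_of (slit_bundle M) (slit_chart M c) y (0, snd y c)"
proof (rule prod_eqI)
  let ?C = "slit_chart M c" and ?T = "slit_bundle M"
  have yC: "y \<in> fst ?C" using y by (simp add: mem_slit_chart_iff)
  show "snd (liouville M y) = snd (tvec_of ?T ?C y (0, snd y c))"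
  proof
    fix D show "snd (liouville M y) D = snd (tvec_of ?T ?C y (0, snd y c)) D"
    proof (cases "D \<in> ?T \<and> y \<in> fst D")
      case True
      then obtain d where d: "d \<in> M" "D = slit_chart M d" by (auto simp: slit_bundle_def)
      have yd: "fst y \<in> fst d" using True by (simp add: d(2) mem_slit_chart_iff)
      define \<tau> where "\<tau> = snd d \<circ> chart_inv c"
      define x where "x = snd c (fst y)"
      have nz: "snd y c \<noteq> 0" by (rule points_slit_coord_nonzero[OF M y(1) c y(2)])
      have x: "x \<in> snd c ` (fst c \<inter> fst d)" using y(2) yd by (simp add: x_def)
      have lin: "linear (frechet_derivative \<tau> (at x))"
        unfolding \<tau>_def x_def by (rule coord_change_linear[OF M c d(1) y(2) yd])
      \<comment> \<open>Evaluating along the radial curve avoids the full Jacobian of the transition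
        map, which contains second derivatives of \<open>\<tau>\<close>.\<close>
      have "coord_change ?C D y (0, snd y c) = (0, frechet_derivative \<tau> (at x) (snd y c))"
      proof (rule has_derivative_radial)
        show "(snd D \<circ> chart_inv ?C has_derivative coord_change ?C D y) (at (x, snd y c))"
          using coord_change_has_derivative[OF smooth_atlas_slit[OF M] slit_chart_mem[OF c] _ yC, of D] True
          by (simp add: slit_chart_apply x_def)
        show "(snd D \<circ> chart_inv ?C) (x, s *\<^sub>R snd y c)
            = (\<tau> x, s *\<^sub>R frechet_derivative \<tau> (at x) (snd y c))" if "0 < s" for s
          using slit_transition[OF M c d(1) x, of "s *\<^sub>R snd y c"] that nz
          unfolding d(2) \<tau>_def[symmetric] linear_cmul[OF lin] by simp
        have "((\<lambda>s. s *\<^sub>R frechet_derivative \<tau> (at x) (snd y c)) has_vector_derivative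
            frechet_derivative \<tau> (at x) (snd y c)) (at 1)"
          unfolding has_vector_derivative_def
          by (rule bounded_linear_imp_has_derivative[OF bounded_linear_scaleR_left])
        then show "((\<lambda>s. (\<tau> x, s *\<^sub>R frechet_derivative \<tau> (at x) (snd y c))) has_vector_derivative
            (0, frechet_derivative \<tau> (at x) (snd y c))) (at 1)"
          by (rule has_vector_derivative_Pair[OF has_vector_derivative_const])
      qed
      moreover have "frechet_derivative \<tau> (at x) (snd y c) = snd y d"
      proof -
        have "y \<in> tangent_space M (fst y)" using y(1) by (simp add: mem_points_slit)
        from tangent_space_coord_change[OF this c d(1) y(2) yd] show ?thesis
          unfolding \<tau>_def x_def by (rule sym)
      qed
      ultimately have "snd (tvec_of ?T ?C y (0, snd y c)) D = (0, snd y d)"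
        unfolding tvec_of_def using True by simp
      then show ?thesis unfolding d(2) liouville_coord[OF d(1) y(1) yd] by (rule sym)
    next
      case False
      then show ?thesis by (auto simp: liouville_def tvec_of_def)
    qed
  qed
qed (simp add: liouville_def)

lemma liouville_tangent:
  assumes M: "smooth_atlas M" and y: "y \<in> points (slit_bundle M)"
  shows "liouville M y \<in> tangent_space (slit_bundle M) y"
proof -
  have "fst y \<in> points M" by (rule tangent_space_points[of y]) (use y in \<open>simp add: mem_points_slit\<close>)
  then obtain c where c: "c \<in> M" "fst y \<in> fst c" unfolding points_def by blast
  show ?thesis
    unfolding liouville_eq_tvec_of[OF M c(1) y c(2)]
    by (rule tvec_of_tangent[OF smooth_atlas_slit[OF M] slit_chart_mem[OF c(1)]])
      (use c(2) y in \<open>simp add: mem_slit_chart_iff\<close>)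
qed

text \<open>
  The bracket condition is kept in the infinitesimal form of Euler's identity because the functions
  \<open>P\<close> of a projective class are given by \<open>\<Delta>(P) = P\<close> only.
\<close>

definition spray_coords ::
  "('p, 'm::euclidean_space) chart set \<Rightarrow> (('p, 'm) tvec \<Rightarrow> (('p, 'm) tvec, 'm \<times> 'm) tvec)
     \<Rightarrow> ('p, 'm) chart \<Rightarrow> ('m \<times> 'm) set \<Rightarrow> ('m \<times> 'm \<Rightarrow> 'm) \<Rightarrow> bool" where
  "spray_coords M \<Gamma> c S W \<longleftrightarrow>
     open S \<and> S \<subseteq> (snd c ` fst c) \<times> (- {0}) \<and> smooth_on S W \<and>
     (\<forall>z\<in>S. frechet_derivative W (at z) (0, snd z) = 2 *\<^sub>R W z) \<and>
     (\<forall>y\<in>points (slit_bundle M). fst y \<in> fst c \<longrightarrow> snd (slit_chart M c) y \<in> S \<longrightarrow>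
        snd (\<Gamma> y) (slit_chart M c) = (snd y c, W (snd (slit_chart M c) y)))"

text \<open>Turns values at points of the bundle into an identity of coordinate functions on
  \<open>S\<close>, as needed to compare derivatives.\<close>

lemma coord_field_eq_on:
  assumes M: "smooth_atlas M" and c: "c \<in> M" and S: "S \<subseteq> (snd c ` fst c) \<times> (- {0})"
    and X: "\<And>y. y \<in> points (slit_bundle M) \<Longrightarrow> fst y \<in> fst c \<Longrightarrow> snd (slit_chart M c) y \<in> S \<Longrightarrow>
      snd (X y) (slit_chart M c) = (f (snd (slit_chart M c) y))"
    and z: "z \<in> S"
  shows "f z = coord_field X (slit_chart M c) z"
proof -
  let ?C = "slit_chart M c"
  have z': "z \<in> (snd c ` fst c) \<times> (- {0})" using S z by (rule subsetD)
  note y = slit_chart_inv_mem[OF M c z' subset_refl]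
  have "snd ?C (chart_inv ?C z) = z" unfolding slit_chart_apply y(3,4) by simp
  then show ?thesis using X[OF y(1,2)] z by (simp add: coord_field_def)
qed

lemma coord_field_spray_coords:
  assumes M: "smooth_atlas M" and c: "c \<in> M" and W: "spray_coords M \<Gamma> c S W" and z: "z \<in> S"
  shows "(snd z, W z) = coord_field \<Gamma> (slit_chart M c) z"
proof (rule coord_field_eq_on[where f="\<lambda>z. (snd z, W z)", OF M c _ _ z])
  show "S \<subseteq> (snd c ` fst c) \<times> (- {0})" using W by (simp add: spray_coords_def)
  show "snd (\<Gamma> y) (slit_chart M c) = (snd (snd (slit_chart M c) y), W (snd (slit_chart M c) y))"
    if "y \<in> points (slit_bundle M)" "fst y \<in> fst c" "snd (slit_chart M c) y \<in> S" for y
    using W that unfolding spray_coords_def by (simp add: slit_chart_apply)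
qed

text \<open>For \<open>\<Gamma> = (y, W)\<close> and \<open>\<Delta> = (0, y)\<close> the coordinate
  formula of the bracket gives \<open>(y, DW(0, y)) - (0, W)\<close>. Euler's identity
  \<open>DW(0, y) = 2 W\<close> makes this equal to \<open>\<Gamma>\<close>.\<close>

lemma sprayI:
  assumes M: "smooth_atlas M"
    and tan: "\<And>y. y \<in> points (slit_bundle M) \<Longrightarrow> \<Gamma> y \<in> tangent_space (slit_bundle M) y"
    and loc: "\<And>c y. c \<in> M \<Longrightarrow> y \<in> points (slit_bundle M) \<Longrightarrow> fst y \<in> fst c \<Longrightarrow>
      \<exists>S W. snd (slit_chart M c) y \<in> S \<and> spray_coords M \<Gamma> c S W"
  shows "spray M \<Gamma>"
  unfolding spray_def smooth_vector_field_def
proof (intro conjI ballI tan)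
  let ?T = "slit_bundle M"
  fix C assume "C \<in> ?T"
  then obtain c where c: "c \<in> M" "C = slit_chart M c" by (auto simp: slit_bundle_def)
  show "smooth_on (snd C ` fst C) (coord_field \<Gamma> C)"
    unfolding c(2)
  proof (rule smooth_on_local)
    fix z assume "z \<in> snd (slit_chart M c) ` fst (slit_chart M c)"
    then obtain y where y: "y \<in> points ?T" "fst y \<in> fst c" "z = snd (slit_chart M c) y"
      using mem_slit_chart_iff by blast
    obtain S W where SW: "z \<in> S" "spray_coords M \<Gamma> c S W" using loc[OF c(1) y(1,2)] y(3) by blast
    then have S: "open S" "smooth_on S W" by (simp_all add: spray_coords_def)
    have "smooth_on S (coord_field \<Gamma> (slit_chart M c))"
      by (rule smooth_on_cong[OF S(1) _ smooth_on_Pair[OF S(1) smooth_on_snd[OF S(1) smooth_on_id[OF S(1)]] S(2)]])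
        (rule coord_field_spray_coords[OF M c(1) SW(2)])
    then show "\<exists>T. open T \<and> z \<in> T \<and> smooth_on T (coord_field \<Gamma> (slit_chart M c))"
      using S(1) SW(1) by blast
  qed
next
  let ?T = "slit_bundle M"
  fix y assume y: "y \<in> points ?T"
  have yM: "fst y \<in> points M" by (rule tangent_space_points[of y]) (use y in \<open>simp add: mem_points_slit\<close>)
  then obtain c where c: "c \<in> M" "fst y \<in> fst c" unfolding points_def by blast
  obtain S W where SW: "snd (slit_chart M c) y \<in> S" "spray_coords M \<Gamma> c S W" using loc[OF c(1) y c(2)] by blast
  have "snd (\<Gamma> y) (slit_chart M c) = (snd y c, W (snd (slit_chart M c) y))"
    using SW y c(2) unfolding spray_coords_def by blast
  moreover have "y \<in> tangent_space M (fst y)" using y by (simp add: mem_points_slit)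
  ultimately show "tangent_map ?T M fst (\<Gamma> y) = y"
    unfolding tangent_map_slit_proj[OF M c y tan[OF y]]
    using tangent_space_eq_tvec_of[of y M "fst y" c] c by simp
next
  let ?T = "slit_bundle M"
  fix y assume y: "y \<in> points ?T"
  show "lie_bracket ?T (liouville M) \<Gamma> y = \<Gamma> y"
  proof (rule prod_eqI)
    show "fst (lie_bracket ?T (liouville M) \<Gamma> y) = fst (\<Gamma> y)"
      using tangent_space_fst[OF tan[OF y]] by (simp add: lie_bracket_def)
    show "snd (lie_bracket ?T (liouville M) \<Gamma> y) = snd (\<Gamma> y)"
    proof
      fix C show "snd (lie_bracket ?T (liouville M) \<Gamma> y) C = snd (\<Gamma> y) C"
      proof (cases "C \<in> ?T \<and> y \<in> fst C")
        case False
        then have "snd (lie_bracket ?T (liouville M) \<Gamma> y) C = 0" by (auto simp: lie_bracket_def)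
        then show ?thesis using tangent_space_0[OF tan[OF y] False] by simp
      next
        case True
        then obtain c where c: "c \<in> M" "C = slit_chart M c" by (auto simp: slit_bundle_def)
        have yc: "fst y \<in> fst c" using True by (simp add: c(2) mem_slit_chart_iff)
        obtain S W where SW: "snd C y \<in> S" "spray_coords M \<Gamma> c S W" using loc[OF c(1) y yc] c(2) by blast
        define z where "z = snd C y"
        have z: "z \<in> S" using SW(1) by (simp add: z_def)
        have sz: "snd z = snd y c" by (simp add: z_def c(2) slit_chart_apply)
        have S: "open S" "S \<subseteq> (snd c ` fst c) \<times> (- {0})" "smooth_on S W"
          and euler: "frechet_derivative W (at z) (0, snd z) = 2 *\<^sub>R W z"
          and \<Gamma>y: "snd (\<Gamma> y) C = (snd y c, W z)"
          using SW(2) z y yc unfolding spray_coords_def z_def c(2) by blast+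
        have "((\<lambda>z. (snd z, W z)) has_derivative (\<lambda>h. (snd h, frechet_derivative W (at z) h))) (at z)"
          by (rule has_derivative_Pair[OF has_derivative_snd[OF has_derivative_ident]
                smooth_on_imp_has_derivative[OF S(3) z]])
        then have "(coord_field \<Gamma> C has_derivative (\<lambda>h. (snd h, frechet_derivative W (at z) h))) (at z)"
          unfolding c(2)
          by (rule has_derivative_transform_within_open[OF _ S(1) z])
            (rule coord_field_spray_coords[OF M c(1) SW(2)])
        then have d\<Gamma>: "frechet_derivative (coord_field \<Gamma> C) (at z)
            = (\<lambda>h. (snd h, frechet_derivative W (at z) h))" by (rule frechet_derivative_eqI)
        have "((\<lambda>z. (0, snd z)) has_derivative (\<lambda>h. (0, snd h))) (at z)"
          by (rule has_derivative_Pair[OF has_derivative_const has_derivative_snd[OF has_derivative_ident]])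
        then have "(coord_field (liouville M) C has_derivative (\<lambda>h. (0, snd h))) (at z)"
          unfolding c(2)
        proof (rule has_derivative_transform_within_open[OF _ S(1) z])
          fix w assume w: "w \<in> S"
          show "(0, snd w) = coord_field (liouville M) (slit_chart M c) w"
          proof (rule coord_field_eq_on[where f="\<lambda>z. (0, snd z)", OF M c(1) S(2) _ w])
            show "snd (liouville M y) (slit_chart M c) = (0, snd (snd (slit_chart M c) y))"
              if "y \<in> points (slit_bundle M)" "fst y \<in> fst c" for y
              unfolding liouville_coord[OF c(1) that] slit_chart_apply snd_conv ..
          qed
        qed
        then have d\<Delta>: "frechet_derivative (coord_field (liouville M) C) (at z) = (\<lambda>h. (0, snd h))"
          by (rule frechet_derivative_eqI)
        have "snd (lie_bracket ?T (liouville M) \<Gamma> y) C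
            = frechet_derivative (coord_field \<Gamma> C) (at z) (snd (liouville M y) C)
            - frechet_derivative (coord_field (liouville M) C) (at z) (snd (\<Gamma> y) C)"
          using True by (simp add: lie_bracket_def z_def)
        also have "\<dots> = (snd y c, 2 *\<^sub>R W z) - (0, W z)"
          unfolding d\<Gamma> d\<Delta> \<Gamma>y using liouville_coord[OF c(1) y yc] euler by (simp add: c(2) sz)
        also have "\<dots> = snd (\<Gamma> y) C" unfolding \<Gamma>y by (simp add: scaleR_2)
        finally show ?thesis .
      qed
    qed
  qed
qed

text \<open>The condition \<open>\<Delta>(P) = P\<close> is Euler's identity of degree 1 for the
  coordinate expression \<open>p\<close>, so \<open>p y\<close> satisfies the one of degree 2 and
  subtracting its double from \<open>W\<close> preserves the identity.\<close>

lemma spray_coords_projective: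
  assumes M: "smooth_atlas M" and c: "c \<in> M" and W: "spray_coords M \<Gamma> c S W"
    and P: "smooth_function (slit_bundle M) P"
    and \<Delta>P: "\<And>y. y \<in> points (slit_bundle M) \<Longrightarrow> vderiv (slit_bundle M) (liouville M y) P = P y"
    and \<Gamma>': "\<And>y. y \<in> points (slit_bundle M) \<Longrightarrow> \<Gamma>' y = tadd (\<Gamma> y) (tscale (- 2 * P y) (liouville M y))"
  shows "spray_coords M \<Gamma>' c S (\<lambda>z. W z - (2 * (P \<circ> chart_inv (slit_chart M c)) z) *\<^sub>R snd z)"
proof -
  let ?C = "slit_chart M c"
  define p where "p = P \<circ> chart_inv ?C"
  have S: "open S" "S \<subseteq> (snd c ` fst c) \<times> (- {0})" "smooth_on S W"
    and euler: "\<And>z. z \<in> S \<Longrightarrow> frechet_derivative W (at z) (0, snd z) = 2 *\<^sub>R W z"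
    and \<Gamma>: "\<And>y. y \<in> points (slit_bundle M) \<Longrightarrow> fst y \<in> fst c \<Longrightarrow> snd ?C y \<in> S \<Longrightarrow>
      snd (\<Gamma> y) ?C = (snd y c, W (snd ?C y))"
    using W unfolding spray_coords_def by blast+
  have "smooth_on (snd ?C ` fst ?C) p"
    using P slit_chart_mem[OF c] unfolding smooth_function_def p_def by blast
  then have sp: "smooth_on S p"
    using S(2) unfolding slit_chart_image[OF M c] by (rule smooth_on_subset)
  have euler_p: "frechet_derivative p (at z) (0, snd z) = p z" if z: "z \<in> S" for z
  proof -
    have z': "z \<in> (snd c ` fst c) \<times> (- {0})" using S(2) z by (rule subsetD)
    note y = slit_chart_inv_mem[OF M c z' subset_refl]
    have Cy: "snd ?C (chart_inv ?C z) = z" unfolding slit_chart_apply y(3,4) by simp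
    have "vderiv (slit_bundle M) (liouville M (chart_inv ?C z)) P
        = frechet_derivative p (at z) (snd (liouville M (chart_inv ?C z)) ?C)"
    proof (rule vderiv_chart[OF smooth_atlas_slit[OF M] liouville_tangent[OF M y(1)] slit_chart_mem[OF c]])
      show "chart_inv ?C z \<in> fst ?C" using y(1,2) by (simp only: mem_slit_chart_iff simp_thms)
      show "(P \<circ> chart_inv ?C has_derivative frechet_derivative p (at z)) (at (snd ?C (chart_inv ?C z)))"
        unfolding Cy p_def[symmetric] by (rule smooth_on_imp_has_derivative[OF sp z])
    qed
    then show ?thesis
      unfolding \<Delta>P[OF y(1)] liouville_coord[OF c y(1,2)] y(4) by (simp add: p_def)
  qed
  have "smooth_on S (\<lambda>z. W z - (2 * p z) *\<^sub>R snd z)"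
    by (rule smooth_on_diff[OF S(1,3) smooth_on_scaleR[OF S(1) smooth_on_mult[OF S(1) smooth_on_const sp]
          smooth_on_snd[OF S(1) smooth_on_id[OF S(1)]]]])
  moreover have "frechet_derivative (\<lambda>z. W z - (2 * p z) *\<^sub>R snd z) (at z) (0, snd z)
      = 2 *\<^sub>R (W z - (2 * p z) *\<^sub>R snd z)" if z: "z \<in> S" for z
  proof -
    have "((\<lambda>z. 2 * p z) has_derivative (\<lambda>h. 2 * frechet_derivative p (at z) h)) (at z)"
      by (rule has_derivative_mult_right[OF smooth_on_imp_has_derivative[OF sp z]])
    from has_derivative_diff[OF smooth_on_imp_has_derivative[OF S(3) z]
        has_derivative_scaleR[OF this has_derivative_snd[OF has_derivative_ident]]]
    have "frechet_derivative (\<lambda>z. W z - (2 * p z) *\<^sub>R snd z) (at z)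
      = (\<lambda>h. frechet_derivative W (at z) h - ((2 * p z) *\<^sub>R snd h + (2 * frechet_derivative p (at z) h) *\<^sub>R snd z))"
      by (rule frechet_derivative_eqI)
    then show ?thesis
      using euler[OF z] euler_p[OF z] by (simp add: algebra_simps scaleR_2[symmetric])
  qed
  moreover have "snd (\<Gamma>' y) ?C = (snd y c, W (snd ?C y) - (2 * p (snd ?C y)) *\<^sub>R snd (snd ?C y))"
    if y: "y \<in> points (slit_bundle M)" "fst y \<in> fst c" "snd ?C y \<in> S" for y
  proof -
    have yC: "y \<in> fst ?C" using y by (simp add: mem_slit_chart_iff)
    have "p (snd ?C y) = P y"
      unfolding p_def comp_apply chart_inv_chart[OF smooth_atlas_slit[OF M] slit_chart_mem[OF c] yC] ..
    show ?thesis
      unfolding \<Gamma>'[OF y(1)] tadd_simps tscale_simps \<Gamma>[OF y] liouville_coord[OF c y(1,2)]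
      using \<open>p (snd ?C y) = P y\<close> by (simp add: slit_chart_apply)
  qed
  ultimately show ?thesis
    unfolding spray_coords_def p_def[symmetric] using S(1,2) by blast
qed

section \<open>The normalised spray of a path geometry\<close>

text \<open>Since \<open>dE(0, y) = 2 E\<close> is nonzero, the equation
  \<open>dE(y, G - k y) = 0\<close> has the unique solution \<open>k = dE(y, G) / (2 E)\<close>. The
  resulting \<open>W = G - k y\<close> is smooth and of degree 2 on every local domain.\<close>

lemma path_geometry_spray:
  fixes M :: "('p, 'm::euclidean_space) chart set"
  assumes sm: "smooth_manifold M" and dim: "DIM('m) = DIM('f::euclidean_space) + 1"
    and \<F>: "path_geometry TYPE('f) M \<F>"
  obtains \<Gamma> where "\<And>y. y \<in> points (slit_bundle M) \<Longrightarrow> \<Gamma> y \<in> tangent_space (slit_bundle M) y"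
    "\<And>c y. c \<in> M \<Longrightarrow> y \<in> points (slit_bundle M) \<Longrightarrow> fst y \<in> fst c \<Longrightarrow>
      \<exists>S W. snd (slit_chart M c) y \<in> S \<and> spray_coords M \<Gamma> c S W"
    "\<And>y. y \<in> points (slit_bundle M) \<Longrightarrow> path_distribution TYPE('f) M \<F> y =
      {tadd (tscale a (liouville M y)) (tscale b (\<Gamma> y)) | a b. True}"
proof -
  let ?T = "slit_bundle M" and ?D = "path_distribution TYPE('f) M \<F>"
  have M: "smooth_atlas M" using sm by (simp add: smooth_manifold_def)
  have T: "smooth_atlas ?T" using M by (rule smooth_atlas_slit)
  obtain E where E: "smooth_function ?T E" "\<And>y. y \<in> points ?T \<Longrightarrow> 0 < E y"
    "\<And>y t. y \<in> points ?T \<Longrightarrow> E (tscale t y) = t\<^sup>2 * E y"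
    by (rule ex_energy[OF sm]) (rule that)
  \<comment> \<open>The description refers to no chart, so the local formulas \<open>W\<close> found
    below are automatically restrictions of one global field.\<close>
  define \<Gamma> where "\<Gamma> = (\<lambda>y. THE v. v \<in> ?D y \<and> tangent_map ?T M fst v = y \<and> vderiv ?T v E = 0)"
  have D_tan: "v \<in> tangent_space ?T y" if "v \<in> ?D y" for v y
    using that unfolding path_distribution_def by blast
  have main: "\<exists>S W. snd (slit_chart M c) y0 \<in> S \<and> spray_coords M \<Gamma> c S W \<and>
      (\<forall>y\<in>points ?T. fst y \<in> fst c \<longrightarrow> snd (slit_chart M c) y \<in> S \<longrightarrow> \<Gamma> y \<in> tangent_space ?T y \<and>
        (\<forall>v\<in>tangent_space ?T y. v \<in> ?D y \<longleftrightarrow> (\<exists>\<alpha> \<beta>. snd v (slit_chart M c)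
          = (\<beta> *\<^sub>R snd y c, \<beta> *\<^sub>R W (snd (slit_chart M c) y) + \<alpha> *\<^sub>R snd y c))))"
    if c: "c \<in> M" and y0: "y0 \<in> points ?T" "fst y0 \<in> fst c" for c y0
  proof -
    let ?C = "slit_chart M c"
    have C: "?C \<in> ?T" using c by (rule slit_chart_mem)
    obtain S G where S: "open S" "snd ?C y0 \<in> S" "S \<subseteq> (snd c ` fst c) \<times> (- {0})"
      and sG: "smooth_on S G"
      and hG: "\<And>x v t. (x, v) \<in> S \<Longrightarrow> 0 < t \<Longrightarrow> (x, t *\<^sub>R v) \<in> S \<and> G (x, t *\<^sub>R v) = t\<^sup>2 *\<^sub>R G (x, v)"
      and DG: "\<And>y v. y \<in> points ?T \<Longrightarrow> fst y \<in> fst c \<Longrightarrow> snd ?C y \<in> S \<Longrightarrow> v \<in> tangent_space ?T y \<Longrightarrow>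
        v \<in> ?D y \<longleftrightarrow> (\<exists>\<alpha> \<beta>. snd v ?C = (\<beta> *\<^sub>R snd y c, \<beta> *\<^sub>R G (snd ?C y) + \<alpha> *\<^sub>R snd y c))"
      by (rule path_distribution_local[OF M dim \<F> c y0]) (rule that)
    define e where "e = E \<circ> chart_inv ?C"
    define de where "de = (\<lambda>z. frechet_derivative e (at z))"
    let ?V = "(snd c ` fst c) \<times> (- {0::'m})"
    have oV: "open ?V" by (rule open_punctured[OF chart_image_open[OF M c]])
    have se: "smooth_on ?V e"
      using E(1) C unfolding smooth_function_def e_def slit_chart_image[OF M c, symmetric] by blast
    have de: "(e has_derivative de z) (at z)" if "z \<in> ?V" for z
      unfolding de_def by (rule smooth_on_imp_has_derivative[OF se that])
    have de_lin: "linear (de z)" if "z \<in> ?V" for z using de[OF that] by (rule has_derivative_linear)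
    have e_pos: "0 < e z" if "z \<in> ?V" for z
      unfolding e_def comp_apply by (rule E(2)[OF slit_chart_inv_mem(1)[OF M c that subset_refl]])
    have e_scale: "e (x, t *\<^sub>R v) = t\<^sup>2 * e (x, v)" if xv: "(x, v) \<in> ?V" and t: "0 < t" for x v t
    proof -
      have x: "x \<in> snd c ` fst c" and v: "v \<noteq> 0" "t *\<^sub>R v \<noteq> 0" using xv t by auto
      have xc: "chart_inv c x \<in> fst c" using x by (rule chart_inv_into) simp
      have "chart_inv ?C (x, t *\<^sub>R v) = tscale t (chart_inv ?C (x, v))"
        unfolding slit_chart_inv[OF M c x v(1)] slit_chart_inv[OF M c x v(2)] tscale_tvec_of[OF M c xc] ..
      then show ?thesis
        unfolding e_def comp_apply using E(3)[OF slit_chart_inv_mem(1)[OF M c xv subset_refl]] by simp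
    qed
    have de_radial: "de (x, v) (0, v) = 2 * e (x, v)" if "(x, v) \<in> ?V" for x v
      using euler_quadratic[OF de[OF that]] e_scale[OF that] by simp
    \<comment> \<open>Obtained by differentiating the identity
      \<open>e (x, t v) = t^2 e (x, v)\<close> in both variables and comparing the two
      derivatives.\<close>
    have de_scale: "de (x, t *\<^sub>R v) (a, t *\<^sub>R b) = t\<^sup>2 * de (x, v) (a, b)"
      if xv: "(x, v) \<in> ?V" and t: "0 < t" for x v t a b
    proof -
      have "(x, t *\<^sub>R v) \<in> ?V" using xv t by auto
      have l: "((\<lambda>z. (fst z, t *\<^sub>R snd z)) has_derivative (\<lambda>h. (fst h, t *\<^sub>R snd h))) (at (x, v))"
        by (rule has_derivative_Pair[OF has_derivative_fst[OF has_derivative_ident]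
              has_derivative_scaleR_right[OF has_derivative_snd[OF has_derivative_ident]]])
      have "(e has_derivative de (x, t *\<^sub>R v)) (at (fst (x, v), t *\<^sub>R snd (x, v)))"
        using de[OF \<open>(x, t *\<^sub>R v) \<in> ?V\<close>] by simp
      from diff_chain_at[OF l this]
      have "((\<lambda>z. t\<^sup>2 * e z) has_derivative de (x, t *\<^sub>R v) \<circ> (\<lambda>h. (fst h, t *\<^sub>R snd h))) (at (x, v))"
      proof (rule has_derivative_transform_within_open[OF _ oV xv])
        fix z assume "z \<in> ?V"
        then have "(fst z, snd z) \<in> ?V" by simp
        from e_scale[OF this t] show "(e \<circ> (\<lambda>z. (fst z, t *\<^sub>R snd z))) z = t\<^sup>2 * e z" by simp
      qed
      moreover have "((\<lambda>z. t\<^sup>2 * e z) has_derivative (\<lambda>h. t\<^sup>2 * de (x, v) h)) (at (x, v))"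
        by (rule has_derivative_mult_right[OF de[OF xv]])
      ultimately have "de (x, t *\<^sub>R v) \<circ> (\<lambda>h. (fst h, t *\<^sub>R snd h)) = (\<lambda>h. t\<^sup>2 * de (x, v) h)"
        by (rule has_derivative_unique)
      from fun_cong[OF this, of "(a, b)"] show ?thesis by simp
    qed
    \<comment> \<open>The coefficient of \<open>\<Delta>\<close> to be removed from
      \<open>(y, G)\<close> so that the derivative of \<open>E\<close> becomes 0.\<close>
    define k where "k = (\<lambda>z. de z (snd z, G z) * inverse (2 * e z))"
    define W where "W = (\<lambda>z. G z - k z *\<^sub>R snd z)"
    have SV: "z \<in> ?V" if "z \<in> S" for z using S(3) that by (rule subsetD)
    have ss: "smooth_on S snd" using smooth_on_snd[OF S(1) smooth_on_id[OF S(1)]] .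
    have "smooth_on S e" by (rule smooth_on_subset[OF se S(3)])
    then have s2e: "smooth_on S (\<lambda>z. 2 * e z)" by (rule smooth_on_mult[OF S(1) smooth_on_const])
    have "smooth_on S (\<lambda>z. de z (snd z, G z))"
      unfolding de_def
      by (rule smooth_on_frechet_derivative[OF S(1) oV se smooth_on_id[OF S(1)] smooth_on_Pair[OF S(1) ss sG]])
        (use SV in blast)
    moreover have "smooth_on S (\<lambda>z. inverse (2 * e z))"
    proof (rule smooth_on_inverse[OF S(1) s2e])
      show "2 * e z \<noteq> 0" if "z \<in> S" for z using e_pos[OF SV[OF that]] by simp
    qed
    ultimately have sk: "smooth_on S k" unfolding k_def by (rule smooth_on_mult[OF S(1)])
    have sW: "smooth_on S W"
      unfolding W_def by (rule smooth_on_diff[OF S(1) sG smooth_on_scaleR[OF S(1) sk ss]])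
    \<comment> \<open>Replacing \<open>v\<close> by \<open>t v\<close> multiplies
      \<open>de z (snd z, G z)\<close> by \<open>t^3\<close> and \<open>e\<close> by
      \<open>t^2\<close>. Hence \<open>k\<close> has degree 1 and \<open>k z\<close> times the fibre
      variable has degree 2, like \<open>G\<close>.\<close>
    have W_scale: "W (x, t *\<^sub>R v) = t\<^sup>2 *\<^sub>R W (x, v)" if xv: "(x, v) \<in> S" and t: "0 < t" for x v t
    proof -
      have V: "(x, v) \<in> ?V" using xv by (rule SV)
      have "de (x, t *\<^sub>R v) (t *\<^sub>R v, t\<^sup>2 *\<^sub>R G (x, v)) = t\<^sup>2 * de (x, v) (t *\<^sub>R v, t *\<^sub>R G (x, v))"
        using de_scale[OF V t, of "t *\<^sub>R v" "t *\<^sub>R G (x, v)"] by (simp add: power2_eq_square)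
      also have "de (x, v) (t *\<^sub>R v, t *\<^sub>R G (x, v)) = t * de (x, v) (v, G (x, v))"
        using linear_cmul[OF de_lin[OF V], of t "(v, G (x, v))"] by simp
      finally have "k (x, t *\<^sub>R v) = t * k (x, v)"
        unfolding k_def e_scale[OF V t] conjunct2[OF hG[OF xv t]] snd_conv
        using t e_pos[OF V] by (simp add: field_simps)
      then show ?thesis
        unfolding W_def conjunct2[OF hG[OF xv t]] by (simp add: power2_eq_square scaleR_diff_right)
    qed
    have coords: "\<Gamma> y \<in> tangent_space ?T y \<and> snd (\<Gamma> y) ?C = (snd y c, W (snd ?C y))"
      if y: "y \<in> points ?T" "fst y \<in> fst c" "snd ?C y \<in> S" for y
    proof -
      define z where "z = snd ?C y"
      define \<eta> where "\<eta> = snd y c"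
      have z: "z = (snd c (fst y), \<eta>)" by (simp add: z_def \<eta>_def slit_chart_apply)
      have sz: "snd z = \<eta>" by (simp add: z)
      have zS: "z \<in> S" using y(3) by (simp add: z_def)
      then have zV: "z \<in> ?V" by (rule SV)
      have \<eta>0: "\<eta> \<noteq> 0" unfolding \<eta>_def by (rule points_slit_coord_nonzero[OF M y(1) c y(2)])
      have yC: "y \<in> fst ?C" using y by (simp add: mem_slit_chart_iff)
      have yT: "y \<in> tangent_space M (fst y)" using y(1) by (simp add: mem_points_slit)
      have vE: "vderiv ?T v E = de z (snd v ?C)" if "v \<in> tangent_space ?T y" for v
        by (rule vderiv_chart[OF T that C yC]) (use de[OF zV] in \<open>simp only: e_def z_def\<close>)
      have de_sum: "de z (\<eta>, G z + \<alpha> *\<^sub>R \<eta>) = de z (\<eta>, G z) + \<alpha> * (2 * e z)" for \<alpha>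
      proof -
        have "de z (\<eta>, G z + \<alpha> *\<^sub>R \<eta>) = de z ((\<eta>, G z) + \<alpha> *\<^sub>R (0, \<eta>))" by simp
        also have "\<dots> = de z (\<eta>, G z) + \<alpha> * de z (0, \<eta>)"
          by (simp only: linear_add[OF de_lin[OF zV]] linear_cmul[OF de_lin[OF zV]] real_scaleR_def)
        finally show ?thesis using de_radial[of "snd c (fst y)" \<eta>] zV unfolding z by simp
      qed
      have kz: "k z = de z (\<eta>, G z) / (2 * e z)" unfolding k_def sz divide_inverse ..
      have Wz: "W z = G z + (- k z) *\<^sub>R \<eta>" unfolding W_def sz by simp
      define v0 where "v0 = tvec_of ?T ?C y (\<eta>, W z)"
      have v0: "v0 \<in> tangent_space ?T y" "snd v0 ?C = (\<eta>, W z)"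
        unfolding v0_def by (rule tvec_of_tangent[OF T C yC], rule snd_tvec_of[OF T C yC])
      have "\<Gamma> y = v0"
        unfolding \<Gamma>_def
      proof (rule the_equality, intro conjI)
        have "snd v0 ?C = (1 *\<^sub>R \<eta>, 1 *\<^sub>R G z + (- k z) *\<^sub>R \<eta>)" unfolding v0(2) Wz by simp
        then show "v0 \<in> ?D y" unfolding DG[OF y v0(1)] \<eta>_def z_def by blast
        show "tangent_map ?T M fst v0 = y"
          unfolding tangent_map_slit_proj[OF M c y(2,1) v0(1)] v0(2) fst_conv \<eta>_def
          by (rule tangent_space_eq_tvec_of[OF yT c y(2), symmetric])
        show "vderiv ?T v0 E = 0"
          unfolding vE[OF v0(1)] v0(2) Wz de_sum using e_pos[OF zV] by (simp add: kz)
      next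
        \<comment> \<open>Projecting to \<open>y\<close> fixes the coefficient
          \<open>\<beta> = 1\<close>, and the vanishing derivative of \<open>E\<close> then fixes
          \<open>\<alpha> = - k z\<close>.\<close>
        fix v assume v: "v \<in> ?D y \<and> tangent_map ?T M fst v = y \<and> vderiv ?T v E = 0"
        then have vT: "v \<in> tangent_space ?T y" using D_tan by blast
        obtain \<alpha> \<beta> where ab: "snd v ?C = (\<beta> *\<^sub>R \<eta>, \<beta> *\<^sub>R G z + \<alpha> *\<^sub>R \<eta>)"
          using v DG[OF y vT] unfolding \<eta>_def z_def by blast
        have "y = tvec_of M c (fst y) (\<beta> *\<^sub>R \<eta>)"
          using v unfolding tangent_map_slit_proj[OF M c y(2,1) vT] ab fst_conv by simp
        then have "snd y c = snd (tvec_of M c (fst y) (\<beta> *\<^sub>R \<eta>)) c" by (rule arg_cong)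
        then have "\<eta> = \<beta> *\<^sub>R \<eta>" unfolding snd_tvec_of[OF M c y(2)] \<eta>_def .
        then have "(1 - \<beta>) *\<^sub>R \<eta> = 0" by (simp add: scaleR_diff_left)
        then have \<beta>: "\<beta> = 1" using \<eta>0 by simp
        have "de z (\<eta>, G z) + \<alpha> * (2 * e z) = 0"
          using v unfolding vE[OF vT] ab \<beta> by (simp add: de_sum)
        then have "\<alpha> = - k z" using e_pos[OF zV] by (simp add: kz field_simps)
        then have "snd v ?C = snd v0 ?C" unfolding ab v0(2) Wz \<beta> by simp
        then show "v = v0" by (rule tangent_space_eqI[OF vT v0(1) C yC])
      qed
      then show ?thesis using v0 unfolding \<eta>_def z_def by simp
    qed
    have "spray_coords M \<Gamma> c S W"
      unfolding spray_coords_def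
    proof (intro conjI S sW ballI impI)
      fix z assume z: "z \<in> S"
      have z': "(fst z, snd z) \<in> S" using z by simp
      have "(W has_derivative frechet_derivative W (at z)) (at (fst z, snd z))"
        using smooth_on_imp_has_derivative[OF sW z] by simp
      from euler_quadratic[OF this W_scale[OF z']]
      show "frechet_derivative W (at z) (0, snd z) = 2 *\<^sub>R W z" by simp
    next
      fix y assume "y \<in> points ?T" "fst y \<in> fst c" "snd ?C y \<in> S"
      then show "snd (\<Gamma> y) ?C = (snd y c, W (snd ?C y))" using coords by blast
    qed
    moreover have "v \<in> ?D y \<longleftrightarrow> (\<exists>\<alpha> \<beta>. snd v ?C = (\<beta> *\<^sub>R snd y c, \<beta> *\<^sub>R W (snd ?C y) + \<alpha> *\<^sub>R snd y c))"
      if y: "y \<in> points ?T" "fst y \<in> fst c" "snd ?C y \<in> S" and v: "v \<in> tangent_space ?T y" for y v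
    proof -
      \<comment> \<open>\<open>W\<close> and \<open>G\<close> differ by a multiple of the fibre
        variable, so together with \<open>\<Delta>\<close> they span the same plane; only the
        coefficient of \<open>\<Delta>\<close> shifts by \<open>\<beta> * K\<close>.\<close>
      define K where "K = k (snd ?C y)"
      have W: "\<beta> *\<^sub>R W (snd ?C y) + \<alpha> *\<^sub>R snd y c = \<beta> *\<^sub>R G (snd ?C y) + (\<alpha> - \<beta> * K) *\<^sub>R snd y c" for \<alpha> \<beta>
        by (simp add: W_def K_def slit_chart_apply algebra_simps)
      have G: "\<beta> *\<^sub>R G (snd ?C y) + \<alpha> *\<^sub>R snd y c = \<beta> *\<^sub>R W (snd ?C y) + (\<alpha> + \<beta> * K) *\<^sub>R snd y c" for \<alpha> \<beta>
        unfolding W by simp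
      show ?thesis unfolding DG[OF y v]
      proof
        assume "\<exists>\<alpha> \<beta>. snd v ?C = (\<beta> *\<^sub>R snd y c, \<beta> *\<^sub>R G (snd ?C y) + \<alpha> *\<^sub>R snd y c)"
        then show "\<exists>\<alpha> \<beta>. snd v ?C = (\<beta> *\<^sub>R snd y c, \<beta> *\<^sub>R W (snd ?C y) + \<alpha> *\<^sub>R snd y c)"
          unfolding G by blast
      next
        assume "\<exists>\<alpha> \<beta>. snd v ?C = (\<beta> *\<^sub>R snd y c, \<beta> *\<^sub>R W (snd ?C y) + \<alpha> *\<^sub>R snd y c)"
        then show "\<exists>\<alpha> \<beta>. snd v ?C = (\<beta> *\<^sub>R snd y c, \<beta> *\<^sub>R G (snd ?C y) + \<alpha> *\<^sub>R snd y c)"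
          unfolding W by blast
      qed
    qed
    ultimately show ?thesis using S(2) coords by blast
  qed
  show ?thesis
  proof (rule that[of \<Gamma>])
    show "\<exists>S W. snd (slit_chart M c) y \<in> S \<and> spray_coords M \<Gamma> c S W"
      if "c \<in> M" "y \<in> points ?T" "fst y \<in> fst c" for c y
      using main[OF that] by blast
    fix y assume y: "y \<in> points ?T"
    have "fst y \<in> points M" by (rule tangent_space_points[of y]) (use y in \<open>simp add: mem_points_slit\<close>)
    then obtain c where c: "c \<in> M" "fst y \<in> fst c" unfolding points_def by blast
    let ?C = "slit_chart M c"
    obtain S W where SW: "snd ?C y \<in> S" "spray_coords M \<Gamma> c S W"
      and "\<forall>y\<in>points ?T. fst y \<in> fst c \<longrightarrow> snd ?C y \<in> S \<longrightarrow> \<Gamma> y \<in> tangent_space ?T y \<and>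
        (\<forall>v\<in>tangent_space ?T y. v \<in> ?D y \<longleftrightarrow> (\<exists>\<alpha> \<beta>. snd v ?C
          = (\<beta> *\<^sub>R snd y c, \<beta> *\<^sub>R W (snd ?C y) + \<alpha> *\<^sub>R snd y c)))"
      using main[OF c(1) y c(2)] by blast
    then have \<Gamma>T: "\<Gamma> y \<in> tangent_space ?T y"
      and D: "\<And>v. v \<in> tangent_space ?T y \<Longrightarrow> v \<in> ?D y \<longleftrightarrow> (\<exists>\<alpha> \<beta>. snd v ?C
          = (\<beta> *\<^sub>R snd y c, \<beta> *\<^sub>R W (snd ?C y) + \<alpha> *\<^sub>R snd y c))"
      using y c(2) by blast+
    show "\<Gamma> y \<in> tangent_space ?T y" by (rule \<Gamma>T)
    have \<Gamma>y: "snd (\<Gamma> y) ?C = (snd y c, W (snd ?C y))"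
      using SW y c(2) unfolding spray_coords_def by blast
    have yC: "y \<in> fst ?C" using y c(2) by (simp add: mem_slit_chart_iff)
    have comb: "tadd (tscale a (liouville M y)) (tscale b (\<Gamma> y)) \<in> tangent_space ?T y" for a b
      by (intro tadd_tangent[OF T] tscale_tangent[OF T] liouville_tangent[OF M y] \<Gamma>T)
    have comb_coord: "snd (tadd (tscale a (liouville M y)) (tscale b (\<Gamma> y))) ?C
        = (b *\<^sub>R snd y c, b *\<^sub>R W (snd ?C y) + a *\<^sub>R snd y c)" for a b
      by (simp add: liouville_coord[OF c(1) y c(2)] \<Gamma>y)
    show "?D y = {tadd (tscale a (liouville M y)) (tscale b (\<Gamma> y)) | a b. True}"
    proof (intro equalityI subsetI)
      fix v assume v: "v \<in> ?D y"
      then have vT: "v \<in> tangent_space ?T y" by (rule D_tan)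
      obtain a b where "snd v ?C = (b *\<^sub>R snd y c, b *\<^sub>R W (snd ?C y) + a *\<^sub>R snd y c)"
        using v D[OF vT] by blast
      then have "snd v ?C = snd (tadd (tscale a (liouville M y)) (tscale b (\<Gamma> y))) ?C"
        unfolding comb_coord .
      from tangent_space_eqI[OF vT comb slit_chart_mem[OF c(1)] yC this]
      show "v \<in> {tadd (tscale a (liouville M y)) (tscale b (\<Gamma> y)) | a b. True}" by blast
    next
      fix v assume "v \<in> {tadd (tscale a (liouville M y)) (tscale b (\<Gamma> y)) | a b. True}"
      then obtain a b where v: "v = tadd (tscale a (liouville M y)) (tscale b (\<Gamma> y))" by blast
      show "v \<in> ?D y" unfolding v D[OF comb] comb_coord by blast
    qed
  qed
qed

theorem theorem1:
  fixes M :: "('p, 'm::euclidean_space) chart set"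
    and \<F> :: "(('p, 'm) tvec set, real) chart set set"
  assumes "smooth_manifold M"
    and "DIM('m) \<ge> 3"
    and "DIM('m) = DIM('f::euclidean_space) + 1"
    and "path_geometry TYPE('f) M \<F>"
  shows "\<exists>\<Gamma>. spray M \<Gamma> \<and>
    (\<forall>\<Gamma>'\<in>projective_class M \<Gamma>. spray M \<Gamma>' \<and>
      (\<forall>y\<in>points (slit_bundle M).
         path_distribution TYPE('f) M \<F> y =
         {tadd (tscale a (liouville M y)) (tscale b (\<Gamma>' y)) | a b. True}))"
proof -
  let ?T = "slit_bundle M"
  have M: "smooth_atlas M" using assms(1) by (simp add: smooth_manifold_def)
  have T: "smooth_atlas ?T" using M by (rule smooth_atlas_slit)
  obtain \<Gamma> where tan: "\<And>y. y \<in> points ?T \<Longrightarrow> \<Gamma> y \<in> tangent_space ?T y"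
    and loc: "\<And>c y. c \<in> M \<Longrightarrow> y \<in> points ?T \<Longrightarrow> fst y \<in> fst c \<Longrightarrow>
      \<exists>S W. snd (slit_chart M c) y \<in> S \<and> spray_coords M \<Gamma> c S W"
    and dist: "\<And>y. y \<in> points ?T \<Longrightarrow> path_distribution TYPE('f) M \<F> y =
      {tadd (tscale a (liouville M y)) (tscale b (\<Gamma> y)) | a b. True}"
    by (rule path_geometry_spray[OF assms(1,3,4)]) (rule that)
  have "spray M \<Gamma>" using M tan loc by (rule sprayI)
  moreover have "spray M \<Gamma>' \<and> (\<forall>y\<in>points ?T. path_distribution TYPE('f) M \<F> y =
      {tadd (tscale a (liouville M y)) (tscale b (\<Gamma>' y)) | a b. True})"
    if "\<Gamma>' \<in> projective_class M \<Gamma>" for \<Gamma>'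
  proof -
    obtain P where P: "smooth_function ?T P"
      and \<Delta>P: "\<And>y. y \<in> points ?T \<Longrightarrow> vderiv ?T (liouville M y) P = P y"
      and \<Gamma>': "\<And>y. y \<in> points ?T \<Longrightarrow> \<Gamma>' y = tadd (\<Gamma> y) (tscale (- 2 * P y) (liouville M y))"
      using \<open>\<Gamma>' \<in> projective_class M \<Gamma>\<close> unfolding projective_class_def by blast
    have "spray M \<Gamma>'"
    proof (rule sprayI[OF M])
      show "\<Gamma>' y \<in> tangent_space ?T y" if y: "y \<in> points ?T" for y
        unfolding \<Gamma>'[OF y] by (intro tadd_tangent[OF T] tscale_tangent[OF T] tan[OF y] liouville_tangent[OF M y])
      show "\<exists>S W. snd (slit_chart M c) y \<in> S \<and> spray_coords M \<Gamma>' c S W"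
        if y: "c \<in> M" "y \<in> points ?T" "fst y \<in> fst c" for c y
        using loc[OF y] spray_coords_projective[OF M y(1) _ P \<Delta>P \<Gamma>'] by blast
    qed
    moreover have "path_distribution TYPE('f) M \<F> y =
        {tadd (tscale a (liouville M y)) (tscale b (\<Gamma>' y)) | a b. True}" if y: "y \<in> points ?T" for y
    proof -
      \<comment> \<open>At a fixed \<open>y\<close> the projective change shifts the coefficient of
        \<open>\<Delta>\<close> by a multiple of \<open>b\<close>, an invertible substitution, so
        the two spans coincide.\<close>
      have eq: "tadd (tscale a (liouville M y)) (tscale b (\<Gamma>' y))
          = tadd (tscale (a - 2 * P y * b) (liouville M y)) (tscale b (\<Gamma> y))" for a b
        unfolding \<Gamma>'[OF y] by (simp add: tadd_def tscale_def fun_eq_iff algebra_simps)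
      have eq': "tadd (tscale a (liouville M y)) (tscale b (\<Gamma> y))
          = tadd (tscale (a + 2 * P y * b) (liouville M y)) (tscale b (\<Gamma>' y))" for a b
        unfolding eq by simp
      show ?thesis
        unfolding dist[OF y]
      proof (intro equalityI subsetI)
        fix v assume "v \<in> {tadd (tscale a (liouville M y)) (tscale b (\<Gamma> y)) | a b. True}"
        then show "v \<in> {tadd (tscale a (liouville M y)) (tscale b (\<Gamma>' y)) | a b. True}"
          unfolding eq' by blast
      next
        fix v assume "v \<in> {tadd (tscale a (liouville M y)) (tscale b (\<Gamma>' y)) | a b. True}"
        then show "v \<in> {tadd (tscale a (liouville M y)) (tscale b (\<Gamma> y)) | a b. True}"
          unfolding eq by blast
      qed
    qed
    ultimately show ?thesis by blast
  qed
  ultimately show ?thesis by blast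
qed

end
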